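(* Let $k$ be a principal ideal domain, let $n,m_1,m_2\geq 2$ be integers, and let $E\in GL_n(k)$, $F_1\in GL_{m_1}(k)$, $F_2\in GL_{m_2}(k)$ be invertible matrices such that the algebras $\mathcal{B}(E,F_1)$ and $\mathcal{B}(E,F_2)$ are faithfully flat over $k$. Then the $\mathcal{B}(E)$-Galois objects $\mathcal{B}(E,F_1)$ and $\mathcal{B}(E,F_2)$ are isomorphic if and only if $m_1=m_2$ and there exists an invertible matrix $P\in GL_{m_1}(k)$ such that $F_1=PF_2P^t$.
   Context: Let $k$ be a commutative ring; $\otimes=\otimes_k$; $M^t$ denotes the transpose of a matrix $M$. Galois objects. Let $H$ be a Hopf algebra over $k$ and $Z$ a left $H$-comodule algebra with coaction $\delta:Z\to H\otimes Z$. Its coinvariants are $Z^{co H}=\{z\in Z\mid \delta(z)=1\otimes z\}$. $Z$ is a (left) $H$-Galois object if $Z^{co H}=k$, the canonical map $\operatorname{can}:Z\otimes Z\to H\otimes Z$, $z\otimes z'\mapsto\delta(z)(1\otimes z')$, is bijective, and $Z$ is faithfully flat over $k$. An isomorphism of $H$-Galois objects is an isomorphism of left $H$-comodule algebras. The Hopf algebra $\mathcal{B}(E)$. For $E\in GL_n(k)$, $\mathcal{B}(E)$ is the $k$-algebra generated by $a_{ij}$, $1\leq i,j\leq n$, subject to the matrix relations $E^{-1}a^tEa=I_n=aE^{-1}a^tE$ where $a=(a_{ij})$. It is a Hopf algebra with $\Delta(a_{ij})=\sum_{l=1}^n a_{il}\otimes a_{lj}$, $\varepsilon(a_{ij})=\delta_{ij}$,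 $S(a)=E^{-1}a^tE$. The algebra $\mathcal{B}(E,F)$. For $E\in GL_n(k)$, $F\in GL_m(k)$, $\mathcal{B}(E,F)$ is the $k$-algebra generated by $z_{ij}$, $1\leq i\leq n$, $1\leq j\leq m$, subject to the matrix relations $F^{-1}z^tEz=I_m$ and $zF^{-1}z^tE=I_n$ where $z=(z_{ij})$. It is a left $\mathcal{B}(E)$-comodule algebra via $\delta(z_{ij})=\sum_{l=1}^n a_{il}\otimes z_{lj}$. Whenever $\mathcal{B}(E,F)$ is faithfully flat over $k$, it is a left $\mathcal{B}(E)$-Galois object. *)

theory Defs
  imports
    "HOL-Algebra.Algebra"
    "HOL-Algebra.Algebraic_Closure_Type"
    "HOL-Library.Poly_Mapping"
    "Jordan_Normal_Form.Matrix"
begin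

text \<open>The base ring is a type \<open>'k\<close> of class \<^class>\<open>comm_ring_1\<close>; as a structure of HOL-Algebra it is
  \<open>ring_of_type_algebra :: 'k ring\<close>. Modules and (not necessarily commutative) algebras over it
  are records of type \<open>('k, 'm) module\<close>. As usual in HOL-Algebra, the fields \<^const>\<open>monoid.mult\<close> and
  \<^const>\<open>one\<close> carry no information when such a record is regarded just as a module.\<close>

definition linear_maps :: "('k, 'm) module \<Rightarrow> ('k, 'n) module \<Rightarrow> ('m \<Rightarrow> 'n) set" where
  "linear_maps M N = {f. f \<in> carrier M \<rightarrow> carrier N \<and>
     (\<forall>x\<in>carrier M. \<forall>y\<in>carrier M. f (x \<oplus>\<^bsub>M\<^esub> y) = f x \<oplus>\<^bsub>N\<^esub> f y) \<and>
     (\<forall>c. \<forall>x\<in>carrier M. f (c \<odot>\<^bsub>M\<^esub> x) = c \<odot>\<^bsub>N\<^esub> f x)}"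

definition quotient_module :: "('k, 'm) module \<Rightarrow> 'm set \<Rightarrow> ('k, 'm set) module" where
  "quotient_module M I =
    \<lparr>carrier = carrier (M Quot I), monoid.mult = monoid.mult (M Quot I), one = one (M Quot I),
     ring.zero = ring.zero (M Quot I), add = add (M Quot I),
     module.smult = (\<lambda>c C. \<Union>x\<in>C. I +>\<^bsub>M\<^esub> (c \<odot>\<^bsub>M\<^esub> x))\<rparr>"

text \<open>The monoid algebra; its underlying module is free on the carrier of the monoid.\<close>

definition monoid_algebra :: "('g, 'r) monoid_scheme \<Rightarrow> ('k::comm_ring_1, 'g \<Rightarrow>\<^sub>0 'k) module" where
  "monoid_algebra G =
    \<lparr>carrier = {p. Poly_Mapping.keys p \<subseteq> carrier G},
     monoid.mult = (\<lambda>p q. \<Sum>u\<in>Poly_Mapping.keys p. \<Sum>v\<in>Poly_Mapping.keys q.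
       Poly_Mapping.single (u \<otimes>\<^bsub>G\<^esub> v) (Poly_Mapping.lookup p u * Poly_Mapping.lookup q v)),
     one = Poly_Mapping.single \<one>\<^bsub>G\<^esub> 1,
     ring.zero = 0,
     add = (+),
     module.smult = (\<lambda>c. Poly_Mapping.map ((*) c))\<rparr>"

text \<open>Let \<open>A\<close> be a module and \<open>C\<close> a coset in a free module. If the linear extension of
  a map \<open>h\<close> on the basis takes only one value on \<open>C\<close>, then \<open>induced A h C\<close> is this value. So
  \<open>induced A h\<close> is the map induced by \<open>h\<close> on a quotient of the free module.\<close>

definition linear_extension :: "('k, 'm) module \<Rightarrow> ('g \<Rightarrow> 'm) \<Rightarrow> ('g \<Rightarrow>\<^sub>0 'k::zero) \<Rightarrow> 'm" where
  "linear_extension A h p = (\<Oplus>\<^bsub>A\<^esub>u\<in>Poly_Mapping.keys p. Poly_Mapping.lookup p u \<odot>\<^bsub>A\<^esub> h u)"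

definition induced :: "('k, 'm) module \<Rightarrow> ('g \<Rightarrow> 'm) \<Rightarrow> ('g \<Rightarrow>\<^sub>0 'k::zero) set \<Rightarrow> 'm" where
  "induced A h C = the_elem (linear_extension A h ` C)"


section \<open>Tensor products\<close>

definition tensor_relators ::
    "('k::comm_ring_1, 'a) module \<Rightarrow> ('k, 'b) module \<Rightarrow> ('a \<times> 'b \<Rightarrow>\<^sub>0 'k) set" where
  "tensor_relators M N =
     {Poly_Mapping.single (x \<oplus>\<^bsub>M\<^esub> x', y) 1 - Poly_Mapping.single (x, y) 1 - Poly_Mapping.single (x', y) 1
        | x x' y. x \<in> carrier M \<and> x' \<in> carrier M \<and> y \<in> carrier N} \<union>
     {Poly_Mapping.single (x, y \<oplus>\<^bsub>N\<^esub> y') 1 - Poly_Mapping.single (x, y) 1 - Poly_Mapping.single (x, y') 1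
        | x y y'. x \<in> carrier M \<and> y \<in> carrier N \<and> y' \<in> carrier N} \<union>
     {Poly_Mapping.single (c \<odot>\<^bsub>M\<^esub> x, y) 1 - Poly_Mapping.single (x, y) c
        | c x y. x \<in> carrier M \<and> y \<in> carrier N} \<union>
     {Poly_Mapping.single (x, c \<odot>\<^bsub>N\<^esub> y) 1 - Poly_Mapping.single (x, y) c
        | c x y. x \<in> carrier M \<and> y \<in> carrier N}"

definition tensor_submodule ::
    "('k::comm_ring_1, 'a) module \<Rightarrow> ('k, 'b) module \<Rightarrow> ('a \<times> 'b \<Rightarrow>\<^sub>0 'k) set" where
  "tensor_submodule M N =
     (\<lambda>I. submodule I ring_of_type_algebra (monoid_algebra (M \<times>\<times> N))) hull tensor_relators M N"

text \<open>For algebras \<open>M\<close> and \<open>N\<close> the submodule \<^const>\<open>tensor_submodule\<close> is a two-sided ideal of the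
  algebra of the monoid \<open>M \<times>\<times> N\<close>, and the multiplication of the quotient is
  \<open>(x \<otimes> y) (x' \<otimes> y') = x x' \<otimes> y y'\<close>.\<close>

definition tensor ::
    "('k::comm_ring_1, 'a) module \<Rightarrow> ('k, 'b) module \<Rightarrow> ('k, ('a \<times> 'b \<Rightarrow>\<^sub>0 'k) set) module" where
  "tensor M N = quotient_module (monoid_algebra (M \<times>\<times> N)) (tensor_submodule M N)"

definition pure_tensor ::
    "('k::comm_ring_1, 'a) module \<Rightarrow> ('k, 'b) module \<Rightarrow> 'a \<Rightarrow> 'b \<Rightarrow> ('a \<times> 'b \<Rightarrow>\<^sub>0 'k) set" where
  "pure_tensor M N x y =
     tensor_submodule M N +>\<^bsub>monoid_algebra (M \<times>\<times> N)\<^esub> Poly_Mapping.single (x, y) 1"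

text \<open>\<open>tensor_map M' N' f g\<close> is the map \<open>f \<otimes> g\<close> into \<open>tensor M' N'\<close>.\<close>

definition tensor_map ::
    "('k::comm_ring_1, 'c) module \<Rightarrow> ('k, 'd) module \<Rightarrow> ('a \<Rightarrow> 'c) \<Rightarrow> ('b \<Rightarrow> 'd) \<Rightarrow>
     ('a \<times> 'b \<Rightarrow>\<^sub>0 'k) set \<Rightarrow> ('c \<times> 'd \<Rightarrow>\<^sub>0 'k) set" where
  "tensor_map M' N' f g = induced (tensor M' N') (\<lambda>(x, y). pure_tensor M' N' (f x) (g y))"


section \<open>Faithful flatness\<close>

definition exact_at ::
    "('k, 'a) module \<Rightarrow> ('k, 'b) module \<Rightarrow> ('k, 'c) module \<Rightarrow> ('a \<Rightarrow> 'b) \<Rightarrow> ('b \<Rightarrow> 'c) \<Rightarrow> bool" where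
  "exact_at N1 N2 N3 f g \<longleftrightarrow> f ` carrier N1 = {y \<in> carrier N2. g y = \<zero>\<^bsub>N3\<^esub>}"

text \<open>A sequence of modules is exact iff it is exact after tensoring with \<open>M\<close>. A definition in HOL
  can only range over test modules whose elements lie in a fixed type \<open>'u\<close>. The resulting property
  is faithful flatness proper as soon as all finitely generated modules have an isomorphic copy
  in \<open>'u\<close>: flatness and faithfulness can be tested on inclusions \<open>I \<subseteq> k\<close> of finitely generated
  ideals and on the quotients of \<open>k\<close>.\<close>

definition faithfully_flat :: "'u itself \<Rightarrow> ('k::comm_ring_1, 'm) module \<Rightarrow> bool" where
  "faithfully_flat _ M \<longleftrightarrow>
     (\<forall>(N1 :: ('k, 'u) module) (N2 :: ('k, 'u) module) (N3 :: ('k, 'u) module) f g.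
        module ring_of_type_algebra N1 \<and> module ring_of_type_algebra N2 \<and>
        module ring_of_type_algebra N3 \<and> f \<in> linear_maps N1 N2 \<and> g \<in> linear_maps N2 N3 \<longrightarrow>
        (exact_at N1 N2 N3 f g \<longleftrightarrow>
         exact_at (tensor M N1) (tensor M N2) (tensor M N3)
           (tensor_map M N2 id f) (tensor_map M N3 id g)))"


section \<open>Isomorphisms of comodule algebras\<close>

text \<open>Here \<open>\<delta>1 : Z1 \<rightarrow> H \<otimes> Z1\<close> and \<open>\<delta>2 : Z2 \<rightarrow> H \<otimes> Z2\<close> are the coactions. An isomorphism of Galois
  objects is by definition an isomorphism of the underlying left comodule algebras; the
  comultiplication and the counit of \<open>H\<close> do not occur in this notion.\<close>

definition comodule_algebra_iso ::
    "('k::comm_ring_1, 'h) module \<Rightarrow>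
     ('k, 'a) module \<Rightarrow> ('a \<Rightarrow> ('h \<times> 'a \<Rightarrow>\<^sub>0 'k) set) \<Rightarrow>
     ('k, 'b) module \<Rightarrow> ('b \<Rightarrow> ('h \<times> 'b \<Rightarrow>\<^sub>0 'k) set) \<Rightarrow> ('a \<Rightarrow> 'b) set" where
  "comodule_algebra_iso H Z1 \<delta>1 Z2 \<delta>2 =
     {\<phi>. \<phi> \<in> ring_iso Z1 Z2 \<and> \<phi> \<in> linear_maps Z1 Z2 \<and>
         (\<forall>x\<in>carrier Z1. \<delta>2 (\<phi> x) = tensor_map H Z2 id \<phi> (\<delta>1 x))}"


section \<open>The algebras $\mathcal{B}(E,F)$\<close>

definition GL :: "nat \<Rightarrow> 'k::comm_ring_1 mat set" where
  "GL n = Units (ring_mat TYPE('k) n ())"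

definition mat_inv :: "'k::comm_ring_1 mat \<Rightarrow> 'k mat" where
  "mat_inv F = inv\<^bsub>ring_mat TYPE('k) (dim_row F) ()\<^esub> F"

definition free_algebra :: "'x set \<Rightarrow> ('k::comm_ring_1, 'x list \<Rightarrow>\<^sub>0 'k) module" where
  "free_algebra V = monoid_algebra \<lparr>carrier = lists V, monoid.mult = (@), one = []\<rparr>"

text \<open>The letter \<open>(i, j)\<close> stands for \<open>z\<^sub>i\<^sub>j\<close>, with indices counted from \<open>0\<close>. The two families of
  relators are the entries of \<open>F\<inverse> z\<^sup>t E z - I\<close> and \<open>z F\<inverse> z\<^sup>t E - I\<close>.\<close>

definition B_relators :: "'k::comm_ring_1 mat \<Rightarrow> 'k mat \<Rightarrow> ((nat \<times> nat) list \<Rightarrow>\<^sub>0 'k) set" where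
  "B_relators E F = (let n = dim_row E; m = dim_row F; F' = mat_inv F in
     {(\<Sum>p<m. \<Sum>q<n. \<Sum>r<n. Poly_Mapping.single [(q, p), (r, j)] (F' $$ (i, p) * E $$ (q, r)))
        - Poly_Mapping.single [] (1\<^sub>m m $$ (i, j)) | i j. i < m \<and> j < m} \<union>
     {(\<Sum>p<m. \<Sum>q<m. \<Sum>r<n. Poly_Mapping.single [(i, p), (r, q)] (F' $$ (p, q) * E $$ (r, j)))
        - Poly_Mapping.single [] (1\<^sub>m n $$ (i, j)) | i j. i < n \<and> j < n})"

type_synonym 'k B_elem = "((nat \<times> nat) list \<Rightarrow>\<^sub>0 'k) set"

definition B_ideal :: "'k::comm_ring_1 mat \<Rightarrow> 'k mat \<Rightarrow> 'k B_elem" where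
  "B_ideal E F = Idl\<^bsub>free_algebra ({..<dim_row E} \<times> {..<dim_row F})\<^esub> B_relators E F"

definition B_alg :: "'k::comm_ring_1 mat \<Rightarrow> 'k mat \<Rightarrow> ('k, 'k B_elem) module" where
  "B_alg E F = quotient_module (free_algebra ({..<dim_row E} \<times> {..<dim_row F})) (B_ideal E F)"

definition B_gen :: "'k::comm_ring_1 mat \<Rightarrow> 'k mat \<Rightarrow> nat \<Rightarrow> nat \<Rightarrow> 'k B_elem" where
  "B_gen E F i j = B_ideal E F +>\<^bsub>free_algebra ({..<dim_row E} \<times> {..<dim_row F})\<^esub> Poly_Mapping.single [(i, j)] 1"

text \<open>The relations of \<open>\<B>(E)\<close> are literally those of \<open>\<B>(E, E)\<close>.\<close>

abbreviation B_hopf :: "'k::comm_ring_1 mat \<Rightarrow> ('k, 'k B_elem) module" where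
  "B_hopf E \<equiv> B_alg E E"

text \<open>The algebra map \<open>\<delta> : \<B>(E, F) \<rightarrow> \<B>(E) \<otimes> \<B>(E, F)\<close> with
  \<open>\<delta>(z\<^sub>i\<^sub>j) = \<Sum>\<^sub>l a\<^sub>i\<^sub>l \<otimes> z\<^sub>l\<^sub>j\<close>: a word goes to the product of the images of its letters.\<close>

definition B_coaction ::
    "'k::comm_ring_1 mat \<Rightarrow> 'k mat \<Rightarrow> 'k B_elem \<Rightarrow> ('k B_elem \<times> 'k B_elem \<Rightarrow>\<^sub>0 'k) set" where
  "B_coaction E F = (let H = B_hopf E; Z = B_alg E F; T = tensor H Z in
     induced T (\<lambda>w. foldr (\<lambda>(i, j) t.
         (\<Oplus>\<^bsub>T\<^esub>l\<in>{..<dim_row E}. pure_tensor H Z (B_gen E E i l) (B_gen E F l j)) \<otimes>\<^bsub>T\<^esub> t) w \<one>\<^bsub>T\<^esub>))"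

definition B_galois_isomorphic :: "'k::comm_ring_1 mat \<Rightarrow> 'k mat \<Rightarrow> 'k mat \<Rightarrow> bool" where
  "B_galois_isomorphic E F1 F2 \<longleftrightarrow>
     comodule_algebra_iso (B_hopf E) (B_alg E F1) (B_coaction E F1) (B_alg E F2) (B_coaction E F2) \<noteq> {}"

text \<open>The type \<open>'k B_elem\<close> contains a copy of every countably generated \<open>'k\<close>-module: such a module
  is a quotient of the free module on the words over \<open>nat \<times> nat\<close>. So this universe of test
  modules is large enough for faithful flatness proper.\<close>

abbreviation B_faithfully_flat :: "'k::comm_ring_1 mat \<Rightarrow> 'k mat \<Rightarrow> bool" where
  "B_faithfully_flat E F \<equiv> faithfully_flat TYPE('k B_elem) (B_alg E F)"

end

theory Submission
  imports Defs "Jordan_Normal_Form.Determinant"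
begin

text \<open>Write \<open>w = F\<inverse> z\<^sup>t E\<close> for the inverse of the generating matrix \<open>z\<close> of \<open>Z = \<B>(E, F)\<close>. The algebra map
  \<open>\<B>(E) \<rightarrow> Z \<otimes> Z\<^sup>o\<^sup>p\<close>, \<open>a \<mapsto> (z \<otimes> 1) (1 \<otimes> w)\<close>, yields a left inverse of the canonical map. Hence,
  if the entries of a matrix \<open>x\<close> over \<open>Z\<close> satisfy \<open>\<delta>(x) = a \<otimes> x\<close>, then \<open>y = w x\<close> satisfies
  \<open>y \<otimes> 1 = 1 \<otimes> y\<close>, and by faithfully flat descent \<open>y\<close> is a matrix \<open>P\<close> over \<open>k\<close>, so that \<open>x = z P\<close>.
  For the image \<open>x\<close> of the generating matrix of \<open>\<B>(E, F\<^sub>1)\<close> in \<open>Z = \<B>(E, F\<^sub>2)\<close> the relations give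
  \<open>F\<^sub>1 = x\<^sup>t E x = P\<^sup>t F\<^sub>2 P\<close>, and \<open>F\<^sub>1\<inverse> P\<^sup>t F\<^sub>2\<close> is a two-sided inverse of \<open>P\<close>, which forces \<open>m\<^sub>1 = m\<^sub>2\<close>.
  Conversely \<open>z \<mapsto> z P\<^sup>t\<close> defines an isomorphism if \<open>F\<^sub>1 = P F\<^sub>2 P\<^sup>t\<close>.\<close>

section \<open>Modules and algebras over a commutative ring type\<close>

text \<open>The opposite algebra enters because transposing reverses products: \<open>w\<close>
  satisfies the relations of type (F, E) only when products are read backwards. In Z \<otimes> Z^op
  the entries of z \<otimes> 1 and 1 \<otimes> w commute, so their matrix product solves the
  relations of B(E). The identity y \<otimes> 1 = 1 \<otimes> y comes from evaluating the left
  inverse on \<delta>(x) in two ways: it returns x \<otimes> 1, and through \<delta>(x) = a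
  \<otimes> x it returns the product of z in the first factor with w x in the second; multiplying by
  w in the first factor cancels z. The left inverse is not an algebra map in general, so \<delta> is
  unwound letter by letter. Descent asks whether the class of y in Z / k1 vanishes, which faithful
  flatness detects after tensoring with Z. The universe of test modules is the obstacle here: their
  elements are sets of noncommutative polynomials, so each test module is presented as a quotient of
  the free algebra itself. Faithful flatness also makes k -> Z injective, so that identities between
  scalar matrices over Z can be read over k.\<close>

locale kmod = abelian_group M for M :: "('k::comm_ring_1, 'm) module" (structure) +
  assumes smult_closed [simp, intro]: "x \<in> carrier M \<Longrightarrow> c \<odot> x \<in> carrier M"
    and smult_l_distr: "x \<in> carrier M \<Longrightarrow> (a + b) \<odot> x = a \<odot> x \<oplus> b \<odot> x"
    and smult_r_distr: "x \<in> carrier M \<Longrightarrow> y \<in> carrier M \<Longrightarrow> a \<odot> (x \<oplus> y) = a \<odot> x \<oplus> a \<odot> y"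
    and smult_assoc: "x \<in> carrier M \<Longrightarrow> (a * b) \<odot> x = a \<odot> (b \<odot> x)"
    and smult_one [simp]: "x \<in> carrier M \<Longrightarrow> 1 \<odot> x = x"

text \<open>Bridge between two views of a module: the definitions speak of
  \<open>module ring_of_type_algebra\<close>, while \<open>kmod\<close> takes its scalars from the
  type \<open>'k\<close>, so that the arithmetic of the type class applies to them directly.\<close>

lemma kmod_iff_module: "kmod M \<longleftrightarrow> module ring_of_type_algebra M"
proof
  assume "kmod M"
  then interpret kmod M .
  show "module ring_of_type_algebra M"
    by (rule moduleI[OF cring_from_type_algebra abelian_group_axioms])
      (auto simp: ring_of_type_algebra_def smult_l_distr smult_r_distr smult_assoc)
next
  assume "module ring_of_type_algebra M"
  then interpret m: module ring_of_type_algebra M .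
  show "kmod M"
    using m.smult_closed m.smult_l_distr m.smult_r_distr m.smult_assoc1 m.smult_one
    by unfold_locales (auto simp: ring_of_type_algebra_def)
qed

context kmod
begin

lemma smult_zero_left [simp]:
  assumes "x \<in> carrier M"
  shows "0 \<odot> x = \<zero>"
proof -
  have "0 \<odot> x \<oplus> 0 \<odot> x = 0 \<odot> x" using smult_l_distr[OF assms, of 0 0] by simp
  then show ?thesis using assms by (subst (asm) add.l_cancel_one) auto
qed

lemma smult_zero_right [simp]: "c \<odot> \<zero> = \<zero>"
  using smult_assoc[OF zero_closed, of c 0] by simp

lemma smult_minus_one:
  assumes "x \<in> carrier M"
  shows "(- 1) \<odot> x = \<ominus> x"
  using smult_l_distr[OF assms, of "-1" 1] assms by (intro minus_equality[symmetric]) auto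

lemma smult_finsum:
  assumes "f \<in> S \<rightarrow> carrier M"
  shows "c \<odot> (\<Oplus>i\<in>S. f i) = (\<Oplus>i\<in>S. c \<odot> f i)"
  using assms
proof (induction S rule: infinite_finite_induct)
  case (insert x F)
  then have "f \<in> F \<rightarrow> carrier M" "f x \<in> carrier M" by auto
  with insert show ?case by (simp add: smult_r_distr Pi_def)
qed auto

lemma finsum_sum_smult:
  assumes "x \<in> carrier M"
  shows "(\<Sum>i\<in>S. f i) \<odot> x = (\<Oplus>i\<in>S. f i \<odot> x)"
  using assms by (induction S rule: infinite_finite_induct) (auto simp: smult_l_distr)

lemma finsum_swap:
  assumes "finite S" "finite T" "\<And>i j. i \<in> S \<Longrightarrow> j \<in> T \<Longrightarrow> f i j \<in> carrier M"
  shows "(\<Oplus>i\<in>S. \<Oplus>j\<in>T. f i j) = (\<Oplus>j\<in>T. \<Oplus>i\<in>S. f i j)"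
  using assms(1,3)
proof (induction S)
  case (insert x F)
  have "(\<Oplus>i\<in>insert x F. \<Oplus>j\<in>T. f i j) = (\<Oplus>j\<in>T. f x j) \<oplus> (\<Oplus>i\<in>F. \<Oplus>j\<in>T. f i j)"
    using insert by (subst finsum_insert) (auto intro!: finsum_closed)
  also have "\<dots> = (\<Oplus>j\<in>T. f x j \<oplus> (\<Oplus>i\<in>F. f i j))"
    using insert by (subst finsum_addf) (auto intro!: finsum_closed)
  also have "\<dots> = (\<Oplus>j\<in>T. \<Oplus>i\<in>insert x F. f i j)"
    using insert by (intro finsum_cong' refl) (auto intro!: finsum_closed)
  finally show ?case .
qed simp

end

locale kalg = kmod A + ring A for A (structure) +
  assumes smult_mult_left: "x \<in> carrier A \<Longrightarrow> y \<in> carrier A \<Longrightarrow> (c \<odot> x) \<otimes> y = c \<odot> (x \<otimes> y)"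
    and smult_mult_right: "x \<in> carrier A \<Longrightarrow> y \<in> carrier A \<Longrightarrow> x \<otimes> (c \<odot> y) = c \<odot> (x \<otimes> y)"

subsection \<open>Linear maps\<close>

lemma linear_mapsI:
  assumes "\<And>x. x \<in> carrier M \<Longrightarrow> f x \<in> carrier N"
    and "\<And>x y. x \<in> carrier M \<Longrightarrow> y \<in> carrier M \<Longrightarrow> f (x \<oplus>\<^bsub>M\<^esub> y) = f x \<oplus>\<^bsub>N\<^esub> f y"
    and "\<And>c x. x \<in> carrier M \<Longrightarrow> f (c \<odot>\<^bsub>M\<^esub> x) = c \<odot>\<^bsub>N\<^esub> f x"
  shows "f \<in> linear_maps M N"
  using assms by (auto simp: linear_maps_def)

lemma linear_maps_closed: "f \<in> linear_maps M N \<Longrightarrow> x \<in> carrier M \<Longrightarrow> f x \<in> carrier N"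
  and linear_maps_add: "f \<in> linear_maps M N \<Longrightarrow> x \<in> carrier M \<Longrightarrow> y \<in> carrier M \<Longrightarrow>
    f (x \<oplus>\<^bsub>M\<^esub> y) = f x \<oplus>\<^bsub>N\<^esub> f y"
  and linear_maps_smult: "f \<in> linear_maps M N \<Longrightarrow> x \<in> carrier M \<Longrightarrow> f (c \<odot>\<^bsub>M\<^esub> x) = c \<odot>\<^bsub>N\<^esub> f x"
  by (auto simp: linear_maps_def)

lemma linear_maps_id: "id \<in> linear_maps M M"
  by (auto simp: linear_maps_def)

lemma linear_maps_comp: "f \<in> linear_maps M N \<Longrightarrow> g \<in> linear_maps N L \<Longrightarrow> (\<lambda>x. g (f x)) \<in> linear_maps M L"
  by (auto simp: linear_maps_def Pi_def)

lemma linear_maps_zero: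
  assumes "kmod M" "kmod N" "f \<in> linear_maps M N"
  shows "f \<zero>\<^bsub>M\<^esub> = \<zero>\<^bsub>N\<^esub>"
proof -
  interpret M: kmod M by fact
  interpret N: kmod N by fact
  show ?thesis
    using linear_maps_smult[OF assms(3) M.zero_closed, of 0] linear_maps_closed[OF assms(3) M.zero_closed]
    by simp
qed

lemma linear_maps_minus:
  assumes "kmod M" "kmod N" "f \<in> linear_maps M N" "x \<in> carrier M" "y \<in> carrier M"
  shows "f (x \<ominus>\<^bsub>M\<^esub> y) = f x \<ominus>\<^bsub>N\<^esub> f y"
proof -
  interpret M: kmod M by fact
  interpret N: kmod N by fact
  show ?thesis
    using assms(3-) by (simp add: a_minus_def linear_maps_add linear_maps_smult linear_maps_closed
        flip: M.smult_minus_one N.smult_minus_one)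
qed

lemma linear_maps_finsum:
  assumes "kmod M" "kmod N" "f \<in> linear_maps M N" "g \<in> S \<rightarrow> carrier M"
  shows "f (\<Oplus>\<^bsub>M\<^esub>i\<in>S. g i) = (\<Oplus>\<^bsub>N\<^esub>i\<in>S. f (g i))"
proof -
  interpret M: kmod M by fact
  interpret N: kmod N by fact
  show ?thesis
    using assms(4)
  proof (induction S rule: infinite_finite_induct)
    case (insert x F)
    then have "g \<in> F \<rightarrow> carrier M" "g x \<in> carrier M" by auto
    with insert assms(3) show ?case
      by (simp add: linear_maps_add linear_maps_closed Pi_def)
  qed (use linear_maps_zero[OF assms(1-3)] in auto)
qed

subsection \<open>Monoid algebras and linear extension\<close>

lemma keys_add_subset [intro, simp]:
  "Poly_Mapping.keys p \<subseteq> S \<Longrightarrow> Poly_Mapping.keys q \<subseteq> S \<Longrightarrow> Poly_Mapping.keys (p + q) \<subseteq> S"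
  using keys_add[of p q] by blast

text \<open>Reduces identities that are linear in a polynomial to monomials. The support bounds are
  carried along because the maps in question are known to be additive only on the carrier; the zero
  case stands apart since \<open>S\<close> may be empty.\<close>

lemma keys_induct [consumes 1, case_names zero single add]:
  fixes p :: "'a \<Rightarrow>\<^sub>0 'b::comm_monoid_add"
  assumes "Poly_Mapping.keys p \<subseteq> S" "P 0" "\<And>u c. u \<in> S \<Longrightarrow> P (Poly_Mapping.single u c)"
    and "\<And>p q. Poly_Mapping.keys p \<subseteq> S \<Longrightarrow> Poly_Mapping.keys q \<subseteq> S \<Longrightarrow> P p \<Longrightarrow> P q \<Longrightarrow> P (p + q)"
  shows "P p"
proof -
  have "P (\<Sum>u\<in>F. Poly_Mapping.single u (Poly_Mapping.lookup p u)) \<and>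
      Poly_Mapping.keys (\<Sum>u\<in>F. Poly_Mapping.single u (Poly_Mapping.lookup p u)) \<subseteq> S"
    if "finite F" "F \<subseteq> S" for F
    using that
  proof (induction F)
    case (insert u F)
    have "Poly_Mapping.keys (Poly_Mapping.single u (Poly_Mapping.lookup p u)) \<subseteq> S"
      using insert by auto
    with insert assms(3,4) show ?case
      by (simp del: keys_single)
  qed (use assms in auto)
  moreover have "p = (\<Sum>u\<in>Poly_Mapping.keys p. Poly_Mapping.single u (Poly_Mapping.lookup p u))"
    by (rule poly_mapping_eqI)
      (auto simp: lookup_sum lookup_single when_def in_keys_iff)
  ultimately show ?thesis using assms(1) by (metis finite_keys)
qed

lemma lookup_map_times: "Poly_Mapping.lookup (Poly_Mapping.map ((*) c) p) u = c * Poly_Mapping.lookup p (u :: 'a)"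
  for c :: "'k::comm_ring_1"
  by (simp add: map.rep_eq when_def)

lemma monoid_algebra_simps [simp]:
  "carrier (monoid_algebra G) = {p. Poly_Mapping.keys p \<subseteq> carrier G}"
  "add (monoid_algebra G) = (+)"
  "\<zero>\<^bsub>monoid_algebra G\<^esub> = 0"
  "\<one>\<^bsub>monoid_algebra G\<^esub> = Poly_Mapping.single \<one>\<^bsub>G\<^esub> 1"
  "c \<odot>\<^bsub>monoid_algebra G\<^esub> p = Poly_Mapping.map ((*) c) p"
  by (simp_all add: monoid_algebra_def)

lemma keys_uminus: "Poly_Mapping.keys (- p) = Poly_Mapping.keys (p :: 'a \<Rightarrow>\<^sub>0 'b::ab_group_add)"
  by (auto simp: in_keys_iff)

lemma keys_map_times: "Poly_Mapping.keys (Poly_Mapping.map ((*) c) p) \<subseteq> Poly_Mapping.keys (p :: 'a \<Rightarrow>\<^sub>0 'k::comm_ring_1)"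
  by (auto simp: in_keys_iff lookup_map_times)

lemma kmod_monoid_algebra: "kmod (monoid_algebra G :: ('k::comm_ring_1, 'g \<Rightarrow>\<^sub>0 'k) module)"
proof -
  have "abelian_group (monoid_algebra G :: ('k, 'g \<Rightarrow>\<^sub>0 'k) module)"
  proof (rule abelian_groupI)
    fix x assume "x \<in> carrier (monoid_algebra G :: ('k, 'g \<Rightarrow>\<^sub>0 'k) module)"
    then show "\<exists>y\<in>carrier (monoid_algebra G). y \<oplus>\<^bsub>monoid_algebra G\<^esub> x = \<zero>\<^bsub>monoid_algebra G\<^esub>"
      by (intro bexI[of _ "- x"]) (auto simp: keys_uminus)
  qed (auto simp: algebra_simps keys_add_subset[THEN subsetD])
  then show ?thesis
    unfolding kmod_def kmod_axioms_def
    by (auto intro!: poly_mapping_eqI simp: lookup_map_times lookup_add algebra_simps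
        dest!: keys_map_times[THEN subsetD])
qed

lemma monoid_algebra_uminus:
  assumes "Poly_Mapping.keys p \<subseteq> carrier G"
  shows "\<ominus>\<^bsub>monoid_algebra G\<^esub> p = - (p :: 'g \<Rightarrow>\<^sub>0 'k::comm_ring_1)"
proof -
  interpret kmod "monoid_algebra G :: ('k, 'g \<Rightarrow>\<^sub>0 'k) module" by (rule kmod_monoid_algebra)
  show ?thesis using assms by (intro minus_equality) (auto simp: keys_uminus)
qed

lemma monoid_algebra_minus:
  assumes "Poly_Mapping.keys q \<subseteq> carrier G"
  shows "p \<ominus>\<^bsub>monoid_algebra G\<^esub> q = p - (q :: 'g \<Rightarrow>\<^sub>0 'k::comm_ring_1)"
  using monoid_algebra_uminus[OF assms] by (simp add: a_minus_def)

text \<open>The product is a sum over the exact supports, which may shrink when polynomials are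
  added. Over a common finite superset the extra coefficients are zero, and distributivity becomes
  an identity of sums over one index set.\<close>

lemma monoid_algebra_mult_superset:
  assumes "finite S" "finite T" "Poly_Mapping.keys p \<subseteq> S" "Poly_Mapping.keys q \<subseteq> T"
  shows "p \<otimes>\<^bsub>monoid_algebra G\<^esub> q =
    (\<Sum>u\<in>S. \<Sum>v\<in>T. Poly_Mapping.single (u \<otimes>\<^bsub>G\<^esub> v) (Poly_Mapping.lookup p u * Poly_Mapping.lookup q v))"
proof -
  have "(\<Sum>v\<in>Poly_Mapping.keys q. Poly_Mapping.single (u \<otimes>\<^bsub>G\<^esub> v) (Poly_Mapping.lookup p u * Poly_Mapping.lookup q v)) =
      (\<Sum>v\<in>T. Poly_Mapping.single (u \<otimes>\<^bsub>G\<^esub> v) (Poly_Mapping.lookup p u * Poly_Mapping.lookup q v))" for u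
    using assms by (intro sum.mono_neutral_left) (auto simp: in_keys_iff)
  then have "p \<otimes>\<^bsub>monoid_algebra G\<^esub> q = (\<Sum>u\<in>Poly_Mapping.keys p. \<Sum>v\<in>T.
      Poly_Mapping.single (u \<otimes>\<^bsub>G\<^esub> v) (Poly_Mapping.lookup p u * Poly_Mapping.lookup q v))"
    by (simp add: monoid_algebra_def)
  also have "\<dots> = (\<Sum>u\<in>S. \<Sum>v\<in>T. Poly_Mapping.single (u \<otimes>\<^bsub>G\<^esub> v) (Poly_Mapping.lookup p u * Poly_Mapping.lookup q v))"
    using assms by (intro sum.mono_neutral_left) (auto simp: in_keys_iff)
  finally show ?thesis .
qed

lemma monoid_algebra_mult_single [simp]:
  "Poly_Mapping.single u c \<otimes>\<^bsub>monoid_algebra G\<^esub> Poly_Mapping.single v d = Poly_Mapping.single (u \<otimes>\<^bsub>G\<^esub> v) (c * d)"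
  by (subst monoid_algebra_mult_superset[of "{u}" "{v}"]) auto

lemma monoid_algebra_mult_add_left:
  "(p + q) \<otimes>\<^bsub>monoid_algebra G\<^esub> r = p \<otimes>\<^bsub>monoid_algebra G\<^esub> r + q \<otimes>\<^bsub>monoid_algebra G\<^esub> r"
  using keys_add[of p q]
  by (simp add: monoid_algebra_mult_superset[of "Poly_Mapping.keys p \<union> Poly_Mapping.keys q" "Poly_Mapping.keys r"]
      lookup_add algebra_simps single_add sum.distrib)

lemma monoid_algebra_mult_add_right:
  "r \<otimes>\<^bsub>monoid_algebra G\<^esub> (p + q) = r \<otimes>\<^bsub>monoid_algebra G\<^esub> p + r \<otimes>\<^bsub>monoid_algebra G\<^esub> q"
  using keys_add[of p q]
  by (simp add: monoid_algebra_mult_superset[of "Poly_Mapping.keys r" "Poly_Mapping.keys p \<union> Poly_Mapping.keys q"]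
      lookup_add algebra_simps single_add sum.distrib)

lemma monoid_algebra_mult_zero [simp]:
  "0 \<otimes>\<^bsub>monoid_algebra G\<^esub> r = 0" "r \<otimes>\<^bsub>monoid_algebra G\<^esub> 0 = 0"
  by (simp_all add: monoid_algebra_def)

lemma map_times_single: "Poly_Mapping.map ((*) c) (Poly_Mapping.single u d) = Poly_Mapping.single u (c * d)"
  for c :: "'k::comm_ring_1"
  by (rule poly_mapping_eqI) (simp add: lookup_map_times lookup_single when_def)

lemma map_times_add: "Poly_Mapping.map ((*) c) (p + q) = Poly_Mapping.map ((*) c) p + Poly_Mapping.map ((*) c) q"
  for c :: "'k::comm_ring_1"
  by (rule poly_mapping_eqI) (simp add: lookup_map_times lookup_add algebra_simps)

text \<open>Each law is linear in every argument, so nested inductions leave only monomials, where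
  it is a law of the monoid or of the scalars.\<close>

lemma kalg_monoid_algebra:
  assumes "Group.monoid G"
  shows "kalg (monoid_algebra G :: ('k::comm_ring_1, 'g \<Rightarrow>\<^sub>0 'k) module)"
proof -
  let ?M = "monoid_algebra G :: ('k, 'g \<Rightarrow>\<^sub>0 'k) module"
  interpret G: Group.monoid G by fact
  interpret kmod ?M by (rule kmod_monoid_algebra)
  have closed: "p \<otimes>\<^bsub>?M\<^esub> q \<in> carrier ?M" if "p \<in> carrier ?M" "q \<in> carrier ?M" for p q
  proof -
    have "Poly_Mapping.keys p \<subseteq> carrier G" "Poly_Mapping.keys q \<subseteq> carrier G" using that by auto
    then show ?thesis
    proof (induction p rule: keys_induct)
      case (single u c)
      from single(2) show ?case
        by (induction q rule: keys_induct)
          (use single(1) in \<open>auto simp: monoid_algebra_mult_add_right split: if_splits\<close>)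
    qed (simp_all add: monoid_algebra_mult_add_left)
  qed
  have assoc: "p \<otimes>\<^bsub>?M\<^esub> q \<otimes>\<^bsub>?M\<^esub> r = p \<otimes>\<^bsub>?M\<^esub> (q \<otimes>\<^bsub>?M\<^esub> r)"
    if "p \<in> carrier ?M" "q \<in> carrier ?M" "r \<in> carrier ?M" for p q r
  proof -
    have "Poly_Mapping.keys p \<subseteq> carrier G" "Poly_Mapping.keys q \<subseteq> carrier G"
      "Poly_Mapping.keys r \<subseteq> carrier G" using that by auto
    then show ?thesis
    proof (induction p rule: keys_induct)
      case (single u a)
      from single(2,1,3) show ?case
      proof (induction q rule: keys_induct)
        case (single v b)
        from single(3,1,2) show ?case
          by (induction r rule: keys_induct)
            (simp_all add: monoid_algebra_mult_add_right G.m_assoc mult.assoc)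
      qed (simp_all add: monoid_algebra_mult_add_left monoid_algebra_mult_add_right)
    qed (simp_all add: monoid_algebra_mult_add_left)
  qed
  have l_one: "\<one>\<^bsub>?M\<^esub> \<otimes>\<^bsub>?M\<^esub> p = p" "p \<otimes>\<^bsub>?M\<^esub> \<one>\<^bsub>?M\<^esub> = p" if "p \<in> carrier ?M" for p
  proof -
    have "Poly_Mapping.keys p \<subseteq> carrier G" using that by auto
    then have "\<one>\<^bsub>?M\<^esub> \<otimes>\<^bsub>?M\<^esub> p = p \<and> p \<otimes>\<^bsub>?M\<^esub> \<one>\<^bsub>?M\<^esub> = p"
      by (induction p rule: keys_induct)
        (simp_all add: monoid_algebra_mult_add_left monoid_algebra_mult_add_right)
    then show "\<one>\<^bsub>?M\<^esub> \<otimes>\<^bsub>?M\<^esub> p = p" "p \<otimes>\<^bsub>?M\<^esub> \<one>\<^bsub>?M\<^esub> = p" by auto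
  qed
  have smult: "(c \<odot>\<^bsub>?M\<^esub> p) \<otimes>\<^bsub>?M\<^esub> q = c \<odot>\<^bsub>?M\<^esub> (p \<otimes>\<^bsub>?M\<^esub> q)"
      "p \<otimes>\<^bsub>?M\<^esub> (c \<odot>\<^bsub>?M\<^esub> q) = c \<odot>\<^bsub>?M\<^esub> (p \<otimes>\<^bsub>?M\<^esub> q)"
    if "p \<in> carrier ?M" "q \<in> carrier ?M" for p q c
  proof -
    have "Poly_Mapping.keys p \<subseteq> carrier G" "Poly_Mapping.keys q \<subseteq> carrier G" using that by auto
    then have "(c \<odot>\<^bsub>?M\<^esub> p) \<otimes>\<^bsub>?M\<^esub> q = c \<odot>\<^bsub>?M\<^esub> (p \<otimes>\<^bsub>?M\<^esub> q) \<and>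
      p \<otimes>\<^bsub>?M\<^esub> (c \<odot>\<^bsub>?M\<^esub> q) = c \<odot>\<^bsub>?M\<^esub> (p \<otimes>\<^bsub>?M\<^esub> q)"
    proof (induction p rule: keys_induct)
      case zero
      show ?case using smult_zero_right by simp
    next
      case (single u a)
      from single(2,1) show ?case
      proof (induction q rule: keys_induct)
        case zero
        show ?case using smult_zero_right by simp
      qed (simp_all add: monoid_algebra_mult_add_right map_times_single map_times_add algebra_simps)
    qed (simp_all add: monoid_algebra_mult_add_left map_times_add)
    then show "(c \<odot>\<^bsub>?M\<^esub> p) \<otimes>\<^bsub>?M\<^esub> q = c \<odot>\<^bsub>?M\<^esub> (p \<otimes>\<^bsub>?M\<^esub> q)"
      "p \<otimes>\<^bsub>?M\<^esub> (c \<odot>\<^bsub>?M\<^esub> q) = c \<odot>\<^bsub>?M\<^esub> (p \<otimes>\<^bsub>?M\<^esub> q)" by auto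
  qed
  have "ring ?M"
    by (intro ringI abelian_group_axioms monoidI)
      (use closed assoc l_one in \<open>auto simp: monoid_algebra_mult_add_left monoid_algebra_mult_add_right\<close>)
  then show ?thesis
    using kmod_axioms smult by (simp add: kalg_def kalg_axioms_def)
qed

lemma linear_maps_monoid_algebra_eqI:
  assumes "kmod M" "f \<in> linear_maps (monoid_algebra G) M" "g \<in> linear_maps (monoid_algebra G) M"
    and "\<And>u. u \<in> carrier G \<Longrightarrow> f (Poly_Mapping.single u 1) = g (Poly_Mapping.single u 1)"
    and "Poly_Mapping.keys p \<subseteq> carrier G"
  shows "f p = g (p :: 'g \<Rightarrow>\<^sub>0 'k::comm_ring_1)"
  using assms(5)
proof (induction p rule: keys_induct)
  case zero
  show ?case using linear_maps_zero[OF kmod_monoid_algebra assms(1,2)]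
    linear_maps_zero[OF kmod_monoid_algebra assms(1,3)] by simp
next
  case (single u c)
  show ?case
    using linear_maps_smult[OF assms(2), of "Poly_Mapping.single u 1" c]
      linear_maps_smult[OF assms(3), of "Poly_Mapping.single u 1" c] single assms(4)
    by (simp add: map_times_single)
next
  case (add p q)
  then show ?case using linear_maps_add[OF assms(2), of p q] linear_maps_add[OF assms(3), of p q] by simp
qed

context kmod
begin

text \<open>As for the product, the defining sum runs over the exact support; enlarging it lets
  \<open>p\<close>, \<open>q\<close> and \<open>p + q\<close> share one index set when additivity is
  proved.\<close>

lemma linear_extension_superset:
  assumes "finite S" "Poly_Mapping.keys p \<subseteq> S" "h \<in> S \<rightarrow> carrier M"
  shows "linear_extension M h p = (\<Oplus>u\<in>S. Poly_Mapping.lookup p u \<odot> h u)"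
  unfolding linear_extension_def using assms
  by (intro add.finprod_mono_neutral_cong_left) (auto simp: in_keys_iff Pi_def)

lemma linear_extension_single [simp]:
  assumes "h u \<in> carrier M"
  shows "linear_extension M h (Poly_Mapping.single u c) = c \<odot> h u"
  using assms by (subst linear_extension_superset[of "{u}"]) auto

lemma linear_extension_linear:
  assumes h: "h \<in> carrier G \<rightarrow> carrier M"
  shows "linear_extension M h \<in> linear_maps (monoid_algebra G) M"
proof (rule linear_mapsI)
  fix p q :: "_ \<Rightarrow>\<^sub>0 'k" and c
  assume pq: "p \<in> carrier (monoid_algebra G)"
  let ?P = "Poly_Mapping.keys p"
  have hP: "h \<in> ?P \<rightarrow> carrier M" using pq h by auto
  show "linear_extension M h p \<in> carrier M"
    using hP unfolding linear_extension_def by (intro finsum_closed) auto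
  show "linear_extension M h (c \<odot>\<^bsub>monoid_algebra G\<^esub> p) = c \<odot> linear_extension M h p"
    using hP keys_map_times[of c p]
    by (auto simp: linear_extension_superset[of ?P] smult_finsum lookup_map_times smult_assoc Pi_def
        intro!: finsum_cong')
  assume q: "q \<in> carrier (monoid_algebra G)"
  let ?Q = "Poly_Mapping.keys q"
  have hPQ: "h \<in> ?P \<union> ?Q \<rightarrow> carrier M" using pq q h by auto
  have "linear_extension M h (p + q) = (\<Oplus>u\<in>?P \<union> ?Q. Poly_Mapping.lookup (p + q) u \<odot> h u)"
    using hPQ keys_add[of p q] by (intro linear_extension_superset) auto
  also have "\<dots> = (\<Oplus>u\<in>?P \<union> ?Q. Poly_Mapping.lookup p u \<odot> h u \<oplus> Poly_Mapping.lookup q u \<odot> h u)"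
    using hPQ by (intro finsum_cong') (auto simp: lookup_add intro!: smult_l_distr)
  also have "\<dots> = (\<Oplus>u\<in>?P \<union> ?Q. Poly_Mapping.lookup p u \<odot> h u) \<oplus> (\<Oplus>u\<in>?P \<union> ?Q. Poly_Mapping.lookup q u \<odot> h u)"
    using hPQ by (intro finsum_addf) auto
  also have "\<dots> = linear_extension M h p \<oplus> linear_extension M h q"
    using hPQ by (simp add: linear_extension_superset[of "?P \<union> ?Q"])
  finally show "linear_extension M h (p \<oplus>\<^bsub>monoid_algebra G\<^esub> q) = linear_extension M h p \<oplus> linear_extension M h q"
    by simp
qed

end

section \<open>Homomorphisms of algebras\<close>

definition kalg_hom :: "('k, 'a) module \<Rightarrow> ('k, 'b) module \<Rightarrow> ('a \<Rightarrow> 'b) set" where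
  "kalg_hom A B = linear_maps A B \<inter> Ring.ring_hom A B"

lemma kalg_homI:
  assumes "f \<in> linear_maps A B"
    and "\<And>x y. x \<in> carrier A \<Longrightarrow> y \<in> carrier A \<Longrightarrow> f (x \<otimes>\<^bsub>A\<^esub> y) = f x \<otimes>\<^bsub>B\<^esub> f y"
    and "f \<one>\<^bsub>A\<^esub> = \<one>\<^bsub>B\<^esub>"
  shows "f \<in> kalg_hom A B"
  using assms by (auto simp: kalg_hom_def Ring.ring_hom_def linear_maps_def)

lemma kalg_hom_linear: "f \<in> kalg_hom A B \<Longrightarrow> f \<in> linear_maps A B"
  and kalg_hom_mult: "f \<in> kalg_hom A B \<Longrightarrow> x \<in> carrier A \<Longrightarrow> y \<in> carrier A \<Longrightarrow> f (x \<otimes>\<^bsub>A\<^esub> y) = f x \<otimes>\<^bsub>B\<^esub> f y"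
  and kalg_hom_one: "f \<in> kalg_hom A B \<Longrightarrow> f \<one>\<^bsub>A\<^esub> = \<one>\<^bsub>B\<^esub>"
  by (auto simp: kalg_hom_def Ring.ring_hom_def)

lemma kalg_hom_comp: "f \<in> kalg_hom A B \<Longrightarrow> g \<in> kalg_hom B C \<Longrightarrow> (\<lambda>x. g (f x)) \<in> kalg_hom A C"
  by (intro kalg_homI) (auto simp: linear_maps_comp[OF kalg_hom_linear kalg_hom_linear] kalg_hom_mult
      kalg_hom_one linear_maps_closed[OF kalg_hom_linear])

text \<open>Universal property of the monoid algebra: both sides of multiplicativity are bilinear
  and agree on monomials. It is applied to the monoid of words, with the product of the images of
  the letters as \<open>h\<close>.\<close>

lemma linear_extension_kalg_hom:
  fixes G :: "('g, 'r) monoid_scheme" and A :: "('k::comm_ring_1, 'a) module"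
  assumes G: "Group.monoid G" and A: "kalg A" and h: "h \<in> carrier G \<rightarrow> carrier A"
    and mult: "\<And>u v. u \<in> carrier G \<Longrightarrow> v \<in> carrier G \<Longrightarrow> h (u \<otimes>\<^bsub>G\<^esub> v) = h u \<otimes>\<^bsub>A\<^esub> h v"
    and one: "h \<one>\<^bsub>G\<^esub> = \<one>\<^bsub>A\<^esub>"
  shows "linear_extension A h \<in> kalg_hom (monoid_algebra G) A"
proof (rule kalg_homI)
  interpret G: Group.monoid G by fact
  interpret A: kalg A by fact
  interpret M: kalg "monoid_algebra G :: ('k, 'g \<Rightarrow>\<^sub>0 'k) module" by (rule kalg_monoid_algebra[OF G])
  let ?L = "linear_extension A h"
  note lin = A.linear_extension_linear[OF h]
  show "?L \<in> linear_maps (monoid_algebra G) A" by (rule lin)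
  have hc: "h u \<in> carrier A" if "u \<in> carrier G" for u using h that by auto
  then show "?L \<one>\<^bsub>monoid_algebra G\<^esub> = \<one>\<^bsub>A\<^esub>" by (simp add: one)
  fix p q :: "'g \<Rightarrow>\<^sub>0 'k"
  assume "p \<in> carrier (monoid_algebra G)" "q \<in> carrier (monoid_algebra G)"
  then have "Poly_Mapping.keys p \<subseteq> carrier G" "Poly_Mapping.keys q \<subseteq> carrier G" by auto
  note L0 = linear_maps_zero[OF kmod_monoid_algebra A.kmod_axioms lin, simplified]
  note Ladd = linear_maps_add[OF lin, simplified] and Lc = linear_maps_closed[OF lin, simplified]
  note Mc = M.m_closed[simplified]
  from \<open>Poly_Mapping.keys p \<subseteq> carrier G\<close> \<open>Poly_Mapping.keys q \<subseteq> carrier G\<close>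
  show "?L (p \<otimes>\<^bsub>monoid_algebra G\<^esub> q) = ?L p \<otimes>\<^bsub>A\<^esub> ?L q"
  proof (induction p rule: keys_induct)
    case zero
    then show ?case by (simp add: L0 Lc)
  next
    case (single u a)
    from single(2,1) show ?case
    proof (induction q rule: keys_induct)
      case zero
      then show ?case by (simp add: L0 Lc hc)
    next
      case (single v b)
      then show ?case
        by (simp add: hc mult A.smult_mult_left A.smult_mult_right A.smult_assoc[symmetric] mult.commute)
    next
      case (add p q)
      have "Poly_Mapping.keys (Poly_Mapping.single u a) \<subseteq> carrier G" using add by auto
      with add show ?case
        by (simp add: monoid_algebra_mult_add_right Ladd Mc Lc A.r_distr del: keys_single A.linear_extension_single)
    qed
  next
    case (add p p')
    then show ?case by (simp add: monoid_algebra_mult_add_left Ladd Mc Lc A.l_distr)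
  qed
qed

subsection \<open>Quotients\<close>

locale ksub = kmod M + abelian_subgroup I M for I and M (structure) +
  assumes smult_in: "x \<in> I \<Longrightarrow> c \<odot> x \<in> I"

lemma ksubI:
  assumes "kmod M" "submodule I ring_of_type_algebra M"
  shows "ksub I M"
proof -
  interpret kmod M by fact
  interpret submodule I ring_of_type_algebra M by fact
  have "abelian_subgroup I M"
    by (intro abelian_subgroupI3 additive_subgroup.intro abelian_group_axioms subgroup_axioms)
  then show ?thesis
    using kmod_axioms smult_closed by (simp add: ksub_def ksub_axioms_def ring_of_type_algebra_def)
qed

lemma (in kmod) submodule_if_closed:
  assumes "I \<subseteq> carrier M" "\<zero> \<in> I" "\<And>x y. x \<in> I \<Longrightarrow> y \<in> I \<Longrightarrow> x \<oplus> y \<in> I" "\<And>c x. x \<in> I \<Longrightarrow> c \<odot> x \<in> I"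
  shows "submodule I ring_of_type_algebra M"
proof -
  interpret module ring_of_type_algebra M using kmod_axioms by (simp add: kmod_iff_module)
  show ?thesis
    using assms by (intro submoduleI) (auto simp flip: smult_minus_one)
qed

lemma quotient_module_simps:
  "add (quotient_module M I) = set_add M"
  "\<zero>\<^bsub>quotient_module M I\<^esub> = I"
  "\<one>\<^bsub>quotient_module M I\<^esub> = I +>\<^bsub>M\<^esub> \<one>\<^bsub>M\<^esub>"
  "monoid.mult (quotient_module M I) = rcoset_mult M I"
  "c \<odot>\<^bsub>quotient_module M I\<^esub> C = (\<Union>x\<in>C. I +>\<^bsub>M\<^esub> (c \<odot>\<^bsub>M\<^esub> x))"
  by (simp_all add: quotient_module_def FactRing_def)

lemma carrier_quotient_module: "carrier (quotient_module M I) = (\<lambda>x. I +>\<^bsub>M\<^esub> x) ` carrier M"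
  by (auto simp add: quotient_module_def FactRing_def A_RCOSETS_defs a_r_coset_def r_coset_def)

context ksub
begin

lemma coset_eq_iff:
  assumes "x \<in> carrier M" "y \<in> carrier M"
  shows "I +> x = I +> y \<longleftrightarrow> x \<ominus> y \<in> I"
proof -
  have "x \<in> I +> y \<longleftrightarrow> x \<ominus> y \<in> I"
    using a_rcos_module[OF assms(2,1)] by (simp add: a_minus_def)
  then show ?thesis
    using assms a_repr_independence'[of x y] a_rcos_self[of x] by metis
qed

lemma coset_eq_zero_iff: "x \<in> carrier M \<Longrightarrow> I +> x = I \<longleftrightarrow> x \<in> I"
  by (metis a_rcos_const a_rcos_self)

lemma quotient_smult:
  assumes "x \<in> carrier M"
  shows "c \<odot>\<^bsub>quotient_module M I\<^esub> (I +> x) = I +> (c \<odot> x)"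
proof -
  have "I +> (c \<odot> y) = I +> (c \<odot> x)" if "y \<in> I +> x" for y
  proof -
    have "y \<in> carrier M" using that assms a_r_coset_subset_G[OF a_subset] by auto
    then have "y \<ominus> x \<in> I" using coset_eq_iff[of y x] a_repr_independence'[OF that assms] assms by metis
    then have "c \<odot> (y \<ominus> x) \<in> I" by (rule smult_in)
    then show ?thesis using \<open>y \<in> carrier M\<close> assms
      by (subst coset_eq_iff) (simp_all add: a_minus_def smult_r_distr mult.commute flip: smult_minus_one smult_assoc)
  qed
  then have "(\<lambda>y. I +> (c \<odot> y)) ` (I +> x) = {I +> (c \<odot> x)}"
    using a_rcos_self[OF assms] by blast
  then show ?thesis by (simp add: quotient_module_simps)
qed

lemma quotient_add:
  assumes "x \<in> carrier M" "y \<in> carrier M"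
  shows "(I +> x) \<oplus>\<^bsub>quotient_module M I\<^esub> (I +> y) = I +> (x \<oplus> y)"
  using assms by (simp add: quotient_module_simps a_rcos_sum)

lemma kmod_quotient: "kmod (quotient_module M I)"
proof -
  let ?Q = "quotient_module M I"
  have z: "\<zero>\<^bsub>?Q\<^esub> = I +> \<zero>"
    using a_rcos_const[OF zero_closed] by (simp add: quotient_module_simps)
  have "abelian_group ?Q"
  proof (rule abelian_groupI)
    fix x assume "x \<in> carrier ?Q"
    then obtain a where "x = I +> a" "a \<in> carrier M" by (auto simp: carrier_quotient_module)
    then show "\<exists>y\<in>carrier ?Q. y \<oplus>\<^bsub>?Q\<^esub> x = \<zero>\<^bsub>?Q\<^esub>"
      by (intro bexI[of _ "I +> (\<ominus> a)"]) (auto simp: carrier_quotient_module quotient_add z l_neg)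
  qed (auto simp: carrier_quotient_module quotient_add z a_ac)
  then show ?thesis
    unfolding kmod_def kmod_axioms_def
    by (auto simp: carrier_quotient_module quotient_add quotient_smult smult_l_distr smult_r_distr smult_assoc)
qed

lemma coset_linear: "(\<lambda>x. I +> x) \<in> linear_maps M (quotient_module M I)"
  by (rule linear_mapsI) (auto simp: carrier_quotient_module quotient_add quotient_smult)

text \<open>A linear map that kills \<open>I\<close> is constant on each coset, so its image there
  is a singleton. This is what gives \<open>induced\<close> its intended value.\<close>

lemma the_elem_coset:
  assumes "kmod N" "f \<in> linear_maps M N" "\<And>x. x \<in> I \<Longrightarrow> f x = \<zero>\<^bsub>N\<^esub>" "x \<in> carrier M"
  shows "the_elem (f ` (I +> x)) = f x"
proof -
  interpret N: kmod N by fact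
  have "f ` (I +> x) = {f x}"
    using assms(2-) a_subset linear_maps_closed[OF assms(2) assms(4)] a_rcos_self[OF assms(4)]
    by (auto simp: a_r_coset_def r_coset_def linear_maps_add[OF assms(2)] subset_iff)
  then show ?thesis by simp
qed

lemma the_elem_linear:
  assumes "kmod N" "f \<in> linear_maps M N" "\<And>x. x \<in> I \<Longrightarrow> f x = \<zero>\<^bsub>N\<^esub>"
  shows "(\<lambda>C. the_elem (f ` C)) \<in> linear_maps (quotient_module M I) N"
  using assms(2)
  by (intro linear_mapsI)
    (auto simp: carrier_quotient_module quotient_add quotient_smult the_elem_coset[OF assms]
      linear_maps_closed linear_maps_add linear_maps_smult)

end

locale kideal = kalg A + ideal I A for I and A (structure)
begin

sublocale ksub I A
proof (unfold_locales)
  fix x c assume x: "x \<in> I"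
  \<comment> \<open>A scalar acts as multiplication by its multiple of the unit, so ring ideals
    absorb scalars.\<close>
  then have "(c \<odot> \<one>) \<otimes> x \<in> I" by (intro I_l_closed) auto
  with x show "c \<odot> x \<in> I" using a_subset by (simp add: smult_mult_left subset_iff)
qed

lemma quotient_mult:
  assumes "x \<in> carrier A" "y \<in> carrier A"
  shows "(I +> x) \<otimes>\<^bsub>quotient_module A I\<^esub> (I +> y) = I +> (x \<otimes> y)"
  using assms by (simp add: quotient_module_simps rcoset_mult_add)

lemma kalg_quotient: "kalg (quotient_module A I)"
proof -
  interpret Q: kmod "quotient_module A I" by (rule kmod_quotient)
  have "ring (quotient_module A I)"
    by (intro ringI Q.abelian_group_axioms monoidI)
      (auto simp: carrier_quotient_module quotient_add quotient_mult quotient_module_simps(3) m_assoc l_distr r_distr)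
  then show ?thesis
    using Q.kmod_axioms unfolding kalg_def kalg_axioms_def
    by (auto simp: carrier_quotient_module quotient_smult quotient_mult smult_mult_left smult_mult_right)
qed

lemma coset_kalg_hom: "(\<lambda>x. I +> x) \<in> kalg_hom A (quotient_module A I)"
  using coset_linear by (rule kalg_homI) (simp_all add: quotient_mult quotient_module_simps(3))

lemma the_elem_kalg_hom:
  assumes "kalg B" "f \<in> kalg_hom A B" "\<And>x. x \<in> I \<Longrightarrow> f x = \<zero>\<^bsub>B\<^esub>"
  shows "(\<lambda>C. the_elem (f ` C)) \<in> kalg_hom (quotient_module A I) B"
proof -
  interpret B: kalg B by fact
  note lin = kalg_hom_linear[OF assms(2)]
  show ?thesis
    using assms(2)
    by (intro kalg_homI the_elem_linear[OF B.kmod_axioms lin assms(3)])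
      (auto simp: carrier_quotient_module quotient_mult quotient_module_simps(3) kalg_hom_mult kalg_hom_one
        the_elem_coset[OF B.kmod_axioms lin assms(3)])
qed

end

subsection \<open>Tensor products\<close>

definition bilinear_map ::
    "('k, 'a) module \<Rightarrow> ('k, 'b) module \<Rightarrow> ('k, 'c) module \<Rightarrow> ('a \<Rightarrow> 'b \<Rightarrow> 'c) \<Rightarrow> bool" where
  "bilinear_map M N L h \<longleftrightarrow>
     (\<forall>x\<in>carrier M. h x \<in> linear_maps N L) \<and> (\<forall>y\<in>carrier N. (\<lambda>x. h x y) \<in> linear_maps M L)"

lemma kalg_mult_left_linear:
  assumes "kalg A" "a \<in> carrier A"
  shows "(\<lambda>x. a \<otimes>\<^bsub>A\<^esub> x) \<in> linear_maps A A"
proof -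
  interpret kalg A by fact
  show ?thesis using assms by (intro linear_mapsI) (auto simp: r_distr smult_mult_right)
qed

lemma kalg_mult_right_linear:
  assumes "kalg A" "a \<in> carrier A"
  shows "(\<lambda>x. x \<otimes>\<^bsub>A\<^esub> a) \<in> linear_maps A A"
proof -
  interpret kalg A by fact
  show ?thesis using assms by (intro linear_mapsI) (auto simp: l_distr smult_mult_left)
qed

lemma bilinear_map_linear:
  assumes "bilinear_map M' N' L' h" "f \<in> linear_maps M M'" "g \<in> linear_maps N N'" "l \<in> linear_maps L' L"
  shows "bilinear_map M N L (\<lambda>x y. l (h (f x) (g y)))"
  unfolding bilinear_map_def
proof safe
  fix x assume "x \<in> carrier M"
  then have "h (f x) \<in> linear_maps N' L'"
    using assms(1) linear_maps_closed[OF assms(2)] by (auto simp: bilinear_map_def)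
  then show "(\<lambda>y. l (h (f x) (g y))) \<in> linear_maps N L"
    using linear_maps_comp[OF linear_maps_comp[OF assms(3)] assms(4)] by blast
next
  fix y assume "y \<in> carrier N"
  then have "(\<lambda>x. h x (g y)) \<in> linear_maps M' L'"
    using assms(1) linear_maps_closed[OF assms(3)] by (auto simp: bilinear_map_def)
  then show "(\<lambda>x. l (h (f x) (g y))) \<in> linear_maps M L"
    using linear_maps_comp[OF linear_maps_comp[OF assms(2)] assms(4)] by blast
qed

lemma linear_maps_ident: "(\<lambda>x. x) \<in> linear_maps M M"
  by (auto simp: linear_maps_def)

lemmas bilinear_map_pre = bilinear_map_linear[OF _ _ _ linear_maps_ident]
  and bilinear_map_post = bilinear_map_linear[OF _ linear_maps_ident linear_maps_ident]

lemma keys_minus_subset: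
  "Poly_Mapping.keys p \<subseteq> S \<Longrightarrow> Poly_Mapping.keys q \<subseteq> S \<Longrightarrow> Poly_Mapping.keys (p - q) \<subseteq> S"
  for p q :: "'a \<Rightarrow>\<^sub>0 'b::ab_group_add"
  using keys_add_subset[of p S "- q"] by (simp add: keys_uminus)

lemma keys_single_subset: "u \<in> S \<Longrightarrow> Poly_Mapping.keys (Poly_Mapping.single u c) \<subseteq> S"
  by simp

locale kmod_pair = M: kmod M + N: kmod N
  for M :: "('k::comm_ring_1, 'a) module" and N :: "('k, 'b) module"
begin

abbreviation free_module :: "('k, 'a \<times> 'b \<Rightarrow>\<^sub>0 'k) module" where
  "free_module \<equiv> monoid_algebra (M \<times>\<times> N)"

lemma carrier_DirProd [simp]: "carrier (M \<times>\<times> N) = carrier M \<times> carrier N"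
  by (simp add: DirProd_def)

lemma tensor_relators_subset: "tensor_relators M N \<subseteq> carrier free_module"
proof
  fix p assume "p \<in> tensor_relators M N"
  then show "p \<in> carrier free_module"
    unfolding tensor_relators_def
    by (elim UnE CollectE exE conjE) (simp_all add: keys_minus_subset keys_single_subset del: keys_single)
qed

text \<open>The hull is an intersection over all submodules that contain the relators; the free
  module itself is one of them, which keeps the intersection inside the carrier.\<close>

lemma submodule_tensor: "submodule (tensor_submodule M N) ring_of_type_algebra free_module"
proof -
  interpret F: kmod free_module by (rule kmod_monoid_algebra)
  interpret F: module ring_of_type_algebra free_module
    using F.kmod_axioms by (simp add: kmod_iff_module)
  have sub: "submodule (carrier free_module) ring_of_type_algebra free_module"
    by (rule F.carrier_is_submodule)
  show ?thesis
    unfolding tensor_submodule_def hull_def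
  proof (rule F.submodule_if_closed)
    show "\<Inter> {t. submodule t ring_of_type_algebra free_module \<and> tensor_relators M N \<subseteq> t} \<subseteq> carrier free_module"
      using sub tensor_relators_subset by blast
    have "\<zero>\<^bsub>free_module\<^esub> \<in> t" if "submodule t ring_of_type_algebra free_module" for t
    proof -
      interpret ksub t free_module by (rule ksubI[OF F.kmod_axioms that])
      show ?thesis by (rule zero_closed)
    qed
    then show "\<zero>\<^bsub>free_module\<^esub> \<in> \<Inter> {t. submodule t ring_of_type_algebra free_module \<and> tensor_relators M N \<subseteq> t}"
      by blast
  qed (use F.submoduleE(4,5) in \<open>auto simp: ring_of_type_algebra_def\<close>)
qed

sublocale T: ksub "tensor_submodule M N" free_module
  by (rule ksubI[OF kmod_monoid_algebra submodule_tensor])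

sublocale TT: kmod "tensor M N"
  unfolding tensor_def by (rule T.kmod_quotient)

lemma pure_tensor_closed [simp, intro]:
  "x \<in> carrier M \<Longrightarrow> y \<in> carrier N \<Longrightarrow> pure_tensor M N x y \<in> carrier (tensor M N)"
  by (auto simp: pure_tensor_def tensor_def carrier_quotient_module)

lemma coset_single:
  assumes "x \<in> carrier M" "y \<in> carrier N"
  shows "tensor_submodule M N +>\<^bsub>free_module\<^esub> Poly_Mapping.single (x, y) c = c \<odot>\<^bsub>tensor M N\<^esub> pure_tensor M N x y"
  using T.quotient_smult[of "Poly_Mapping.single (x, y) 1" c] assms
  by (simp add: tensor_def pure_tensor_def map_times_single)

lemma relator_in: "p \<in> tensor_relators M N \<Longrightarrow> p \<in> tensor_submodule M N"
  unfolding tensor_submodule_def by (rule hull_inc)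

lemma coset_eqI:
  assumes "p - q \<in> tensor_relators M N" "p \<in> carrier free_module" "q \<in> carrier free_module"
  shows "tensor_submodule M N +>\<^bsub>free_module\<^esub> p = tensor_submodule M N +>\<^bsub>free_module\<^esub> q"
  using assms relator_in[OF assms(1)] T.coset_eq_iff[of p q] by (simp add: monoid_algebra_minus)

lemma pure_tensor_bilinear: "bilinear_map M N (tensor M N) (pure_tensor M N)"
proof -
  let ?c = "\<lambda>p. tensor_submodule M N +>\<^bsub>free_module\<^esub> p" and ?s = "Poly_Mapping.single :: _ \<Rightarrow> 'k \<Rightarrow> _"
  have add: "pure_tensor M N x y \<oplus>\<^bsub>tensor M N\<^esub> pure_tensor M N x' y' = ?c (?s (x, y) 1 + ?s (x', y') 1)"
    if "x \<in> carrier M" "x' \<in> carrier M" "y \<in> carrier N" "y' \<in> carrier N" for x x' y y'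
    using that T.quotient_add[of "?s (x, y) 1" "?s (x', y') 1"]
    by (simp add: tensor_def pure_tensor_def)
  show ?thesis
    unfolding bilinear_map_def
  proof (intro ballI conjI linear_mapsI)
    fix x x' y assume xy: "x \<in> carrier M" "x' \<in> carrier M" "y \<in> carrier N"
    show "pure_tensor M N (x \<oplus>\<^bsub>M\<^esub> x') y = pure_tensor M N x y \<oplus>\<^bsub>tensor M N\<^esub> pure_tensor M N x' y"
      unfolding add[OF xy(1,2,3,3)] unfolding pure_tensor_def
      by (rule coset_eqI) (use xy in \<open>fastforce simp: tensor_relators_def diff_diff_eq split: if_splits\<close>)+
  next
    fix x y y' assume xy: "x \<in> carrier M" "y \<in> carrier N" "y' \<in> carrier N"
    show "pure_tensor M N x (y \<oplus>\<^bsub>N\<^esub> y') = pure_tensor M N x y \<oplus>\<^bsub>tensor M N\<^esub> pure_tensor M N x y'"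
      unfolding add[OF xy(1,1,2,3)] unfolding pure_tensor_def
      by (rule coset_eqI) (use xy in \<open>fastforce simp: tensor_relators_def diff_diff_eq split: if_splits\<close>)+
  next
    fix c x y assume xy: "x \<in> carrier M" "y \<in> carrier N"
    show "pure_tensor M N (c \<odot>\<^bsub>M\<^esub> x) y = c \<odot>\<^bsub>tensor M N\<^esub> pure_tensor M N x y"
      unfolding coset_single[OF xy, symmetric] unfolding pure_tensor_def
      by (rule coset_eqI) (use xy in \<open>fastforce simp: tensor_relators_def split: if_splits\<close>)+
    show "pure_tensor M N x (c \<odot>\<^bsub>N\<^esub> y) = c \<odot>\<^bsub>tensor M N\<^esub> pure_tensor M N x y"
      unfolding coset_single[OF xy, symmetric] unfolding pure_tensor_def
      by (rule coset_eqI) (use xy in \<open>fastforce simp: tensor_relators_def split: if_splits\<close>)+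
  qed auto
qed

lemma pure_tensor_linear_left: "y \<in> carrier N \<Longrightarrow> (\<lambda>x. pure_tensor M N x y) \<in> linear_maps M (tensor M N)"
  and pure_tensor_linear_right: "x \<in> carrier M \<Longrightarrow> pure_tensor M N x \<in> linear_maps N (tensor M N)"
  using pure_tensor_bilinear by (auto simp: bilinear_map_def)

lemma pure_tensor_add_left: "x \<in> carrier M \<Longrightarrow> x' \<in> carrier M \<Longrightarrow> y \<in> carrier N \<Longrightarrow>
    pure_tensor M N (x \<oplus>\<^bsub>M\<^esub> x') y = pure_tensor M N x y \<oplus>\<^bsub>tensor M N\<^esub> pure_tensor M N x' y"
  using linear_maps_add[OF pure_tensor_linear_left] by simp

lemma pure_tensor_smult_left: "x \<in> carrier M \<Longrightarrow> y \<in> carrier N \<Longrightarrow>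
    pure_tensor M N (c \<odot>\<^bsub>M\<^esub> x) y = c \<odot>\<^bsub>tensor M N\<^esub> pure_tensor M N x y"
  using linear_maps_smult[OF pure_tensor_linear_left] by simp

lemma pure_tensor_smult_right: "x \<in> carrier M \<Longrightarrow> y \<in> carrier N \<Longrightarrow>
    pure_tensor M N x (c \<odot>\<^bsub>N\<^esub> y) = c \<odot>\<^bsub>tensor M N\<^esub> pure_tensor M N x y"
  using linear_maps_smult[OF pure_tensor_linear_right] by simp

lemma pure_tensor_zero_left [simp]: "y \<in> carrier N \<Longrightarrow> pure_tensor M N \<zero>\<^bsub>M\<^esub> y = \<zero>\<^bsub>tensor M N\<^esub>"
  using linear_maps_zero[OF M.kmod_axioms TT.kmod_axioms pure_tensor_linear_left] by simp

lemma pure_tensor_zero_right [simp]: "x \<in> carrier M \<Longrightarrow> pure_tensor M N x \<zero>\<^bsub>N\<^esub> = \<zero>\<^bsub>tensor M N\<^esub>"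
  using linear_maps_zero[OF N.kmod_axioms TT.kmod_axioms pure_tensor_linear_right] by simp

lemma pure_tensor_finsum_left: "y \<in> carrier N \<Longrightarrow> g \<in> S \<rightarrow> carrier M \<Longrightarrow>
    pure_tensor M N (\<Oplus>\<^bsub>M\<^esub>i\<in>S. g i) y = (\<Oplus>\<^bsub>tensor M N\<^esub>i\<in>S. pure_tensor M N (g i) y)"
  by (rule linear_maps_finsum[OF M.kmod_axioms TT.kmod_axioms pure_tensor_linear_left])

lemma pure_tensor_finsum_right: "x \<in> carrier M \<Longrightarrow> g \<in> S \<rightarrow> carrier N \<Longrightarrow>
    pure_tensor M N x (\<Oplus>\<^bsub>N\<^esub>i\<in>S. g i) = (\<Oplus>\<^bsub>tensor M N\<^esub>i\<in>S. pure_tensor M N x (g i))"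
  by (rule linear_maps_finsum[OF N.kmod_axioms TT.kmod_axioms pure_tensor_linear_right])

text \<open>Neither zero nor scalars need a case: zero is the pure tensor of two zeros, and a
  coefficient is absorbed into the left factor.\<close>

lemma tensor_induct [consumes 1, case_names pure add]:
  assumes "t \<in> carrier (tensor M N)"
    and pure: "\<And>x y. x \<in> carrier M \<Longrightarrow> y \<in> carrier N \<Longrightarrow> P (pure_tensor M N x y)"
    and add: "\<And>s t. s \<in> carrier (tensor M N) \<Longrightarrow> t \<in> carrier (tensor M N) \<Longrightarrow> P s \<Longrightarrow> P t \<Longrightarrow> P (s \<oplus>\<^bsub>tensor M N\<^esub> t)"
  shows "P t"
proof -
  let ?c = "\<lambda>p. tensor_submodule M N +>\<^bsub>free_module\<^esub> p"
  obtain p where p: "t = ?c p" "Poly_Mapping.keys p \<subseteq> carrier M \<times> carrier N"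
    using assms(1) by (auto simp: tensor_def carrier_quotient_module)
  from p(2) have "P (?c p)"
  proof (induction p rule: keys_induct)
    case zero
    have "?c 0 = \<zero>\<^bsub>tensor M N\<^esub>"
      using T.a_rcos_const[OF T.zero_closed] by (simp add: tensor_def quotient_module_simps)
    then show ?case using pure[of "\<zero>\<^bsub>M\<^esub>" "\<zero>\<^bsub>N\<^esub>"] by simp
  next
    case (single u c)
    then obtain x y where u: "u = (x, y)" "x \<in> carrier M" "y \<in> carrier N" by auto
    then show ?case
      using pure[of "c \<odot>\<^bsub>M\<^esub> x" y] by (simp add: coset_single pure_tensor_smult_left)
  next
    case (add p q)
    then have "?c (p + q) = ?c p \<oplus>\<^bsub>tensor M N\<^esub> ?c q"
      using T.quotient_add[of p q] by (simp add: tensor_def)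
    moreover have "?c p \<in> carrier (tensor M N)" "?c q \<in> carrier (tensor M N)"
      using add by (auto simp: tensor_def carrier_quotient_module)
    ultimately show ?case using add.IH assms(3) by simp
  qed
  with p show ?thesis by simp
qed

lemma linear_maps_tensor_eqI:
  assumes "f \<in> linear_maps (tensor M N) L" "g \<in> linear_maps (tensor M N) L"
    and "\<And>x y. x \<in> carrier M \<Longrightarrow> y \<in> carrier N \<Longrightarrow> f (pure_tensor M N x y) = g (pure_tensor M N x y)"
    and "t \<in> carrier (tensor M N)"
  shows "f t = g t"
  using assms(4)
  by (induction t rule: tensor_induct) (use assms(1-3) in \<open>auto simp: linear_maps_add\<close>)

text \<open>The kernel of \<open>f\<close> is a submodule, and bilinearity of \<open>h\<close> puts
  the relators into it. The map \<open>f\<close> need not be given as a linear extension: the lemma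
  is also applied to multiplication by a monomial followed by the coset map, to see that the
  submodule is an ideal.\<close>

lemma bilinear_kills_tensor_submodule:
  assumes L: "kmod L" and h: "bilinear_map M N L h" and f: "f \<in> linear_maps free_module L"
    and fh: "\<And>x y. x \<in> carrier M \<Longrightarrow> y \<in> carrier N \<Longrightarrow> f (Poly_Mapping.single (x, y) 1) = h x y"
    and "p \<in> tensor_submodule M N"
  shows "f p = \<zero>\<^bsub>L\<^esub>"
proof -
  interpret L: kmod L by fact
  let ?K = "{p \<in> carrier free_module. f p = \<zero>\<^bsub>L\<^esub>}" and ?s = "Poly_Mapping.single :: _ \<Rightarrow> 'k \<Rightarrow> _"
  have sub: "submodule ?K ring_of_type_algebra free_module"
    by (rule T.submodule_if_closed)
      (use linear_maps_zero[OF kmod_monoid_algebra L f] linear_maps_add[OF f] linear_maps_smult[OF f] T.smult_closed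
        in auto)
  have fs: "f (?s (x, y) c) = c \<odot>\<^bsub>L\<^esub> h x y" if "x \<in> carrier M" "y \<in> carrier N" for x y c
    using linear_maps_smult[OF f, of "?s (x, y) 1" c] fh[OF that] that by (simp add: map_times_single)
  have hc: "h x y \<in> carrier L" if "x \<in> carrier M" "y \<in> carrier N" for x y
    using h that by (auto simp: bilinear_map_def linear_maps_closed)
  have fm: "f (p - q) = f p \<ominus>\<^bsub>L\<^esub> f q" if "Poly_Mapping.keys p \<subseteq> carrier M \<times> carrier N" "Poly_Mapping.keys q \<subseteq> carrier M \<times> carrier N" for p q
    using linear_maps_minus[OF kmod_monoid_algebra L f, of p q] that by (simp add: monoid_algebra_minus)
  have kills: "f p = \<zero>\<^bsub>L\<^esub>" if "p \<in> tensor_relators M N" for p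
  proof -
    have cancel: "(a \<oplus>\<^bsub>L\<^esub> b) \<ominus>\<^bsub>L\<^esub> a \<ominus>\<^bsub>L\<^esub> b = \<zero>\<^bsub>L\<^esub>" "a \<ominus>\<^bsub>L\<^esub> a = \<zero>\<^bsub>L\<^esub>"
      if "a \<in> carrier L" "b \<in> carrier L" for a b
      using that L.r_neg[of "a \<oplus>\<^bsub>L\<^esub> b"] by (simp_all add: a_minus_def L.a_assoc L.minus_add L.r_neg)
    have hl: "h (x \<oplus>\<^bsub>M\<^esub> x') y = h x y \<oplus>\<^bsub>L\<^esub> h x' y" "h (c \<odot>\<^bsub>M\<^esub> x) y = c \<odot>\<^bsub>L\<^esub> h x y"
      if "x \<in> carrier M" "x' \<in> carrier M" "y \<in> carrier N" for x x' y c
      using h that linear_maps_add[of "\<lambda>x. h x y" M L x x'] linear_maps_smult[of "\<lambda>x. h x y" M L x c]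
      by (auto simp: bilinear_map_def)
    have hr: "h x (y \<oplus>\<^bsub>N\<^esub> y') = h x y \<oplus>\<^bsub>L\<^esub> h x y'" "h x (c \<odot>\<^bsub>N\<^esub> y) = c \<odot>\<^bsub>L\<^esub> h x y"
      if "x \<in> carrier M" "y \<in> carrier N" "y' \<in> carrier N" for x y y' c
      using h that linear_maps_add[of "h x" N L y y'] linear_maps_smult[of "h x" N L y c]
      by (auto simp: bilinear_map_def)
    note hl' = hl(2)[OF _ M.zero_closed] and hr' = hr(2)[OF _ _ N.zero_closed]
    from that show ?thesis
      unfolding tensor_relators_def
      \<comment> \<open>Additivity relators are built from three monomials and need
        \<open>fm\<close> twice, scalar relators only once; hence the optional second
        substitution.\<close>
      by (elim UnE CollectE exE conjE; simp only:; subst fm; (subst fm)?)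
        (simp_all add: fs hc hl(1) hr(1) hl' hr' cancel(1) cancel(2)[OF _ L.zero_closed] keys_minus_subset)
  qed
  have "tensor_submodule M N \<subseteq> ?K"
    unfolding tensor_submodule_def
  proof (rule hull_minimal)
    show "tensor_relators M N \<subseteq> ?K" using kills tensor_relators_subset by auto
  qed (rule sub)
  with assms(5) show ?thesis by auto
qed

text \<open>Existence half of the universal property of the tensor product; uniqueness is
  \<open>linear_maps_tensor_eqI\<close>. The linear extension of a bilinear map kills the relators
  and therefore descends to cosets.\<close>

lemma
  assumes L: "kmod L" and h: "bilinear_map M N L h"
  shows tensor_lift_linear: "induced L (\<lambda>(x, y). h x y) \<in> linear_maps (tensor M N) L"
    and tensor_lift_pure: "x \<in> carrier M \<Longrightarrow> y \<in> carrier N \<Longrightarrow>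
      induced L (\<lambda>(x, y). h x y) (pure_tensor M N x y) = h x y"
proof -
  interpret L: kmod L by fact
  let ?h = "\<lambda>(x, y). h x y"
  have hc: "h x y \<in> carrier L" if "x \<in> carrier M" "y \<in> carrier N" for x y
    using h that by (auto simp: bilinear_map_def linear_maps_closed)
  then have h': "?h \<in> carrier (M \<times>\<times> N) \<rightarrow> carrier L" by auto
  note lin = L.linear_extension_linear[OF h']
  have kill: "linear_extension L ?h p = \<zero>\<^bsub>L\<^esub>" if "p \<in> tensor_submodule M N" for p
    by (rule bilinear_kills_tensor_submodule[OF L h lin _ that]) (simp add: hc)
  show "induced L ?h \<in> linear_maps (tensor M N) L"
    using T.the_elem_linear[OF L lin kill] unfolding induced_def tensor_def by simp
  assume "x \<in> carrier M" "y \<in> carrier N"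
  then show "induced L ?h (pure_tensor M N x y) = h x y"
    using T.the_elem_coset[OF L lin kill, of "Poly_Mapping.single (x, y) 1"]
    by (simp add: induced_def pure_tensor_def hc)
qed

end

lemma
  assumes "kmod M" "kmod N" "kmod M'" "kmod N'" "f \<in> linear_maps M M'" "g \<in> linear_maps N N'"
  shows tensor_map_linear: "tensor_map M' N' f g \<in> linear_maps (tensor M N) (tensor M' N')"
    and tensor_map_pure: "x \<in> carrier M \<Longrightarrow> y \<in> carrier N \<Longrightarrow>
      tensor_map M' N' f g (pure_tensor M N x y) = pure_tensor M' N' (f x) (g y)"
proof -
  interpret P: kmod_pair M N using assms by (simp add: kmod_pair_def)
  interpret P': kmod_pair M' N' using assms by (simp add: kmod_pair_def)
  have "bilinear_map M N (tensor M' N') (\<lambda>x y. pure_tensor M' N' (f x) (g y))"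
    by (rule bilinear_map_pre[OF P'.pure_tensor_bilinear assms(5,6)])
  from P.tensor_lift_linear[OF P'.TT.kmod_axioms this] P.tensor_lift_pure[OF P'.TT.kmod_axioms this]
  show "tensor_map M' N' f g \<in> linear_maps (tensor M N) (tensor M' N')"
    and "x \<in> carrier M \<Longrightarrow> y \<in> carrier N \<Longrightarrow>
      tensor_map M' N' f g (pure_tensor M N x y) = pure_tensor M' N' (f x) (g y)"
    by (simp_all add: tensor_map_def)
qed

locale kalg_pair = M: kalg M + N: kalg N
  for M :: "('k::comm_ring_1, 'a) module" and N :: "('k, 'b) module"
begin

sublocale kmod_pair M N ..

lemma monoid_DirProd: "Group.monoid (M \<times>\<times> N)"
  by (rule DirProd_monoid) unfold_locales

sublocale F: kalg free_module
  by (rule kalg_monoid_algebra[OF monoid_DirProd])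

text \<open>For a monomial c (u, v), multiplying by it and passing to cosets is a linear map on the
  free module whose value at (x, y) is c times the tensor of u x and v y. This is bilinear in (x,
  y), so the map kills the submodule. General multipliers follow by additivity.\<close>

lemma tensor_submodule_mult:
  assumes a: "a \<in> tensor_submodule M N" and "p \<in> carrier free_module"
  shows "p \<otimes>\<^bsub>free_module\<^esub> a \<in> tensor_submodule M N" (is ?A)
    and "a \<otimes>\<^bsub>free_module\<^esub> p \<in> tensor_submodule M N" (is ?B)
proof -
  let ?c = "\<lambda>p. tensor_submodule M N +>\<^bsub>free_module\<^esub> p"
  have lc: "?c \<in> linear_maps free_module (tensor M N)"
    using T.coset_linear by (simp add: tensor_def)
  have zero: "q \<in> tensor_submodule M N \<longleftrightarrow> ?c q = \<zero>\<^bsub>tensor M N\<^esub>" if "q \<in> carrier free_module" for q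
    using T.coset_eq_zero_iff[OF that] by (simp add: tensor_def quotient_module_simps)
  have a': "a \<in> carrier free_module" using a T.a_subset by blast
  have "Poly_Mapping.keys p \<subseteq> carrier M \<times> carrier N" using assms(2) by simp
  then have "?A \<and> ?B"
  proof (induction p rule: keys_induct)
    case zero
    then show ?case using T.zero_closed by simp
  next
    case (single w c)
    then obtain u v where w: "w = (u, v)" "u \<in> carrier M" "v \<in> carrier N" by auto
    let ?s = "Poly_Mapping.single (u, v) c"
    have sc: "?s \<in> carrier free_module" using w by auto
    note sl = linear_maps_comp[OF kalg_mult_left_linear[OF F.kalg_axioms sc] lc]
      and sr = linear_maps_comp[OF kalg_mult_right_linear[OF F.kalg_axioms sc] lc]
    have c: "(\<lambda>t. c \<odot>\<^bsub>tensor M N\<^esub> t) \<in> linear_maps (tensor M N) (tensor M N)"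
      by (rule linear_mapsI) (simp_all add: TT.smult_r_distr mult.commute flip: TT.smult_assoc)
    have "bilinear_map M N (tensor M N) (\<lambda>x y. c \<odot>\<^bsub>tensor M N\<^esub> pure_tensor M N (u \<otimes>\<^bsub>M\<^esub> x) (v \<otimes>\<^bsub>N\<^esub> y))"
      by (intro bilinear_map_linear[OF pure_tensor_bilinear _ _ c] kalg_mult_left_linear M.kalg_axioms N.kalg_axioms w)
    from bilinear_kills_tensor_submodule[OF TT.kmod_axioms this sl _ a]
    have A: "?c (?s \<otimes>\<^bsub>free_module\<^esub> a) = \<zero>\<^bsub>tensor M N\<^esub>"
      using w by (simp add: coset_single)
    have "bilinear_map M N (tensor M N) (\<lambda>x y. c \<odot>\<^bsub>tensor M N\<^esub> pure_tensor M N (x \<otimes>\<^bsub>M\<^esub> u) (y \<otimes>\<^bsub>N\<^esub> v))"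
      by (intro bilinear_map_linear[OF pure_tensor_bilinear _ _ c] kalg_mult_right_linear M.kalg_axioms N.kalg_axioms w)
    from bilinear_kills_tensor_submodule[OF TT.kmod_axioms this sr _ a]
    have B: "?c (a \<otimes>\<^bsub>free_module\<^esub> ?s) = \<zero>\<^bsub>tensor M N\<^esub>"
      using w by (simp add: coset_single)
    show ?case using A B a' sc zero[OF F.m_closed[OF sc a']] zero[OF F.m_closed[OF a' sc]] w(1) by simp
  next
    case (add p q)
    then show ?case
      using T.a_closed by (simp add: monoid_algebra_mult_add_left monoid_algebra_mult_add_right)
  qed
  then show ?A ?B by auto
qed

sublocale I: kideal "tensor_submodule M N" free_module
  by (unfold_locales) (auto intro: tensor_submodule_mult)

sublocale TA: kalg "tensor M N"
  unfolding tensor_def by (rule I.kalg_quotient)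

lemma pure_tensor_mult:
  assumes "x \<in> carrier M" "y \<in> carrier N" "x' \<in> carrier M" "y' \<in> carrier N"
  shows "pure_tensor M N x y \<otimes>\<^bsub>tensor M N\<^esub> pure_tensor M N x' y' = pure_tensor M N (x \<otimes>\<^bsub>M\<^esub> x') (y \<otimes>\<^bsub>N\<^esub> y')"
  using I.quotient_mult[of "Poly_Mapping.single (x, y) 1" "Poly_Mapping.single (x', y') 1"] assms
  by (simp add: pure_tensor_def tensor_def)

lemma tensor_one: "\<one>\<^bsub>tensor M N\<^esub> = pure_tensor M N \<one>\<^bsub>M\<^esub> \<one>\<^bsub>N\<^esub>"
  by (simp add: tensor_def pure_tensor_def quotient_module_simps DirProd_def)

text \<open>Both sides of multiplicativity are additive in each argument, so pure tensors
  suffice.\<close>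

lemma tensor_kalg_homI:
  assumes "kalg C" and f: "f \<in> linear_maps (tensor M N) C"
    and mult: "\<And>x y x' y'. x \<in> carrier M \<Longrightarrow> y \<in> carrier N \<Longrightarrow> x' \<in> carrier M \<Longrightarrow> y' \<in> carrier N \<Longrightarrow>
      f (pure_tensor M N (x \<otimes>\<^bsub>M\<^esub> x') (y \<otimes>\<^bsub>N\<^esub> y')) = f (pure_tensor M N x y) \<otimes>\<^bsub>C\<^esub> f (pure_tensor M N x' y')"
    and one: "f (pure_tensor M N \<one>\<^bsub>M\<^esub> \<one>\<^bsub>N\<^esub>) = \<one>\<^bsub>C\<^esub>"
  shows "f \<in> kalg_hom (tensor M N) C"
proof (rule kalg_homI[OF f])
  interpret C: kalg C by fact
  fix s t assume "s \<in> carrier (tensor M N)" "t \<in> carrier (tensor M N)"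
  then show "f (s \<otimes>\<^bsub>tensor M N\<^esub> t) = f s \<otimes>\<^bsub>C\<^esub> f t"
  proof (induction s rule: tensor_induct)
    case (pure x y)
    from pure(3,1,2) show ?case
    proof (induction t rule: tensor_induct)
      case (pure x' y')
      then show ?case by (simp add: pure_tensor_mult mult)
    next
      case (add s t)
      then show ?case
        by (simp add: TA.r_distr C.r_distr linear_maps_add[OF f] linear_maps_closed[OF f])
    qed
  next
    case (add s s')
    then show ?case
      by (simp add: TA.l_distr C.l_distr linear_maps_add[OF f] linear_maps_closed[OF f])
  qed
qed (simp add: tensor_one one)

end

lemma tensor_map_kalg_hom:
  assumes "kalg M" "kalg N" "kalg M'" "kalg N'" and f: "f \<in> kalg_hom M M'" and g: "g \<in> kalg_hom N N'"
  shows "tensor_map M' N' f g \<in> kalg_hom (tensor M N) (tensor M' N')"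
proof -
  interpret P: kalg_pair M N using assms by (simp add: kalg_pair_def)
  interpret P': kalg_pair M' N' using assms by (simp add: kalg_pair_def)
  note * = P.M.kmod_axioms P.N.kmod_axioms P'.M.kmod_axioms P'.N.kmod_axioms kalg_hom_linear[OF f] kalg_hom_linear[OF g]
  show ?thesis
    by (rule P.tensor_kalg_homI[OF P'.TA.kalg_axioms tensor_map_linear[OF *]])
      (simp_all add: tensor_map_pure[OF *] P'.pure_tensor_mult P'.tensor_one kalg_hom_mult[OF f] kalg_hom_mult[OF g]
        kalg_hom_one[OF f] kalg_hom_one[OF g] linear_maps_closed[OF kalg_hom_linear[OF f]]
        linear_maps_closed[OF kalg_hom_linear[OF g]])
qed

section \<open>Opposite algebras\<close>

definition op_alg :: "('k, 'a) module \<Rightarrow> ('k, 'a) module" where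
  "op_alg A = A\<lparr>monoid.mult := (\<lambda>x y. y \<otimes>\<^bsub>A\<^esub> x)\<rparr>"

lemma op_alg_simps [simp]:
  "carrier (op_alg A) = carrier A" "x \<otimes>\<^bsub>op_alg A\<^esub> y = y \<otimes>\<^bsub>A\<^esub> x" "\<one>\<^bsub>op_alg A\<^esub> = \<one>\<^bsub>A\<^esub>"
  "\<zero>\<^bsub>op_alg A\<^esub> = \<zero>\<^bsub>A\<^esub>" "add (op_alg A) = add A" "c \<odot>\<^bsub>op_alg A\<^esub> x = c \<odot>\<^bsub>A\<^esub> x"
  by (simp_all add: op_alg_def)

text \<open>The underlying module is untouched, so a linear map on an algebra serves for its
  opposite without any conversion. Descent uses this for the projection onto Z / k1.\<close>

lemma linear_maps_op_alg [simp]: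
  "linear_maps (op_alg A) N = linear_maps A N" "linear_maps N (op_alg A) = linear_maps N A"
  by (simp_all add: linear_maps_def)

lemma finsum_op_alg [simp]: "finsum (op_alg A) = finsum A"
  by (simp add: fun_eq_iff finsum_def finprod_def op_alg_def)

lemma kalg_op_alg:
  assumes "kalg A"
  shows "kalg (op_alg A)"
proof -
  interpret kalg A by fact
  have "abelian_group (op_alg A)"
    by (rule abelian_groupI) (auto simp: a_ac intro: bexI[of _ "\<ominus>\<^bsub>A\<^esub> _"] l_neg)
  then have "ring (op_alg A)"
    by (intro ringI monoidI) (auto simp: m_assoc l_distr r_distr)
  with \<open>abelian_group _\<close> show ?thesis
    by (auto simp: kalg_def kmod_def kmod_axioms_def kalg_axioms_def smult_l_distr smult_r_distr smult_assoc
        smult_mult_left smult_mult_right)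
qed

section \<open>Matrices over an algebra\<close>

definition amat :: "('k, 'a) module \<Rightarrow> 'a mat \<Rightarrow> bool" where
  "amat A U \<longleftrightarrow> (\<forall>i<dim_row U. \<forall>j<dim_col U. U $$ (i, j) \<in> carrier A)"

text \<open>Entries lie in the carrier of a record, so sums and products are those of the record.
  Sizes are read off the matrices, and compatibility appears as equations between
  dimensions.\<close>

definition mmul :: "('k, 'a) module \<Rightarrow> 'a mat \<Rightarrow> 'a mat \<Rightarrow> 'a mat" (infixl \<open>\<boxtimes>\<index>\<close> 70) where
  "U \<boxtimes>\<^bsub>A\<^esub> Y = mat (dim_row U) (dim_col Y) (\<lambda>(i, j). \<Oplus>\<^bsub>A\<^esub>l\<in>{..<dim_col U}. U $$ (i, l) \<otimes>\<^bsub>A\<^esub> Y $$ (l, j))"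

definition smat :: "('k, 'a) module \<Rightarrow> 'k mat \<Rightarrow> 'a mat" where
  "smat A U = map_mat (\<lambda>c. c \<odot>\<^bsub>A\<^esub> \<one>\<^bsub>A\<^esub>) U"

lemma mmul_dims [simp]: "dim_row (U \<boxtimes>\<^bsub>A\<^esub> Y) = dim_row U" "dim_col (U \<boxtimes>\<^bsub>A\<^esub> Y) = dim_col Y"
  by (simp_all add: mmul_def)

lemma smat_dims [simp]: "dim_row (smat A U) = dim_row U" "dim_col (smat A U) = dim_col U"
  by (simp_all add: smat_def)

lemma mmul_index: "i < dim_row U \<Longrightarrow> j < dim_col Y \<Longrightarrow>
    (U \<boxtimes>\<^bsub>A\<^esub> Y) $$ (i, j) = (\<Oplus>\<^bsub>A\<^esub>l\<in>{..<dim_col U}. U $$ (i, l) \<otimes>\<^bsub>A\<^esub> Y $$ (l, j))"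
  by (simp add: mmul_def)

lemma smat_index: "i < dim_row U \<Longrightarrow> j < dim_col U \<Longrightarrow> smat A U $$ (i, j) = U $$ (i, j) \<odot>\<^bsub>A\<^esub> \<one>\<^bsub>A\<^esub>"
  by (simp add: smat_def)

lemma amatD: "amat A U \<Longrightarrow> i < dim_row U \<Longrightarrow> j < dim_col U \<Longrightarrow> U $$ (i, j) \<in> carrier A"
  by (simp add: amat_def)

lemma amat_transpose [simp]: "amat A (transpose_mat U) \<longleftrightarrow> amat A U"
  by (auto simp: amat_def)

lemma transpose_smat: "transpose_mat (smat A U) = smat A (transpose_mat U)"
  by (rule eq_matI) (auto simp: smat_index)

lemma amat_op_alg [simp]: "amat (op_alg A) U \<longleftrightarrow> amat A U"
  by (simp add: amat_def)

lemma smat_op_alg [simp]: "smat (op_alg A) U = smat A U"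
  by (simp add: smat_def)

context kalg
begin

lemma amat_smat [simp]: "amat A (smat A U)"
  by (auto simp: amat_def smat_index)

lemma amat_mmul [simp]: "amat A U \<Longrightarrow> amat A Y \<Longrightarrow> dim_col U = dim_row Y \<Longrightarrow> amat A (U \<boxtimes> Y)"
  by (auto simp: amat_def mmul_index intro!: finsum_closed)

lemma mmul_assoc:
  assumes "amat A U" "amat A Y" "amat A Z" "dim_col U = dim_row Y" "dim_col Y = dim_row Z"
  shows "U \<boxtimes> Y \<boxtimes> Z = U \<boxtimes> (Y \<boxtimes> Z)"
proof (rule eq_matI)
  fix i j assume "i < dim_row (U \<boxtimes> (Y \<boxtimes> Z))" "j < dim_col (U \<boxtimes> (Y \<boxtimes> Z))"
  then have ij: "i < dim_row U" "j < dim_col Z" by auto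
  note c = amatD[OF assms(1)] amatD[OF assms(2)] amatD[OF assms(3)]
  have "(U \<boxtimes> Y \<boxtimes> Z) $$ (i, j) = (\<Oplus>q\<in>{..<dim_col Y}. (\<Oplus>p\<in>{..<dim_col U}. U $$ (i, p) \<otimes> Y $$ (p, q)) \<otimes> Z $$ (q, j))"
    using ij assms(4,5) c by (auto simp: mmul_index intro!: finsum_cong' finsum_closed)
  also have "\<dots> = (\<Oplus>q\<in>{..<dim_col Y}. \<Oplus>p\<in>{..<dim_col U}. U $$ (i, p) \<otimes> Y $$ (p, q) \<otimes> Z $$ (q, j))"
    using ij assms(4,5) c by (intro finsum_cong' refl finsum_ldistr) (auto intro!: finsum_closed)
  also have "\<dots> = (\<Oplus>p\<in>{..<dim_col U}. \<Oplus>q\<in>{..<dim_col Y}. U $$ (i, p) \<otimes> Y $$ (p, q) \<otimes> Z $$ (q, j))"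
    using ij assms(4,5) c by (intro finsum_swap) auto
  also have "\<dots> = (\<Oplus>p\<in>{..<dim_col U}. U $$ (i, p) \<otimes> (\<Oplus>q\<in>{..<dim_col Y}. Y $$ (p, q) \<otimes> Z $$ (q, j)))"
    using ij assms(4,5) c by (intro finsum_cong' refl) (auto intro!: finsum_closed finsum_cong' simp: finsum_rdistr m_assoc)
  also have "\<dots> = (U \<boxtimes> (Y \<boxtimes> Z)) $$ (i, j)"
    using ij assms(4,5) c by (auto simp: mmul_index intro!: finsum_cong' finsum_closed)
  finally show "(U \<boxtimes> Y \<boxtimes> Z) $$ (i, j) = (U \<boxtimes> (Y \<boxtimes> Z)) $$ (i, j)" .
qed auto

lemma smat_mult:
  assumes "dim_col U = dim_row Y"
  shows "smat A U \<boxtimes> smat A Y = smat A (U * Y)"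
proof (rule eq_matI)
  fix i j assume "i < dim_row (smat A (U * Y))" "j < dim_col (smat A (U * Y))"
  then have ij: "i < dim_row U" "j < dim_col Y" by auto
  have "(smat A U \<boxtimes> smat A Y) $$ (i, j) = (\<Oplus>l\<in>{..<dim_col U}. (U $$ (i, l) * Y $$ (l, j)) \<odot> \<one>)"
    using ij assms by (auto simp: mmul_index smat_index smult_mult_left smult_mult_right mult.commute simp flip: smult_assoc intro!: finsum_cong')
  also have "\<dots> = (\<Sum>l<dim_col U. U $$ (i, l) * Y $$ (l, j)) \<odot> \<one>"
    by (rule finsum_sum_smult[symmetric]) simp
  also have "(\<Sum>l<dim_col U. U $$ (i, l) * Y $$ (l, j)) = (U * Y) $$ (i, j)"
    using ij assms by (auto simp: scalar_prod_def atLeast0LessThan intro!: sum.cong)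
  finally show "(smat A U \<boxtimes> smat A Y) $$ (i, j) = smat A (U * Y) $$ (i, j)"
    using ij by (simp add: smat_index)
qed auto

lemma smat_one_mult [simp]:
  assumes "amat A U" "dim_row U = n"
  shows "smat A (1\<^sub>m n) \<boxtimes> U = U"
proof (rule eq_matI)
  fix i j assume ij: "i < dim_row U" "j < dim_col U"
  note c = amatD[OF assms(1)]
  have "(smat A (1\<^sub>m n) \<boxtimes> U) $$ (i, j) = (\<Oplus>l\<in>{..<n}. if i = l then U $$ (l, j) else \<zero>)"
    using ij assms(2) c by (auto simp: mmul_index smat_index smult_mult_left intro!: finsum_cong')
  also have "\<dots> = U $$ (i, j)"
    using ij assms(2) c by (intro add.finprod_singleton) auto
  finally show "(smat A (1\<^sub>m n) \<boxtimes> U) $$ (i, j) = U $$ (i, j)" .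
qed (use assms in auto)

lemma mult_smat_one [simp]:
  assumes "amat A U" "dim_col U = n"
  shows "U \<boxtimes> smat A (1\<^sub>m n) = U"
proof (rule eq_matI)
  fix i j assume ij: "i < dim_row U" "j < dim_col U"
  note c = amatD[OF assms(1)]
  have "(U \<boxtimes> smat A (1\<^sub>m n)) $$ (i, j) = (\<Oplus>l\<in>{..<n}. if j = l then U $$ (i, l) else \<zero>)"
    using ij assms(2) c by (auto simp: mmul_index smat_index smult_mult_right intro!: finsum_cong')
  also have "\<dots> = U $$ (i, j)"
    using ij assms(2) c by (intro add.finprod_singleton) auto
  finally show "(U \<boxtimes> smat A (1\<^sub>m n)) $$ (i, j) = U $$ (i, j)" .
qed (use assms in auto)

text \<open>Over a noncommutative algebra transposition reverses a product only if the entries of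
  the two factors commute with each other. The two lemmas that follow are the case of a scalar
  factor, whose entries are central.\<close>

lemma transpose_mmul:
  assumes "amat A U" "amat A Y" "dim_col U = dim_row Y"
    and "\<And>i p j. i < dim_row U \<Longrightarrow> p < dim_col U \<Longrightarrow> j < dim_col Y \<Longrightarrow>
      U $$ (i, p) \<otimes> Y $$ (p, j) = Y $$ (p, j) \<otimes> U $$ (i, p)"
  shows "transpose_mat (U \<boxtimes> Y) = transpose_mat Y \<boxtimes> transpose_mat U"
  using assms(3,4) amatD[OF assms(1)] amatD[OF assms(2)]
  by (intro eq_matI) (auto simp: mmul_index intro!: finsum_cong')

lemma transpose_smat_mmul:
  assumes "amat A U" "dim_col S = dim_row U"
  shows "transpose_mat (smat A S \<boxtimes> U) = transpose_mat U \<boxtimes> smat A (transpose_mat S)"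
  unfolding transpose_smat[symmetric] using assms amatD[OF assms(1)]
  by (intro transpose_mmul) (auto simp: smat_index smult_mult_left smult_mult_right)

lemma transpose_mmul_smat:
  assumes "amat A U" "dim_col U = dim_row S"
  shows "transpose_mat (U \<boxtimes> smat A S) = smat A (transpose_mat S) \<boxtimes> transpose_mat U"
  unfolding transpose_smat[symmetric] using assms amatD[OF assms(1)]
  by (intro transpose_mmul) (auto simp: smat_index smult_mult_left smult_mult_right)

text \<open>Here no commutation is required: swapping the factors and swapping the order of each
  entrywise product compensate. It turns matrix relations over the opposite algebra into relations
  over the algebra.\<close>

lemma op_alg_mmul:
  assumes "amat A U" "amat A Y" "dim_col U = dim_row Y"
  shows "U \<boxtimes>\<^bsub>op_alg A\<^esub> Y = transpose_mat (transpose_mat Y \<boxtimes> transpose_mat U)"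
  using assms(3) amatD[OF assms(1)] amatD[OF assms(2)]
  by (intro eq_matI) (auto simp: mmul_index intro!: finsum_cong')

end

lemma
  assumes "kalg A" "kalg B" "f \<in> kalg_hom A B"
  shows amat_map: "amat A U \<Longrightarrow> amat B (map_mat f U)"
    and map_smat: "map_mat f (smat A S) = smat B S"
    and map_mmul: "amat A U \<Longrightarrow> amat A Y \<Longrightarrow> dim_col U = dim_row Y \<Longrightarrow>
      map_mat f (U \<boxtimes>\<^bsub>A\<^esub> Y) = map_mat f U \<boxtimes>\<^bsub>B\<^esub> map_mat f Y"
proof -
  interpret A: kalg A by fact
  interpret B: kalg B by fact
  note lin = kalg_hom_linear[OF assms(3)]
  note fc = linear_maps_closed[OF lin]
  show "amat A U \<Longrightarrow> amat B (map_mat f U)"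
    by (auto simp: amat_def fc)
  show "map_mat f (smat A S) = smat B S"
    by (rule eq_matI) (auto simp: smat_index linear_maps_smult[OF lin] kalg_hom_one[OF assms(3)])
  assume U: "amat A U" and Y: "amat A Y" and d: "dim_col U = dim_row Y"
  show "map_mat f (U \<boxtimes>\<^bsub>A\<^esub> Y) = map_mat f U \<boxtimes>\<^bsub>B\<^esub> map_mat f Y"
    using amatD[OF U] amatD[OF Y] d
    by (intro eq_matI) (auto simp: mmul_index linear_maps_finsum[OF A.kmod_axioms B.kmod_axioms lin] Pi_def
        kalg_hom_mult[OF assms(3)] fc intro!: B.finsum_cong')
qed

lemma map_transpose: "map_mat f (transpose_mat U) = transpose_mat (map_mat f U)"
  by (rule eq_matI) auto

subsection \<open>Invertible scalar matrices\<close>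

lemma GL_iff: "P \<in> GL n \<longleftrightarrow> P \<in> carrier_mat n n \<and> (\<exists>Q\<in>carrier_mat n n. P * Q = 1\<^sub>m n \<and> Q * P = 1\<^sub>m n)"
  by (auto simp: GL_def Units_def ring_mat_simps)

lemma
  assumes "F \<in> GL n"
  shows GL_carrier: "F \<in> carrier_mat n n"
    and mat_inv_carrier: "mat_inv F \<in> carrier_mat n n"
    and mat_inv_right: "F * mat_inv F = 1\<^sub>m n"
    and mat_inv_left: "mat_inv F * F = 1\<^sub>m n"
proof -
  show F: "F \<in> carrier_mat n n" using assms by (simp add: GL_iff)
  interpret R: semiring "ring_mat TYPE('a) n ()" by (rule semiring_mat)
  show "mat_inv F \<in> carrier_mat n n" "F * mat_inv F = 1\<^sub>m n" "mat_inv F * F = 1\<^sub>m n"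
    using assms F R.Units_inv_closed[of F] R.Units_r_inv[of F] R.Units_l_inv[of F]
    by (auto simp: mat_inv_def GL_def ring_mat_simps)
qed

lemma transpose_GL:
  assumes "P \<in> GL n"
  shows "transpose_mat P \<in> GL n"
proof -
  obtain Q where "P \<in> carrier_mat n n" "Q \<in> carrier_mat n n" "P * Q = 1\<^sub>m n" "Q * P = 1\<^sub>m n"
    using assms by (auto simp: GL_iff)
  then show ?thesis
    by (auto simp: GL_iff intro!: bexI[of _ "transpose_mat Q"] simp flip: transpose_mult)
qed

text \<open>Padding to square matrices gives \<open>P\<close> a zero row if \<open>m < n\<close>, which contradicts
  \<open>det Q * det P = 1\<close>.\<close>

lemma left_inverse_imp_dim_le:
  fixes P Q :: "'k::comm_ring_1 mat"
  assumes P: "P \<in> carrier_mat m n" and Q: "Q \<in> carrier_mat n m" and QP: "Q * P = 1\<^sub>m n"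
  shows "n \<le> m"
proof (rule ccontr)
  assume "\<not> n \<le> m"
  define P' where "P' = mat n n (\<lambda>(i, j). if i < m then P $$ (i, j) else 0)"
  define Q' where "Q' = mat n n (\<lambda>(i, j). if j < m then Q $$ (i, j) else 0)"
  have P': "P' \<in> carrier_mat n n" and Q': "Q' \<in> carrier_mat n n" by (auto simp: P'_def Q'_def)
  have "Q' * P' = Q * P"
  proof (rule eq_matI)
    fix i j assume "i < dim_row (Q * P)" "j < dim_col (Q * P)"
    then have ij: "i < n" "j < n" using P Q by auto
    have "(Q' * P') $$ (i, j) = (\<Sum>l\<in>{0..<n}. if l < m then Q $$ (i, l) * P $$ (l, j) else 0)"
      using ij by (auto simp: P'_def Q'_def scalar_prod_def intro!: sum.cong)
    also have "\<dots> = (\<Sum>l\<in>{0..<m}. Q $$ (i, l) * P $$ (l, j))"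
      using \<open>\<not> n \<le> m\<close> by (intro sum.mono_neutral_cong_right) auto
    also have "\<dots> = (Q * P) $$ (i, j)"
      using ij P Q by (auto simp: scalar_prod_def intro!: sum.cong)
    finally show "(Q' * P') $$ (i, j) = (Q * P) $$ (i, j)" .
  qed (use P' Q' P Q in auto)
  then have "det Q' * det P' = 1"
    using det_mult[OF Q' P'] QP by simp
  \<comment> \<open>Row \<open>m\<close> exists because \<open>m < n\<close>; rewriting it as an
    explicit zero vector matches the determinant rule.\<close>
  moreover have "P' = mat\<^sub>r n n (\<lambda>i. if i = m then 0\<^sub>v n else row P' i)"
    using P' by (intro eq_matI) (auto simp: P'_def)
  then have "det P' = 0"
    using det_row_0[of m n "row P'"] P' \<open>\<not> n \<le> m\<close> by auto
  ultimately show False by simp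
qed

subsection \<open>The defining relations\<close>

text \<open>The defining relations as matrix equations in an arbitrary algebra. Such solutions
  amount to algebra maps out of \<open>B_alg E F\<close>: \<open>B_hom\<close> gives the map of a
  solution, and \<open>B_relation_map\<close> shows that maps carry solutions to solutions.\<close>

definition B_relation :: "('k::comm_ring_1, 'a) module \<Rightarrow> 'k mat \<Rightarrow> 'k mat \<Rightarrow> 'a mat \<Rightarrow> bool" where
  "B_relation A E F z \<longleftrightarrow> amat A z \<and> dim_row z = dim_row E \<and> dim_col z = dim_row F \<and>
     smat A (mat_inv F) \<boxtimes>\<^bsub>A\<^esub> transpose_mat z \<boxtimes>\<^bsub>A\<^esub> smat A E \<boxtimes>\<^bsub>A\<^esub> z = smat A (1\<^sub>m (dim_row F)) \<and>
     z \<boxtimes>\<^bsub>A\<^esub> smat A (mat_inv F) \<boxtimes>\<^bsub>A\<^esub> transpose_mat z \<boxtimes>\<^bsub>A\<^esub> smat A E = smat A (1\<^sub>m (dim_row E))"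

definition B_inverse :: "('k::comm_ring_1, 'a) module \<Rightarrow> 'k mat \<Rightarrow> 'k mat \<Rightarrow> 'a mat \<Rightarrow> 'a mat" where
  "B_inverse A E F z = smat A (mat_inv F) \<boxtimes>\<^bsub>A\<^esub> transpose_mat z \<boxtimes>\<^bsub>A\<^esub> smat A E"

locale B_solution = kalg A for A :: "('k::comm_ring_1, 'a) module" (structure) and E F z n m +
  assumes E: "E \<in> GL n" and F: "F \<in> GL m" and rel: "B_relation A E F z"
begin

abbreviation "w \<equiv> B_inverse A E F z"

lemmas E_mat = GL_carrier[OF E] mat_inv_carrier[OF E] mat_inv_right[OF E] mat_inv_left[OF E]
lemmas F_mat = GL_carrier[OF F] mat_inv_carrier[OF F] mat_inv_right[OF F] mat_inv_left[OF F]

lemma dims [simp]: "dim_row E = n" "dim_col E = n" "dim_row F = m" "dim_col F = m"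
    "dim_row (mat_inv E) = n" "dim_col (mat_inv E) = n" "dim_row (mat_inv F) = m" "dim_col (mat_inv F) = m"
  using E_mat(1,2) F_mat(1,2) by auto

lemma z [simp]: "amat A z" "dim_row z = n" "dim_col z = m"
  using rel by (simp_all add: B_relation_def)

lemma w [simp]: "amat A w" "dim_row w = m" "dim_col w = n"
  by (simp_all add: B_inverse_def)

lemma w_z: "w \<boxtimes> z = smat A (1\<^sub>m m)"
  using rel by (simp add: B_relation_def B_inverse_def)

lemma z_w: "z \<boxtimes> w = smat A (1\<^sub>m n)"
  using rel by (simp add: B_relation_def B_inverse_def mmul_assoc)

text \<open>Stated with a trailing factor \<open>U\<close> because \<open>mmul_assoc\<close>
  brackets products to the right, so an adjacent inverse pair shows up only in this shape. The same
  holds for \<open>cancel_F\<close>.\<close>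

lemma cancel_E [simp]: "amat A U \<Longrightarrow> dim_row U = n \<Longrightarrow> smat A E \<boxtimes> (smat A (mat_inv E) \<boxtimes> U) = U"
    "amat A U \<Longrightarrow> dim_row U = n \<Longrightarrow> smat A (mat_inv E) \<boxtimes> (smat A E \<boxtimes> U) = U"
  by (simp_all add: smat_mult E_mat flip: mmul_assoc)

lemma cancel_F [simp]: "amat A U \<Longrightarrow> dim_row U = m \<Longrightarrow> smat A F \<boxtimes> (smat A (mat_inv F) \<boxtimes> U) = U"
    "amat A U \<Longrightarrow> dim_row U = m \<Longrightarrow> smat A (mat_inv F) \<boxtimes> (smat A F \<boxtimes> U) = U"
  by (simp_all add: smat_mult F_mat flip: mmul_assoc)

text \<open>The first relation cleared of the inverse of F; \<open>zFz\<close> is its counterpart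
  for the second one. In these forms z stands at both ends or transposed to itself, so a product of
  solutions collapses from the inside.\<close>

lemma zEz: "transpose_mat z \<boxtimes> (smat A E \<boxtimes> z) = smat A F"
proof -
  have "smat A F \<boxtimes> (w \<boxtimes> z) = smat A F" by (simp add: w_z)
  then show ?thesis by (simp add: B_inverse_def mmul_assoc)
qed

lemma zFz: "z \<boxtimes> (smat A (mat_inv F) \<boxtimes> transpose_mat z) = smat A (mat_inv E)"
proof -
  have "z \<boxtimes> w \<boxtimes> smat A (mat_inv E) = smat A (mat_inv E)" by (simp add: z_w)
  then show ?thesis by (simp add: B_inverse_def mmul_assoc smat_mult E_mat)
qed

text \<open>In the opposite algebra the relations of \<open>w\<close> are the transposes of \<open>w\<^sup>t F\<^sup>t w = E\<^sup>t\<close>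
  and \<open>w E\<^sup>-\<^sup>t w\<^sup>t = F\<^sup>-\<^sup>t\<close>, which hold since \<open>w\<^sup>t F\<^sup>t = E\<^sup>t z\<close>.\<close>

lemma B_relation_op: "B_relation (op_alg A) F E w"
proof -
  have wT: "transpose_mat w = smat A (transpose_mat E) \<boxtimes> (z \<boxtimes> smat A (transpose_mat (mat_inv F)))"
    by (simp add: B_inverse_def mmul_assoc transpose_smat_mmul transpose_mmul_smat)
  have F1: "smat A (transpose_mat (mat_inv F)) \<boxtimes> smat A (transpose_mat F) = smat A (1\<^sub>m m)"
    and F2: "smat A (transpose_mat F) \<boxtimes> smat A (transpose_mat (mat_inv F)) = smat A (1\<^sub>m m)"
    and E1: "smat A (transpose_mat (mat_inv E)) \<boxtimes> smat A (transpose_mat E) = smat A (1\<^sub>m n)"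
    and E2: "smat A (transpose_mat E) \<boxtimes> smat A (transpose_mat (mat_inv E)) = smat A (1\<^sub>m n)"
    using E_mat F_mat by (simp_all add: smat_mult flip: transpose_mult)
  have "transpose_mat w \<boxtimes> (smat A (transpose_mat F) \<boxtimes> (w \<boxtimes> smat A (transpose_mat (mat_inv E)))) =
      smat A (transpose_mat E) \<boxtimes> (z \<boxtimes> (smat A (transpose_mat (mat_inv F)) \<boxtimes> smat A (transpose_mat F))
        \<boxtimes> w \<boxtimes> smat A (transpose_mat (mat_inv E)))"
    by (simp add: wT mmul_assoc)
  also have "\<dots> = smat A (1\<^sub>m n)"
    by (simp add: F1 z_w E2)
  finally have 1: "transpose_mat w \<boxtimes> (smat A (transpose_mat F) \<boxtimes> (w \<boxtimes> smat A (transpose_mat (mat_inv E)))) =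
      smat A (1\<^sub>m n)" .
  have "smat A (transpose_mat F) \<boxtimes> (w \<boxtimes> (smat A (transpose_mat (mat_inv E)) \<boxtimes> transpose_mat w)) =
      smat A (transpose_mat F) \<boxtimes> (w \<boxtimes> (smat A (transpose_mat (mat_inv E)) \<boxtimes> smat A (transpose_mat E)) \<boxtimes> z
        \<boxtimes> smat A (transpose_mat (mat_inv F)))"
    by (simp add: wT mmul_assoc)
  also have "\<dots> = smat A (1\<^sub>m m)"
    by (simp add: E1 w_z F2)
  finally have 2: "smat A (transpose_mat F) \<boxtimes> (w \<boxtimes> (smat A (transpose_mat (mat_inv E)) \<boxtimes> transpose_mat w)) =
      smat A (1\<^sub>m m)" .
  show ?thesis
    by (simp add: B_relation_def op_alg_mmul transpose_smat 1 2)
qed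

lemma B_relation_map:
  assumes "kalg B" "f \<in> kalg_hom A B"
  shows "B_relation B E F (map_mat f z)"
proof -
  note map = map_mmul[OF kalg_axioms assms] map_smat[OF kalg_axioms assms]
  have "map_mat f (smat A (mat_inv F) \<boxtimes> transpose_mat z \<boxtimes> smat A E \<boxtimes> z) = map_mat f (smat A (1\<^sub>m m))"
    "map_mat f (z \<boxtimes> smat A (mat_inv F) \<boxtimes> transpose_mat z \<boxtimes> smat A E) = map_mat f (smat A (1\<^sub>m n))"
    using rel by (simp_all add: B_relation_def)
  then show ?thesis
    using amat_map[OF kalg_axioms assms z(1)]
    by (simp add: B_relation_def map map_transpose)
qed

end

text \<open>Solutions compose: the entries commute, so the transpose of the product reverses, and
  the inner factors collapse by \<alpha>^t E \<alpha> = G and \<zeta> F^{-1} \<zeta>^t = G^{-1}. The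
  coaction is the case G = E; the map \<open>kappa\<close> has F in the middle and E at both
  ends.\<close>

lemma B_relation_mult:
  assumes "B_solution A E G \<alpha> n p" "B_solution A G F \<zeta> p m"
    and "\<And>i j k l. i < n \<Longrightarrow> j < p \<Longrightarrow> k < p \<Longrightarrow> l < m \<Longrightarrow>
      \<alpha> $$ (i, j) \<otimes>\<^bsub>A\<^esub> \<zeta> $$ (k, l) = \<zeta> $$ (k, l) \<otimes>\<^bsub>A\<^esub> \<alpha> $$ (i, j)"
  shows "B_relation A E F (\<alpha> \<boxtimes>\<^bsub>A\<^esub> \<zeta>)"
proof -
  interpret a: B_solution A E G \<alpha> n p by fact
  interpret z: B_solution A G F \<zeta> p m by fact
  have t: "transpose_mat (\<alpha> \<boxtimes>\<^bsub>A\<^esub> \<zeta>) = transpose_mat \<zeta> \<boxtimes>\<^bsub>A\<^esub> transpose_mat \<alpha>"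
    by (rule a.transpose_mmul) (use assms(3) in auto)
  have 1: "transpose_mat \<alpha> \<boxtimes>\<^bsub>A\<^esub> (smat A E \<boxtimes>\<^bsub>A\<^esub> (\<alpha> \<boxtimes>\<^bsub>A\<^esub> \<zeta>)) = smat A G \<boxtimes>\<^bsub>A\<^esub> \<zeta>"
    by (simp flip: a.zEz add: a.mmul_assoc)
  have "\<zeta> \<boxtimes>\<^bsub>A\<^esub> (smat A (mat_inv F) \<boxtimes>\<^bsub>A\<^esub> (transpose_mat \<zeta> \<boxtimes>\<^bsub>A\<^esub> U)) = smat A (mat_inv G) \<boxtimes>\<^bsub>A\<^esub> U"
    if "amat A U" "dim_row U = p" for U
    using that by (simp flip: z.zFz add: a.mmul_assoc)
  then have 2: "\<zeta> \<boxtimes>\<^bsub>A\<^esub> (smat A (mat_inv F) \<boxtimes>\<^bsub>A\<^esub> (transpose_mat \<zeta> \<boxtimes>\<^bsub>A\<^esub> (transpose_mat \<alpha> \<boxtimes>\<^bsub>A\<^esub> smat A E))) =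
      smat A (mat_inv G) \<boxtimes>\<^bsub>A\<^esub> (transpose_mat \<alpha> \<boxtimes>\<^bsub>A\<^esub> smat A E)"
    by simp
  show ?thesis
    using z.w_z a.z_w
    by (simp add: B_relation_def t a.mmul_assoc 1 2 B_inverse_def z.zEz a.smat_mult z.F_mat)
qed

context kalg
begin

lemma smat_mmul_index:
  assumes "amat A U" "dim_col S = dim_row U" "i < dim_row S" "j < dim_col U"
  shows "(smat A S \<boxtimes> U) $$ (i, j) = (\<Oplus>l\<in>{..<dim_row U}. S $$ (i, l) \<odot> U $$ (l, j))"
  using assms(2-) amatD[OF assms(1)]
  by (auto simp: mmul_index smat_index smult_mult_left intro!: finsum_cong')

lemma mmul_smat_index:
  assumes "amat A U" "dim_col U = dim_row S" "i < dim_row U" "j < dim_col S"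
  shows "(U \<boxtimes> smat A S) $$ (i, j) = (\<Oplus>l\<in>{..<dim_row S}. S $$ (l, j) \<odot> U $$ (i, l))"
  using assms(2-) amatD[OF assms(1)]
  by (auto simp: mmul_index smat_index smult_mult_right intro!: finsum_cong')

end

section \<open>The algebras \<open>\<B>(E, F)\<close>\<close>

abbreviation list_monoid :: "'x set \<Rightarrow> 'x list monoid" where
  "list_monoid V \<equiv> \<lparr>carrier = lists V, monoid.mult = (@), one = []\<rparr>"

lemma monoid_list_monoid: "Group.monoid (list_monoid V)"
  by (rule monoidI) auto

lemma kalg_free_algebra: "kalg (free_algebra V)"
  unfolding free_algebra_def by (rule kalg_monoid_algebra[OF monoid_list_monoid])

text \<open>The fold from \<open>B_coaction\<close> with arbitrary images of the letters, so that
  the coaction becomes one instance of the universal property.\<close>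

definition word_prod :: "('k, 'a) module \<Rightarrow> (nat \<Rightarrow> nat \<Rightarrow> 'a) \<Rightarrow> (nat \<times> nat) list \<Rightarrow> 'a" where
  "word_prod A d w = foldr (\<lambda>(i, j) t. d i j \<otimes>\<^bsub>A\<^esub> t) w \<one>\<^bsub>A\<^esub>"

lemma word_prod_simps [simp]:
  "word_prod A d [] = \<one>\<^bsub>A\<^esub>" "word_prod A d ((i, j) # w) = d i j \<otimes>\<^bsub>A\<^esub> word_prod A d w"
  by (simp_all add: word_prod_def)

lemma keys_sum_subset: "(\<And>i. i \<in> I \<Longrightarrow> Poly_Mapping.keys (g i) \<subseteq> S) \<Longrightarrow> Poly_Mapping.keys (sum g I) \<subseteq> S"
  by (induction I rule: infinite_finite_induct) auto

lemma linear_maps_sum: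
  assumes "kmod M" "f \<in> linear_maps (monoid_algebra G) M" "\<And>i. i \<in> S \<Longrightarrow> Poly_Mapping.keys (g i) \<subseteq> carrier G"
  shows "f (\<Sum>i\<in>S. g i) = (\<Oplus>\<^bsub>M\<^esub>i\<in>S. f (g i))"
proof -
  interpret kmod M by fact
  note f0 = linear_maps_zero[OF kmod_monoid_algebra assms(1,2), simplified]
  note fadd = linear_maps_add[OF assms(2), simplified] and fc = linear_maps_closed[OF assms(2), simplified]
  from assms(3) show ?thesis
  proof (induction S rule: infinite_finite_induct)
    case (insert i I)
    then have "Poly_Mapping.keys (sum g I) \<subseteq> carrier G" by (intro keys_sum_subset) auto
    with insert have "f (\<Sum>i\<in>insert i I. g i) = f (g i) \<oplus>\<^bsub>M\<^esub> (\<Oplus>\<^bsub>M\<^esub>i\<in>I. f (g i))"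
      by (simp add: fadd)
    also have "\<dots> = (\<Oplus>\<^bsub>M\<^esub>i\<in>insert i I. f (g i))"
      using insert fc by (intro finsum_insert[symmetric]) auto
    finally show ?case .
  qed (simp_all add: f0)
qed

locale B_data =
  fixes E F :: "'k::comm_ring_1 mat" and n m
  assumes E: "E \<in> GL n" and F: "F \<in> GL m"
begin

lemmas E_mat = GL_carrier[OF E] mat_inv_carrier[OF E] mat_inv_right[OF E] mat_inv_left[OF E]
lemmas F_mat = GL_carrier[OF F] mat_inv_carrier[OF F] mat_inv_right[OF F] mat_inv_left[OF F]

lemma dims [simp]: "dim_row E = n" "dim_col E = n" "dim_row F = m" "dim_col F = m"
    "dim_row (mat_inv E) = n" "dim_col (mat_inv E) = n" "dim_row (mat_inv F) = m" "dim_col (mat_inv F) = m"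
  using E_mat(1,2) F_mat(1,2) by auto

abbreviation "V \<equiv> {..<n} \<times> {..<m}"
abbreviation "FA \<equiv> free_algebra V :: ('k, (nat \<times> nat) list \<Rightarrow>\<^sub>0 'k) module"
abbreviation "rel1 i j \<equiv> (\<Sum>p<m. \<Sum>q<n. \<Sum>r<n. Poly_Mapping.single [(q, p), (r, j)] (mat_inv F $$ (i, p) * E $$ (q, r)))
        - Poly_Mapping.single [] (1\<^sub>m m $$ (i, j))"
abbreviation "rel2 i j \<equiv> (\<Sum>p<m. \<Sum>q<m. \<Sum>r<n. Poly_Mapping.single [(i, p), (r, q)] (mat_inv F $$ (p, q) * E $$ (r, j)))
        - Poly_Mapping.single [] (1\<^sub>m n $$ (i, j))"

lemma B_relators_eq: "B_relators E F = {rel1 i j | i j. i < m \<and> j < m} \<union> {rel2 i j | i j. i < n \<and> j < n}"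
  unfolding B_relators_def dims Let_def ..

lemma rel_in_relators:
  "i < m \<Longrightarrow> j < m \<Longrightarrow> rel1 i j \<in> B_relators E F"
  "i < n \<Longrightarrow> j < n \<Longrightarrow> rel2 i j \<in> B_relators E F"
  unfolding B_relators_eq by blast+

lemma keys_rel:
  "i < m \<Longrightarrow> j < m \<Longrightarrow> Poly_Mapping.keys (rel1 i j) \<subseteq> lists V"
  "i < n \<Longrightarrow> j < n \<Longrightarrow> Poly_Mapping.keys (rel2 i j) \<subseteq> lists V"
  by (rule keys_minus_subset; (intro keys_sum_subset keys_single_subset)?; simp)+

lemma carrier_FA: "carrier FA = {p. Poly_Mapping.keys p \<subseteq> lists V}"
  by (simp add: free_algebra_def)

sublocale FA: kalg FA by (rule kalg_free_algebra)

lemma B_relators_subset: "B_relators E F \<subseteq> carrier FA"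
proof
  fix p assume "p \<in> B_relators E F"
  then consider i j where "p = rel1 i j" "i < m" "j < m" | i j where "p = rel2 i j" "i < n" "j < n"
    by (auto simp: B_relators_eq)
  then show "p \<in> carrier FA"
    unfolding carrier_FA mem_Collect_eq by cases (simp_all only: keys_rel)
qed

sublocale I: kideal "B_ideal E F" FA
proof -
  have "ideal (B_ideal E F) FA"
    unfolding B_ideal_def dims
    by (rule FA.genideal_ideal[OF B_relators_subset])
  then show "kideal (B_ideal E F) FA"
    using FA.kalg_axioms by (simp add: kideal_def)
qed

lemma B_alg_eq: "B_alg E F = quotient_module FA (B_ideal E F)"
  by (simp add: B_alg_def)

sublocale B: kalg "B_alg E F"
  unfolding B_alg_eq by (rule I.kalg_quotient)

abbreviation "cl p \<equiv> B_ideal E F +>\<^bsub>FA\<^esub> p"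

lemma cl_hom: "cl \<in> kalg_hom FA (B_alg E F)"
  unfolding B_alg_eq by (rule I.coset_kalg_hom)

lemma B_gen_eq: "B_gen E F i j = cl (Poly_Mapping.single [(i, j)] 1)"
  by (simp add: B_gen_def)

lemma B_gen_closed [simp]: "i < n \<Longrightarrow> j < m \<Longrightarrow> B_gen E F i j \<in> carrier (B_alg E F)"
  unfolding B_gen_eq by (rule linear_maps_closed[OF kalg_hom_linear[OF cl_hom]]) (auto simp: carrier_FA)

text \<open>Words grow by one letter on the left, so left multiplication by a generator replaces a
  general product case. Zero is covered as the scalar multiple of the unit by 0.\<close>

lemma B_induct [consumes 1, case_names one gen smult add]:
  assumes "x \<in> carrier (B_alg E F)"
    and one: "P \<one>\<^bsub>B_alg E F\<^esub>"
    and gen: "\<And>i j x. i < n \<Longrightarrow> j < m \<Longrightarrow> x \<in> carrier (B_alg E F) \<Longrightarrow> P x \<Longrightarrow> P (B_gen E F i j \<otimes>\<^bsub>B_alg E F\<^esub> x)"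
    and smult: "\<And>c x. x \<in> carrier (B_alg E F) \<Longrightarrow> P x \<Longrightarrow> P (c \<odot>\<^bsub>B_alg E F\<^esub> x)"
    and add: "\<And>x y. x \<in> carrier (B_alg E F) \<Longrightarrow> y \<in> carrier (B_alg E F) \<Longrightarrow> P x \<Longrightarrow> P y \<Longrightarrow> P (x \<oplus>\<^bsub>B_alg E F\<^esub> y)"
  shows "P x"
proof -
  note lin = kalg_hom_linear[OF cl_hom]
  have FA_simps: "add FA = (+)" "\<zero>\<^bsub>FA\<^esub> = 0" "\<one>\<^bsub>FA\<^esub> = Poly_Mapping.single [] 1"
    "c \<odot>\<^bsub>FA\<^esub> p = Poly_Mapping.map ((*) c) p"
    "Poly_Mapping.single u a \<otimes>\<^bsub>FA\<^esub> Poly_Mapping.single v b = Poly_Mapping.single (u @ v) (a * b)" for c p u v a b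
    by (simp_all add: free_algebra_def)
  have cl_closed: "cl p \<in> carrier (B_alg E F)" if "Poly_Mapping.keys p \<subseteq> lists V" for p
    by (rule linear_maps_closed[OF lin]) (use that in \<open>simp add: carrier_FA\<close>)
  have word: "P (cl (Poly_Mapping.single w 1))" if "w \<in> lists V" for w
    using that
  proof (induction w)
    case Nil
    then show ?case using one kalg_hom_one[OF cl_hom] by (simp add: FA_simps)
  next
    case (Cons a w)
    obtain i j where a: "a = (i, j)" by force
    have "cl (Poly_Mapping.single (a # w) 1) = B_gen E F i j \<otimes>\<^bsub>B_alg E F\<^esub> cl (Poly_Mapping.single w 1)"
      using kalg_hom_mult[OF cl_hom, of "Poly_Mapping.single [a] 1" "Poly_Mapping.single w 1"] Cons
      by (simp add: FA_simps carrier_FA a B_gen_eq)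
    then show ?case using gen[of i j] Cons a cl_closed by auto
  qed
  obtain p where p: "x = cl p" "Poly_Mapping.keys p \<subseteq> lists V"
    using assms(1) by (auto simp: B_alg_eq carrier_quotient_module carrier_FA)
  from p(2) have "P (cl p)"
  proof (induction p rule: keys_induct)
    case zero
    have "cl 0 = 0 \<odot>\<^bsub>B_alg E F\<^esub> \<one>\<^bsub>B_alg E F\<^esub>"
      using linear_maps_zero[OF FA.kmod_axioms B.kmod_axioms lin] by (simp add: FA_simps)
    then show ?case using smult[OF _ one, of 0] by simp
  next
    case (single w c)
    then show ?case
      using smult[OF _ word[OF single], of c] linear_maps_smult[OF lin, of "Poly_Mapping.single w 1" c]
        cl_closed[of "Poly_Mapping.single w 1"]
      by (simp add: FA_simps carrier_FA map_times_single)
  next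
    case (add p q)
    then show ?case
      using assms(5)[of "cl p" "cl q"] linear_maps_add[OF lin, of p q] cl_closed by (simp add: FA_simps carrier_FA)
  qed
  with p show ?thesis by simp
qed

lemma B_hom_eqI:
  assumes "f \<in> kalg_hom (B_alg E F) A" "g \<in> kalg_hom (B_alg E F) A"
    and "\<And>i j. i < n \<Longrightarrow> j < m \<Longrightarrow> f (B_gen E F i j) = g (B_gen E F i j)"
    and "x \<in> carrier (B_alg E F)"
  shows "f x = g x"
  using assms(4)
  by (induction rule: B_induct)
    (simp_all add: assms(3) kalg_hom_one[OF assms(1)] kalg_hom_one[OF assms(2)] kalg_hom_mult[OF assms(1)]
      kalg_hom_mult[OF assms(2)] linear_maps_smult[OF kalg_hom_linear[OF assms(1)]]
      linear_maps_smult[OF kalg_hom_linear[OF assms(2)]] linear_maps_add[OF kalg_hom_linear[OF assms(1)]]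
      linear_maps_add[OF kalg_hom_linear[OF assms(2)]])

section \<open>Evaluation of words and the universal property of \<open>B_alg E F\<close>\<close>

context
  fixes A :: "('k, 'a) module" and d :: "nat \<Rightarrow> nat \<Rightarrow> 'a"
  assumes A: "kalg A" and d: "\<And>i j. i < n \<Longrightarrow> j < m \<Longrightarrow> d i j \<in> carrier A"
begin

interpretation A: kalg A by (rule A)

abbreviation (input) "ev \<equiv> linear_extension A (word_prod A d)"
abbreviation (input) "dm \<equiv> mat n m (\<lambda>(i, j). d i j)"

lemma word_prod_closed: "w \<in> lists V \<Longrightarrow> word_prod A d w \<in> carrier A"
  by (induction w) (auto simp: d)

lemma word_prod_append:
  "v \<in> lists V \<Longrightarrow> w \<in> lists V \<Longrightarrow> word_prod A d (v @ w) = word_prod A d v \<otimes>\<^bsub>A\<^esub> word_prod A d w"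
proof (induction v)
  case (Cons a v)
  then show ?case
    using word_prod_closed[of v] word_prod_closed[of w] by (auto simp: d A.m_assoc)
qed (simp add: word_prod_closed)

lemma ev_hom: "ev \<in> kalg_hom FA A"
  unfolding free_algebra_def
  by (rule linear_extension_kalg_hom[OF monoid_list_monoid A]) (auto simp: word_prod_closed word_prod_append)

lemma ev_single: "w \<in> lists V \<Longrightarrow> ev (Poly_Mapping.single w c) = c \<odot>\<^bsub>A\<^esub> word_prod A d w"
  by (simp add: word_prod_closed)

text \<open>Translates between the two forms of the relations: the relators are triple sums of words
  of length two minus constants, whereas \<open>B_relation\<close> consists of matrix products. It
  serves both for maps out of the algebra and for showing that its own generators satisfy the
  relations.\<close>

lemma ev_relators:
  "i < m \<Longrightarrow> j < m \<Longrightarrow> ev (rel1 i j) =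
     (smat A (mat_inv F) \<boxtimes>\<^bsub>A\<^esub> transpose_mat dm \<boxtimes>\<^bsub>A\<^esub> smat A E \<boxtimes>\<^bsub>A\<^esub> dm) $$ (i, j) \<ominus>\<^bsub>A\<^esub> smat A (1\<^sub>m m) $$ (i, j)"
  "i < n \<Longrightarrow> j < n \<Longrightarrow> ev (rel2 i j) =
     (dm \<boxtimes>\<^bsub>A\<^esub> smat A (mat_inv F) \<boxtimes>\<^bsub>A\<^esub> transpose_mat dm \<boxtimes>\<^bsub>A\<^esub> smat A E) $$ (i, j) \<ominus>\<^bsub>A\<^esub> smat A (1\<^sub>m n) $$ (i, j)"
proof -
  have lin: "ev \<in> linear_maps (monoid_algebra (list_monoid V)) A"
    using kalg_hom_linear[OF ev_hom] by (simp add: free_algebra_def)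
  have ev_sum: "ev (sum g I) = (\<Oplus>\<^bsub>A\<^esub>i\<in>I. ev (g i))"
    if "\<And>i. i \<in> I \<Longrightarrow> Poly_Mapping.keys (g i) \<subseteq> lists V" for I :: "nat set" and g
    by (rule linear_maps_sum[OF A.kmod_axioms lin]) (use that in simp)
  have ev_minus: "ev (p - q) = ev p \<ominus>\<^bsub>A\<^esub> ev q" if "Poly_Mapping.keys p \<subseteq> lists V" "Poly_Mapping.keys q \<subseteq> lists V" for p q
    using linear_maps_minus[OF kmod_monoid_algebra A.kmod_axioms lin, of p q] that
    by (simp add: monoid_algebra_minus)
  \<comment> \<open>Additivity of \<open>ev\<close> is available only for polynomials supported on
    words over \<open>V\<close>, so each level of the triple sum carries its own support
    obligation.\<close>
  have ev_sum3: "ev (\<Sum>p\<in>P. \<Sum>q\<in>Q. \<Sum>r\<in>R. Poly_Mapping.single (u p q r) (c p q r)) =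
      (\<Oplus>\<^bsub>A\<^esub>p\<in>P. \<Oplus>\<^bsub>A\<^esub>q\<in>Q. \<Oplus>\<^bsub>A\<^esub>r\<in>R. c p q r \<odot>\<^bsub>A\<^esub> word_prod A d (u p q r))"
    if "\<And>p q r. p \<in> P \<Longrightarrow> q \<in> Q \<Longrightarrow> r \<in> R \<Longrightarrow> u p q r \<in> lists V"
    for P Q R :: "nat set" and u and c :: "nat \<Rightarrow> nat \<Rightarrow> nat \<Rightarrow> 'k"
  proof -
    note keys = keys_single_subset[OF that] and closed = word_prod_closed[OF that]
    have 1: "ev (\<Sum>r\<in>R. Poly_Mapping.single (u p q r) (c p q r)) = (\<Oplus>\<^bsub>A\<^esub>r\<in>R. c p q r \<odot>\<^bsub>A\<^esub> word_prod A d (u p q r))"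
      if pq: "p \<in> P" "q \<in> Q" for p q
    proof (subst ev_sum)
      show "Poly_Mapping.keys (Poly_Mapping.single (u p q r) (c p q r)) \<subseteq> lists V" if "r \<in> R" for r
        by (rule keys[OF pq that])
      show "(\<Oplus>\<^bsub>A\<^esub>r\<in>R. ev (Poly_Mapping.single (u p q r) (c p q r))) =
          (\<Oplus>\<^bsub>A\<^esub>r\<in>R. c p q r \<odot>\<^bsub>A\<^esub> word_prod A d (u p q r))"
        by (rule A.finsum_cong') (use closed pq in auto)
    qed
    have 2: "ev (\<Sum>q\<in>Q. \<Sum>r\<in>R. Poly_Mapping.single (u p q r) (c p q r)) =
      (\<Oplus>\<^bsub>A\<^esub>q\<in>Q. \<Oplus>\<^bsub>A\<^esub>r\<in>R. c p q r \<odot>\<^bsub>A\<^esub> word_prod A d (u p q r))" if p: "p \<in> P" for p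
    proof (subst ev_sum)
      show "Poly_Mapping.keys (\<Sum>r\<in>R. Poly_Mapping.single (u p q r) (c p q r)) \<subseteq> lists V" if "q \<in> Q" for q
        by (rule keys_sum_subset, rule keys[OF p that])
      show "(\<Oplus>\<^bsub>A\<^esub>q\<in>Q. ev (\<Sum>r\<in>R. Poly_Mapping.single (u p q r) (c p q r))) =
          (\<Oplus>\<^bsub>A\<^esub>q\<in>Q. \<Oplus>\<^bsub>A\<^esub>r\<in>R. c p q r \<odot>\<^bsub>A\<^esub> word_prod A d (u p q r))"
        by (rule A.finsum_cong') (use closed p in \<open>auto simp: 1 intro!: A.finsum_closed\<close>)
    qed
    show ?thesis
    proof (subst ev_sum)
      show "Poly_Mapping.keys (\<Sum>q\<in>Q. \<Sum>r\<in>R. Poly_Mapping.single (u p q r) (c p q r)) \<subseteq> lists V" if "p \<in> P" for p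
        by (rule keys_sum_subset, rule keys_sum_subset, rule keys[OF that])
      show "(\<Oplus>\<^bsub>A\<^esub>p\<in>P. ev (\<Sum>q\<in>Q. \<Sum>r\<in>R. Poly_Mapping.single (u p q r) (c p q r))) =
          (\<Oplus>\<^bsub>A\<^esub>p\<in>P. \<Oplus>\<^bsub>A\<^esub>q\<in>Q. \<Oplus>\<^bsub>A\<^esub>r\<in>R. c p q r \<odot>\<^bsub>A\<^esub> word_prod A d (u p q r))"
        by (rule A.finsum_cong') (use closed in \<open>auto simp: 2 intro!: A.finsum_closed\<close>)
    qed
  qed
  have cong: "a = b \<Longrightarrow> c \<odot>\<^bsub>A\<^esub> a = c \<odot>\<^bsub>A\<^esub> b" "x = y \<Longrightarrow> a = b \<Longrightarrow> x \<otimes>\<^bsub>A\<^esub> a = y \<otimes>\<^bsub>A\<^esub> b" for a b c x y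
    by simp_all
  have dm: "amat A dm" using d by (auto simp: amat_def)
  {
    assume ij: "i < m" "j < m"
    have "ev (\<Sum>p<m. \<Sum>q<n. \<Sum>r<n. Poly_Mapping.single [(q, p), (r, j)] (mat_inv F $$ (i, p) * E $$ (q, r)))
        = (\<Oplus>\<^bsub>A\<^esub>p\<in>{..<m}. \<Oplus>\<^bsub>A\<^esub>q\<in>{..<n}. \<Oplus>\<^bsub>A\<^esub>r\<in>{..<n}. (mat_inv F $$ (i, p) * E $$ (q, r)) \<odot>\<^bsub>A\<^esub> (d q p \<otimes>\<^bsub>A\<^esub> d r j))"
      using ij d by (subst ev_sum3) (auto intro!: A.finsum_cong' A.finsum_closed)
    \<comment> \<open>Pulling scalars and left letters out of the inner sums nests them exactly as a
      matrix product bracketed to the right.\<close>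
    also have "\<dots> = (\<Oplus>\<^bsub>A\<^esub>p\<in>{..<m}. mat_inv F $$ (i, p) \<odot>\<^bsub>A\<^esub> (\<Oplus>\<^bsub>A\<^esub>q\<in>{..<n}. d q p \<otimes>\<^bsub>A\<^esub> (\<Oplus>\<^bsub>A\<^esub>r\<in>{..<n}. E $$ (q, r) \<odot>\<^bsub>A\<^esub> d r j)))"
      using ij d
      by (auto simp: A.smult_finsum A.finsum_rdistr A.smult_assoc A.smult_mult_right Pi_def
          intro!: A.finsum_cong' A.finsum_closed)
    also have "\<dots> = (smat A (mat_inv F) \<boxtimes>\<^bsub>A\<^esub> (transpose_mat dm \<boxtimes>\<^bsub>A\<^esub> (smat A E \<boxtimes>\<^bsub>A\<^esub> dm))) $$ (i, j)"
      using ij d dm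
      by (auto simp: A.smat_mmul_index mmul_index[of _ "transpose_mat dm"] intro!: cong A.finsum_cong' A.finsum_closed)
    finally show "ev (rel1 i j) =
     (smat A (mat_inv F) \<boxtimes>\<^bsub>A\<^esub> transpose_mat dm \<boxtimes>\<^bsub>A\<^esub> smat A E \<boxtimes>\<^bsub>A\<^esub> dm) $$ (i, j) \<ominus>\<^bsub>A\<^esub> smat A (1\<^sub>m m) $$ (i, j)"
      using ij dm
      by (subst ev_minus) (auto simp: A.mmul_assoc smat_index ev_single intro!: keys_sum_subset keys_single_subset simp del: keys_single)
  next
    assume ij: "i < n" "j < n"
    have "ev (\<Sum>p<m. \<Sum>q<m. \<Sum>r<n. Poly_Mapping.single [(i, p), (r, q)] (mat_inv F $$ (p, q) * E $$ (r, j)))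
        = (\<Oplus>\<^bsub>A\<^esub>p\<in>{..<m}. \<Oplus>\<^bsub>A\<^esub>q\<in>{..<m}. \<Oplus>\<^bsub>A\<^esub>r\<in>{..<n}. (mat_inv F $$ (p, q) * E $$ (r, j)) \<odot>\<^bsub>A\<^esub> (d i p \<otimes>\<^bsub>A\<^esub> d r q))"
      using ij d by (subst ev_sum3) (auto intro!: A.finsum_cong' A.finsum_closed)
    also have "\<dots> = (\<Oplus>\<^bsub>A\<^esub>p\<in>{..<m}. d i p \<otimes>\<^bsub>A\<^esub> (\<Oplus>\<^bsub>A\<^esub>q\<in>{..<m}. mat_inv F $$ (p, q) \<odot>\<^bsub>A\<^esub> (\<Oplus>\<^bsub>A\<^esub>r\<in>{..<n}. E $$ (r, j) \<odot>\<^bsub>A\<^esub> d r q)))"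
      using ij d
      by (auto simp: A.smult_finsum A.finsum_rdistr A.smult_assoc A.smult_mult_right Pi_def
          intro!: A.finsum_cong' A.finsum_closed)
    also have "\<dots> = (dm \<boxtimes>\<^bsub>A\<^esub> (smat A (mat_inv F) \<boxtimes>\<^bsub>A\<^esub> (transpose_mat dm \<boxtimes>\<^bsub>A\<^esub> smat A E))) $$ (i, j)"
      using ij d dm
      by (auto simp: A.smat_mmul_index A.mmul_smat_index mmul_index[of _ dm] intro!: cong A.finsum_cong' A.finsum_closed)
    finally show "ev (rel2 i j) =
     (dm \<boxtimes>\<^bsub>A\<^esub> smat A (mat_inv F) \<boxtimes>\<^bsub>A\<^esub> transpose_mat dm \<boxtimes>\<^bsub>A\<^esub> smat A E) $$ (i, j) \<ominus>\<^bsub>A\<^esub> smat A (1\<^sub>m n) $$ (i, j)"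
      using ij dm
      by (subst ev_minus) (auto simp: A.mmul_assoc smat_index ev_single intro!: keys_sum_subset keys_single_subset simp del: keys_single)
  }
qed

text \<open>The kernel of the evaluation is a two-sided ideal that contains the relators, hence the
  ideal they generate, and the evaluation descends to the quotient.\<close>

lemma
  assumes rel: "B_relation A E F dm"
  shows B_hom: "induced A (word_prod A d) \<in> kalg_hom (B_alg E F) A"
    and B_hom_gen: "i < n \<Longrightarrow> j < m \<Longrightarrow> induced A (word_prod A d) (B_gen E F i j) = d i j"
proof -
  note lin = kalg_hom_linear[OF ev_hom]
  note ev_closed = linear_maps_closed[OF lin] and ev_mult = kalg_hom_mult[OF ev_hom]
  let ?K = "{p \<in> carrier FA. ev p = \<zero>\<^bsub>A\<^esub>}"
  have "submodule ?K ring_of_type_algebra FA"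
    by (rule FA.submodule_if_closed) (auto simp: linear_maps_zero[OF FA.kmod_axioms A.kmod_axioms lin]
        linear_maps_add[OF lin] linear_maps_smult[OF lin])
  then have "subgroup ?K (add_monoid FA)" by (rule submodule.axioms)
  then have "ideal ?K FA"
    by (rule idealI[OF FA.ring_axioms]) (auto simp: ev_mult ev_closed)
  moreover have "B_relators E F \<subseteq> ?K"
  proof
    have minus: "a \<ominus>\<^bsub>A\<^esub> a = \<zero>\<^bsub>A\<^esub>" if "a \<in> carrier A" for a using that by (simp add: a_minus_def A.r_neg)
    fix p assume "p \<in> B_relators E F"
    then consider i j where "p = rel1 i j" "i < m" "j < m" | i j where "p = rel2 i j" "i < n" "j < n"
      by (auto simp: B_relators_eq)
    then show "p \<in> ?K"
    proof cases
      case 1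
      then show ?thesis
        using rel keys_rel(1)[of i j] ev_relators(1)[of i j] by (simp add: B_relation_def carrier_FA smat_index minus)
    next
      case 2
      then show ?thesis
        using rel keys_rel(2)[of i j] ev_relators(2)[of i j] by (simp add: B_relation_def carrier_FA smat_index minus)
    qed
  qed
  ultimately have "B_ideal E F \<subseteq> ?K"
    unfolding B_ideal_def dims by (rule FA.genideal_minimal)
  then have kill: "ev p = \<zero>\<^bsub>A\<^esub>" if "p \<in> B_ideal E F" for p using that by auto
  show "induced A (word_prod A d) \<in> kalg_hom (B_alg E F) A"
    using I.the_elem_kalg_hom[OF A ev_hom kill] unfolding induced_def B_alg_eq by simp
  assume "i < n" "j < m"
  then show "induced A (word_prod A d) (B_gen E F i j) = d i j"
    using I.the_elem_coset[OF A.kmod_axioms lin kill, of "Poly_Mapping.single [(i, j)] 1"] d[of i j]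
    by (simp add: induced_def B_gen_eq carrier_FA)
qed

end

section \<open>The generating matrix as universal solution\<close>

definition "Z \<equiv> mat n m (\<lambda>(i, j). B_gen E F i j)"

lemma Z_index [simp]: "i < n \<Longrightarrow> j < m \<Longrightarrow> Z $$ (i, j) = B_gen E F i j" "dim_row Z = n" "dim_col Z = m"
  by (simp_all add: Z_def)

text \<open>Evaluation at the classes of the letters is the quotient map itself, since the two agree
  on words. It therefore sends relators to zero, and \<open>ev_relators\<close> reads this as the
  matrix relations.\<close>

lemma B_relation_Z: "B_relation (B_alg E F) E F Z"
proof -
  let ?ev = "linear_extension (B_alg E F) (word_prod (B_alg E F) (B_gen E F))"
  have ev: "?ev \<in> kalg_hom FA (B_alg E F)"
    by (rule ev_hom[OF B.kalg_axioms B_gen_closed])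
  have cl: "cl p = ?ev p" if "Poly_Mapping.keys p \<subseteq> lists V" for p
  proof (rule linear_maps_monoid_algebra_eqI[OF B.kmod_axioms, of _ "list_monoid V"])
    fix w assume "w \<in> carrier (list_monoid V)"
    then have w: "w \<in> lists V" by simp
    then have "cl (Poly_Mapping.single w 1) = word_prod (B_alg E F) (B_gen E F) w"
    proof (induction w)
      case Nil
      then show ?case using kalg_hom_one[OF cl_hom] by (simp add: free_algebra_def)
    next
      case (Cons a w)
      obtain i j where a: "a = (i, j)" by force
      have "Poly_Mapping.single (a # w) 1 = Poly_Mapping.single [a] 1 \<otimes>\<^bsub>FA\<^esub> (Poly_Mapping.single w 1 :: _ \<Rightarrow>\<^sub>0 'k)"
        by (simp add: free_algebra_def)
      with Cons a show ?case
        using kalg_hom_mult[OF cl_hom, of "Poly_Mapping.single [a] 1" "Poly_Mapping.single w 1"]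
        by (simp add: carrier_FA a B_gen_eq)
    qed
    then show "cl (Poly_Mapping.single w 1) = ?ev (Poly_Mapping.single w 1)"
      using w word_prod_closed[OF B.kalg_axioms B_gen_closed] by (simp add: ev_single[OF B.kalg_axioms B_gen_closed])
  qed (use that kalg_hom_linear[OF cl_hom] kalg_hom_linear[OF ev] in \<open>simp_all add: free_algebra_def\<close>)
  have zero: "?ev p = \<zero>\<^bsub>B_alg E F\<^esub>" if "p \<in> B_relators E F" for p
  proof -
    note sub = B_relators_subset
    have "p \<in> B_ideal E F" using FA.genideal_self[OF sub] that by (auto simp: B_ideal_def)
    then have "cl p = B_ideal E F" by (rule I.a_rcos_const)
    then show ?thesis
      using sub that cl[of p] by (auto simp: B_alg_eq quotient_module_simps carrier_FA)
  qed
  have am: "amat (B_alg E F) Z" by (auto simp: amat_def)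
  have eq: "a = b" if "a \<ominus>\<^bsub>B_alg E F\<^esub> b = \<zero>\<^bsub>B_alg E F\<^esub>" "a \<in> carrier (B_alg E F)" "b \<in> carrier (B_alg E F)" for a b
    using that B.minus_unique B.r_right_minus_eq by blast
  let ?A = "B_alg E F"
  have "smat ?A (mat_inv F) \<boxtimes>\<^bsub>?A\<^esub> transpose_mat Z \<boxtimes>\<^bsub>?A\<^esub> smat ?A E \<boxtimes>\<^bsub>?A\<^esub> Z = smat ?A (1\<^sub>m m)" (is "?L = _")
  proof (rule eq_matI)
    fix i j assume "i < dim_row (smat ?A (1\<^sub>m m :: 'k mat))" "j < dim_col (smat ?A (1\<^sub>m m :: 'k mat))"
    then have ij: "i < m" "j < m" by auto
    then have "?ev (rel1 i j) = \<zero>\<^bsub>?A\<^esub>" by (intro zero rel_in_relators)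
    then have "?L $$ (i, j) \<ominus>\<^bsub>?A\<^esub> smat ?A (1\<^sub>m m) $$ (i, j) = \<zero>\<^bsub>?A\<^esub>"
      using ev_relators(1)[OF B.kalg_axioms B_gen_closed ij] by (simp add: Z_def)
    then show "?L $$ (i, j) = smat ?A (1\<^sub>m m) $$ (i, j)"
      by (rule eq) (use ij am in \<open>auto intro!: amatD\<close>)
  qed auto
  moreover have "Z \<boxtimes>\<^bsub>?A\<^esub> smat ?A (mat_inv F) \<boxtimes>\<^bsub>?A\<^esub> transpose_mat Z \<boxtimes>\<^bsub>?A\<^esub> smat ?A E = smat ?A (1\<^sub>m n)" (is "?L = _")
  proof (rule eq_matI)
    fix i j assume "i < dim_row (smat ?A (1\<^sub>m n :: 'k mat))" "j < dim_col (smat ?A (1\<^sub>m n :: 'k mat))"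
    then have ij: "i < n" "j < n" by auto
    then have "?ev (rel2 i j) = \<zero>\<^bsub>?A\<^esub>" by (intro zero rel_in_relators)
    then have "?L $$ (i, j) \<ominus>\<^bsub>?A\<^esub> smat ?A (1\<^sub>m n) $$ (i, j) = \<zero>\<^bsub>?A\<^esub>"
      using ev_relators(2)[OF B.kalg_axioms B_gen_closed ij] by (simp add: Z_def)
    then show "?L $$ (i, j) = smat ?A (1\<^sub>m n) $$ (i, j)"
      by (rule eq) (use ij am in \<open>auto intro!: amatD\<close>)
  qed auto
  ultimately show ?thesis using am by (simp add: B_relation_def)
qed

sublocale Z: B_solution "B_alg E F" E F Z n m
  by unfold_locales (use E F B_relation_Z in auto)

end

section \<open>Composing solutions inside a tensor product\<close>

context kalg_pair
begin

lemma pure_tensor_one_right_hom: "(\<lambda>x. pure_tensor M N x \<one>\<^bsub>N\<^esub>) \<in> kalg_hom M (tensor M N)"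
  by (rule kalg_homI[OF pure_tensor_linear_left]) (auto simp: pure_tensor_mult tensor_one)

lemma pure_tensor_one_left_hom: "(\<lambda>y. pure_tensor M N \<one>\<^bsub>M\<^esub> y) \<in> kalg_hom N (tensor M N)"
  by (rule kalg_homI[OF pure_tensor_linear_right]) (auto simp: pure_tensor_mult tensor_one)

text \<open>The two algebra maps into the tensor product have commuting images, so
  \<open>B_relation_mult\<close> applies to the images of \<alpha> and \<zeta>. The index formula
  identifies the entries with the sums that define \<open>coact_gen\<close> and
  \<open>kappa_gen\<close>.\<close>

lemma B_solution_tensor:
  assumes "B_solution M E G \<alpha> n p" "B_solution N G F \<zeta> p m"
  shows "B_relation (tensor M N) E F
    (map_mat (\<lambda>x. pure_tensor M N x \<one>\<^bsub>N\<^esub>) \<alpha> \<boxtimes>\<^bsub>tensor M N\<^esub> map_mat (\<lambda>y. pure_tensor M N \<one>\<^bsub>M\<^esub> y) \<zeta>)"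
    and "i < n \<Longrightarrow> j < m \<Longrightarrow>
      (map_mat (\<lambda>x. pure_tensor M N x \<one>\<^bsub>N\<^esub>) \<alpha> \<boxtimes>\<^bsub>tensor M N\<^esub> map_mat (\<lambda>y. pure_tensor M N \<one>\<^bsub>M\<^esub> y) \<zeta>) $$ (i, j) =
        (\<Oplus>\<^bsub>tensor M N\<^esub>l\<in>{..<p}. pure_tensor M N (\<alpha> $$ (i, l)) (\<zeta> $$ (l, j)))"
proof -
  interpret a: B_solution M E G \<alpha> n p by fact
  interpret z: B_solution N G F \<zeta> p m by fact
  note ac = amatD[OF a.z(1), simplified] and zc = amatD[OF z.z(1), simplified]
  show "B_relation (tensor M N) E F
    (map_mat (\<lambda>x. pure_tensor M N x \<one>\<^bsub>N\<^esub>) \<alpha> \<boxtimes>\<^bsub>tensor M N\<^esub> map_mat (\<lambda>y. pure_tensor M N \<one>\<^bsub>M\<^esub> y) \<zeta>)"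
  proof (rule B_relation_mult)
    show "B_solution (tensor M N) E G (map_mat (\<lambda>x. pure_tensor M N x \<one>\<^bsub>N\<^esub>) \<alpha>) n p"
      using a.B_relation_map[OF TA.kalg_axioms pure_tensor_one_right_hom] a.E a.F TA.kalg_axioms
      by (simp add: B_solution_def B_solution_axioms_def)
    show "B_solution (tensor M N) G F (map_mat (\<lambda>y. pure_tensor M N \<one>\<^bsub>M\<^esub> y) \<zeta>) p m"
      using z.B_relation_map[OF TA.kalg_axioms pure_tensor_one_left_hom] z.E z.F TA.kalg_axioms
      by (simp add: B_solution_def B_solution_axioms_def)
  qed (simp add: ac zc pure_tensor_mult)
  assume "i < n" "j < m"
  then show "(map_mat (\<lambda>x. pure_tensor M N x \<one>\<^bsub>N\<^esub>) \<alpha> \<boxtimes>\<^bsub>tensor M N\<^esub> map_mat (\<lambda>y. pure_tensor M N \<one>\<^bsub>M\<^esub> y) \<zeta>) $$ (i, j) =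
        (\<Oplus>\<^bsub>tensor M N\<^esub>l\<in>{..<p}. pure_tensor M N (\<alpha> $$ (i, l)) (\<zeta> $$ (l, j)))"
    by (auto simp: mmul_index pure_tensor_mult ac zc del: equalityI intro!: TT.finsum_cong')
qed

end

section \<open>The coaction and the canonical map\<close>

locale B_coact = B_data
begin

sublocale H: B_data E E n n
  by unfold_locales (rule E)+

sublocale HB: kalg_pair "B_alg E E" "B_alg E F" ..

abbreviation "HZ \<equiv> tensor (B_alg E E) (B_alg E F)"

definition "coact_gen i j =
  (\<Oplus>\<^bsub>HZ\<^esub>l\<in>{..<n}. pure_tensor (B_alg E E) (B_alg E F) (B_gen E E i l) (B_gen E F l j))"

lemma B_coaction_eq: "B_coaction E F = induced HZ (word_prod HZ coact_gen)"
  by (simp add: B_coaction_def word_prod_def[abs_def] coact_gen_def Let_def)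

lemma coact_gen_closed: "i < n \<Longrightarrow> j < m \<Longrightarrow> coact_gen i j \<in> carrier HZ"
  unfolding coact_gen_def by (intro HB.TT.finsum_closed) auto

lemma B_relation_coact_gen: "B_relation HZ E F (mat n m (\<lambda>(i, j). coact_gen i j))"
proof -
  have "mat n m (\<lambda>(i, j). coact_gen i j) =
    map_mat (\<lambda>x. pure_tensor (B_alg E E) (B_alg E F) x \<one>\<^bsub>B_alg E F\<^esub>) H.Z \<boxtimes>\<^bsub>HZ\<^esub>
    map_mat (\<lambda>y. pure_tensor (B_alg E E) (B_alg E F) \<one>\<^bsub>B_alg E E\<^esub> y) Z"
  proof (rule eq_matI)
    fix i j assume "i < dim_row (map_mat (\<lambda>x. pure_tensor (B_alg E E) (B_alg E F) x \<one>\<^bsub>B_alg E F\<^esub>) H.Z \<boxtimes>\<^bsub>HZ\<^esub>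
    map_mat (\<lambda>y. pure_tensor (B_alg E E) (B_alg E F) \<one>\<^bsub>B_alg E E\<^esub> y) Z)"
      "j < dim_col (map_mat (\<lambda>x. pure_tensor (B_alg E E) (B_alg E F) x \<one>\<^bsub>B_alg E F\<^esub>) H.Z \<boxtimes>\<^bsub>HZ\<^esub>
    map_mat (\<lambda>y. pure_tensor (B_alg E E) (B_alg E F) \<one>\<^bsub>B_alg E E\<^esub> y) Z)"
    then have ij: "i < n" "j < m" by auto
    show "mat n m (\<lambda>(i, j). coact_gen i j) $$ (i, j) =
    (map_mat (\<lambda>x. pure_tensor (B_alg E E) (B_alg E F) x \<one>\<^bsub>B_alg E F\<^esub>) H.Z \<boxtimes>\<^bsub>HZ\<^esub>
    map_mat (\<lambda>y. pure_tensor (B_alg E E) (B_alg E F) \<one>\<^bsub>B_alg E E\<^esub> y) Z) $$ (i, j)"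
      unfolding HB.B_solution_tensor(2)[OF H.Z.B_solution_axioms Z.B_solution_axioms ij]
      using ij by (auto simp: coact_gen_def del: equalityI intro!: HB.TT.finsum_cong')
  qed auto
  with HB.B_solution_tensor(1)[OF H.Z.B_solution_axioms Z.B_solution_axioms] show ?thesis by simp
qed

lemma coaction_hom: "B_coaction E F \<in> kalg_hom (B_alg E F) HZ"
  and coaction_gen: "i < n \<Longrightarrow> j < m \<Longrightarrow> B_coaction E F (B_gen E F i j) = coact_gen i j"
  unfolding B_coaction_eq
  using B_hom[OF HB.TA.kalg_axioms coact_gen_closed B_relation_coact_gen]
    B_hom_gen[OF HB.TA.kalg_axioms coact_gen_closed B_relation_coact_gen] by auto

section \<open>The left inverse of the canonical map\<close>

sublocale op: kalg "op_alg (B_alg E F)" by (rule kalg_op_alg[OF B.kalg_axioms])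

sublocale BB: kalg_pair "B_alg E F" "op_alg (B_alg E F)" ..

abbreviation "BB \<equiv> tensor (B_alg E F) (op_alg (B_alg E F))"
abbreviation "pt \<equiv> pure_tensor (B_alg E F) (op_alg (B_alg E F))"

text \<open>The translation map of Hopf-Galois theory on generators, that is, a preimage of a_ij
  \<otimes> 1 under the canonical map: summing \<delta>(z_il) (1 \<otimes> w_lj) over l gives a_ij
  \<otimes> 1, because z w = 1.\<close>

definition "kappa_gen i j = (\<Oplus>\<^bsub>BB\<^esub>l\<in>{..<m}. pt (Z $$ (i, l)) (Z.w $$ (l, j)))"

lemma w_closed [simp]: "i < m \<Longrightarrow> j < n \<Longrightarrow> Z.w $$ (i, j) \<in> carrier (B_alg E F)"
  by (rule amatD[OF Z.w(1)]) auto

lemma kappa_gen_closed: "i < n \<Longrightarrow> j < n \<Longrightarrow> kappa_gen i j \<in> carrier BB"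
  unfolding kappa_gen_def by (intro BB.TT.finsum_closed) auto

lemma B_solution_op: "B_solution (op_alg (B_alg E F)) F E Z.w m n"
  using Z.B_relation_op E F op.kalg_axioms by (simp add: B_solution_def B_solution_axioms_def)

text \<open>In Z the matrix z has type (E, F), and in Z^op the matrix w has type (F, E); composing
  them gives type (E, E), the relations of B(E).\<close>

lemma B_relation_kappa_gen: "B_relation BB E E (mat n n (\<lambda>(i, j). kappa_gen i j))"
proof -
  have "mat n n (\<lambda>(i, j). kappa_gen i j) =
    map_mat (\<lambda>x. pt x \<one>\<^bsub>op_alg (B_alg E F)\<^esub>) Z \<boxtimes>\<^bsub>BB\<^esub> map_mat (\<lambda>y. pt \<one>\<^bsub>B_alg E F\<^esub> y) Z.w"
    (is "_ = ?R")
  proof (rule eq_matI)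
    fix i j assume "i < dim_row ?R" "j < dim_col ?R"
    then have ij: "i < n" "j < n" by auto
    show "mat n n (\<lambda>(i, j). kappa_gen i j) $$ (i, j) = ?R $$ (i, j)"
      unfolding BB.B_solution_tensor(2)[OF Z.B_solution_axioms B_solution_op ij]
      using ij by (simp add: kappa_gen_def)
  qed auto
  with BB.B_solution_tensor(1)[OF Z.B_solution_axioms B_solution_op] show ?thesis by simp
qed

definition "kappa = induced BB (word_prod BB kappa_gen)"

lemma kappa_hom: "kappa \<in> kalg_hom (B_alg E E) BB"
  and kappa_B_gen: "i < n \<Longrightarrow> j < n \<Longrightarrow> kappa (B_gen E E i j) = kappa_gen i j"
  unfolding kappa_def
  using H.B_hom[OF BB.TA.kalg_axioms kappa_gen_closed B_relation_kappa_gen]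
    H.B_hom_gen[OF BB.TA.kalg_axioms kappa_gen_closed B_relation_kappa_gen] by auto

lemma kappa_closed [simp]: "h \<in> carrier (B_alg E E) \<Longrightarrow> kappa h \<in> carrier BB"
  by (rule linear_maps_closed[OF kalg_hom_linear[OF kappa_hom]])

text \<open>The inverse of the canonical map, up to the identification of \<open>Z \<otimes> Z\<close> with
  \<open>Z \<otimes> Z\<^sup>o\<^sup>p\<close>.\<close>

definition "can_inv = induced BB (\<lambda>(h, z). pt \<one>\<^bsub>B_alg E F\<^esub> z \<otimes>\<^bsub>BB\<^esub> kappa h)"

text \<open>In \<open>BB\<close> left multiplication by 1 \<otimes> z multiplies the second factor
  by z on the right in Z. Hence the formula extends the translation map to be linear over right
  multiplication by Z, as the canonical map is.\<close>

lemma can_inv_linear: "can_inv \<in> linear_maps HZ BB"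
  and can_inv_pure: "h \<in> carrier (B_alg E E) \<Longrightarrow> z \<in> carrier (B_alg E F) \<Longrightarrow>
    can_inv (pure_tensor (B_alg E E) (B_alg E F) h z) = pt \<one>\<^bsub>B_alg E F\<^esub> z \<otimes>\<^bsub>BB\<^esub> kappa h"
proof -
  have "bilinear_map (B_alg E E) (B_alg E F) BB (\<lambda>h z. pt \<one>\<^bsub>B_alg E F\<^esub> z \<otimes>\<^bsub>BB\<^esub> kappa h)"
    unfolding bilinear_map_def
  proof (intro conjI ballI)
    fix h assume h: "h \<in> carrier (B_alg E E)"
    have l: "(\<lambda>z. pt \<one>\<^bsub>B_alg E F\<^esub> z) \<in> linear_maps (B_alg E F) BB"
      using BB.pure_tensor_linear_right[of "\<one>\<^bsub>B_alg E F\<^esub>"] by simp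
    show "(\<lambda>z. pt \<one>\<^bsub>B_alg E F\<^esub> z \<otimes>\<^bsub>BB\<^esub> kappa h) \<in> linear_maps (B_alg E F) BB"
      by (rule linear_maps_comp[OF l kalg_mult_right_linear[OF BB.TA.kalg_axioms kappa_closed[OF h]]])
  next
    fix z assume "z \<in> carrier (B_alg E F)"
    then have "pt \<one>\<^bsub>B_alg E F\<^esub> z \<in> carrier BB" by simp
    from linear_maps_comp[OF kalg_hom_linear[OF kappa_hom] kalg_mult_left_linear[OF BB.TA.kalg_axioms this]]
    show "(\<lambda>h. pt \<one>\<^bsub>B_alg E F\<^esub> z \<otimes>\<^bsub>BB\<^esub> kappa h) \<in> linear_maps (B_alg E E) BB" .
  qed
  from HB.tensor_lift_linear[OF BB.TT.kmod_axioms this] HB.tensor_lift_pure[OF BB.TT.kmod_axioms this]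
  show "can_inv \<in> linear_maps HZ BB"
    "h \<in> carrier (B_alg E E) \<Longrightarrow> z \<in> carrier (B_alg E F) \<Longrightarrow>
    can_inv (pure_tensor (B_alg E E) (B_alg E F) h z) = pt \<one>\<^bsub>B_alg E F\<^esub> z \<otimes>\<^bsub>BB\<^esub> kappa h"
    unfolding can_inv_def by auto
qed

lemma can_inv_closed [simp]: "t \<in> carrier HZ \<Longrightarrow> can_inv t \<in> carrier BB"
  by (rule linear_maps_closed[OF can_inv_linear])

text \<open>A substitute for multiplicativity: \<open>kappa\<close> keeps the order of the Hopf
  factors, while the opposite multiplication moves z to the front, so \<open>can_inv t\<close> ends
  up enclosed between the two.\<close>

lemma can_inv_mult_pure:
  assumes "t \<in> carrier HZ" and h: "h \<in> carrier (B_alg E E)" and z: "z \<in> carrier (B_alg E F)"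
  shows "can_inv (t \<otimes>\<^bsub>HZ\<^esub> pure_tensor (B_alg E E) (B_alg E F) h z) =
    pt \<one>\<^bsub>B_alg E F\<^esub> z \<otimes>\<^bsub>BB\<^esub> can_inv t \<otimes>\<^bsub>BB\<^esub> kappa h"
  using assms(1)
proof (induction t rule: HB.tensor_induct)
  case (pure h' z')
  have "pt \<one>\<^bsub>B_alg E F\<^esub> (z' \<otimes>\<^bsub>B_alg E F\<^esub> z) = pt \<one>\<^bsub>B_alg E F\<^esub> z \<otimes>\<^bsub>BB\<^esub> pt \<one>\<^bsub>B_alg E F\<^esub> z'"
    using pure z by (simp add: BB.pure_tensor_mult)
  with pure h z show ?case
    by (simp add: HB.pure_tensor_mult can_inv_pure kalg_hom_mult[OF kappa_hom] BB.TA.m_assoc)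
next
  case (add s t)
  then show ?case
    using h z by (simp add: HB.TA.l_distr BB.TA.l_distr BB.TA.r_distr linear_maps_add[OF can_inv_linear])
qed

text \<open>Expanding \<open>kappa\<close> on generators brings w next to x in the second factor.
  With x = z this yields the values on the coaction of generators, by w z = 1; with a general x it
  produces the matrix w x to which descent is applied.\<close>

lemma can_inv_coact:
  assumes x: "amat (B_alg E F) x" "dim_row x = n" and ij: "i < n" "j < dim_col x"
  shows "can_inv (\<Oplus>\<^bsub>HZ\<^esub>l\<in>{..<n}. pure_tensor (B_alg E E) (B_alg E F) (B_gen E E i l) (x $$ (l, j))) =
    (\<Oplus>\<^bsub>BB\<^esub>p\<in>{..<m}. pt (Z $$ (i, p)) ((Z.w \<boxtimes>\<^bsub>B_alg E F\<^esub> x) $$ (p, j)))"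
proof -
  have xc: "x $$ (l, j) \<in> carrier (B_alg E F)" if "l < n" for l
    using amatD[OF x(1)] x(2) ij that by simp
  have "can_inv (\<Oplus>\<^bsub>HZ\<^esub>l\<in>{..<n}. pure_tensor (B_alg E E) (B_alg E F) (B_gen E E i l) (x $$ (l, j))) =
    (\<Oplus>\<^bsub>BB\<^esub>l\<in>{..<n}. pt \<one>\<^bsub>B_alg E F\<^esub> (x $$ (l, j)) \<otimes>\<^bsub>BB\<^esub> kappa_gen i l)"
    using ij
    by (auto simp: linear_maps_finsum[OF HB.TT.kmod_axioms BB.TT.kmod_axioms can_inv_linear] can_inv_pure
        kappa_B_gen xc kappa_gen_closed del: equalityI intro!: BB.TT.finsum_cong')
  also have "\<dots> = (\<Oplus>\<^bsub>BB\<^esub>l\<in>{..<n}. \<Oplus>\<^bsub>BB\<^esub>p\<in>{..<m}. pt (Z $$ (i, p)) (Z.w $$ (p, l) \<otimes>\<^bsub>B_alg E F\<^esub> x $$ (l, j)))"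
    unfolding kappa_gen_def using ij
    by (auto simp: BB.TA.finsum_rdistr BB.pure_tensor_mult xc del: equalityI intro!: BB.TT.finsum_cong' BB.TT.finsum_closed)
  also have "\<dots> = (\<Oplus>\<^bsub>BB\<^esub>p\<in>{..<m}. \<Oplus>\<^bsub>BB\<^esub>l\<in>{..<n}. pt (Z $$ (i, p)) (Z.w $$ (p, l) \<otimes>\<^bsub>B_alg E F\<^esub> x $$ (l, j)))"
    using ij by (intro BB.TT.finsum_swap) (auto simp: xc)
  also have "\<dots> = (\<Oplus>\<^bsub>BB\<^esub>p\<in>{..<m}. pt (Z $$ (i, p)) ((Z.w \<boxtimes>\<^bsub>B_alg E F\<^esub> x) $$ (p, j)))"
  proof (rule BB.TT.finsum_cong'[OF refl])
    fix p assume "p \<in> {..<m}"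
    then show "(\<Oplus>\<^bsub>BB\<^esub>l\<in>{..<n}. pt (Z $$ (i, p)) (Z.w $$ (p, l) \<otimes>\<^bsub>B_alg E F\<^esub> x $$ (l, j))) =
      pt (Z $$ (i, p)) ((Z.w \<boxtimes>\<^bsub>B_alg E F\<^esub> x) $$ (p, j))"
      using x(2) ij BB.pure_tensor_finsum_right[of "Z $$ (i, p)" "\<lambda>l. Z.w $$ (p, l) \<otimes>\<^bsub>B_alg E F\<^esub> x $$ (l, j)" "{..<n}"]
      by (simp add: mmul_index xc Pi_def)
  next
    show "(\<lambda>p. pt (Z $$ (i, p)) ((Z.w \<boxtimes>\<^bsub>B_alg E F\<^esub> x) $$ (p, j))) \<in> {..<m} \<rightarrow> carrier BB"
      using x ij amatD[OF B.amat_mmul[OF Z.w(1) x(1)]] by auto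
  qed
  finally show ?thesis .
qed

lemma smat_one_index:
  assumes "i < n'" "j < n'" and A: "kalg A"
  shows "smat A (1\<^sub>m n') $$ (i, j) = (if i = j then \<one>\<^bsub>A\<^esub> else \<zero>\<^bsub>A\<^esub>)"
proof -
  interpret A: kalg A by fact
  show ?thesis using assms by (simp add: smat_index)
qed

lemma can_inv_coact_gen:
  assumes ij: "i < n" "j < m"
  shows "can_inv (coact_gen i j) = pt (B_gen E F i j) \<one>\<^bsub>B_alg E F\<^esub>"
proof -
  have "can_inv (coact_gen i j) = can_inv (\<Oplus>\<^bsub>HZ\<^esub>l\<in>{..<n}. pure_tensor (B_alg E E) (B_alg E F) (B_gen E E i l) (Z $$ (l, j)))"
    unfolding coact_gen_def using ij by (intro arg_cong[of _ _ can_inv] HB.TT.finsum_cong') auto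
  also have "\<dots> = (\<Oplus>\<^bsub>BB\<^esub>p\<in>{..<m}. pt (Z $$ (i, p)) ((Z.w \<boxtimes>\<^bsub>B_alg E F\<^esub> Z) $$ (p, j)))"
    using ij by (intro can_inv_coact) auto
  also have "\<dots> = (\<Oplus>\<^bsub>BB\<^esub>p\<in>{..<m}. if j = p then pt (Z $$ (i, p)) \<one>\<^bsub>B_alg E F\<^esub> else \<zero>\<^bsub>BB\<^esub>)"
    unfolding Z.w_z
  proof (rule BB.TT.finsum_cong'[OF refl])
    fix p assume "p \<in> {..<m}"
    then show "pt (Z $$ (i, p)) (smat (B_alg E F) (1\<^sub>m m) $$ (p, j)) = (if j = p then pt (Z $$ (i, p)) \<one>\<^bsub>B_alg E F\<^esub> else \<zero>\<^bsub>BB\<^esub>)"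
      using ij BB.pure_tensor_zero_right[of "Z $$ (i, p)"] by (auto simp: smat_one_index[OF _ _ B.kalg_axioms])
  qed (use ij in auto)
  also have "\<dots> = pt (Z $$ (i, j)) \<one>\<^bsub>B_alg E F\<^esub>"
    using ij by (intro BB.TT.add.finprod_singleton) auto
  finally show ?thesis using ij by simp
qed

text \<open>The left inverse property on elements u \<otimes> 1, whose image under the canonical map
  is \<delta>(u). The induction over words needs a spectator factor \<open>s\<close> on the right,
  because \<open>can_inv\<close> has no product rule for two arbitrary tensors.\<close>

lemma can_inv_coaction:
  assumes "u \<in> carrier (B_alg E F)"
  shows "can_inv (B_coaction E F u) = pt u \<one>\<^bsub>B_alg E F\<^esub>"
proof -
  \<comment> \<open>The fact \<open>gen\<close> below peels one letter off: for a pure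
    \<open>s\<close>, \<open>can_inv_mult_pure\<close> leaves z_ij \<otimes> 1 between 1 \<otimes> z
    and \<open>kappa h\<close>, and z_ij \<otimes> 1 commutes past 1 \<otimes> z.\<close>
  note dl = kalg_hom_linear[OF coaction_hom]
  note dc = linear_maps_closed[OF dl]
  have gen: "can_inv (coact_gen i j \<otimes>\<^bsub>HZ\<^esub> s) = pt (B_gen E F i j) \<one>\<^bsub>B_alg E F\<^esub> \<otimes>\<^bsub>BB\<^esub> can_inv s"
    if ij: "i < n" "j < m" and s: "s \<in> carrier HZ" for i j s
    using s
  proof (induction s rule: HB.tensor_induct)
    case (pure h z)
    then have "can_inv (coact_gen i j \<otimes>\<^bsub>HZ\<^esub> pure_tensor (B_alg E E) (B_alg E F) h z) =
        pt \<one>\<^bsub>B_alg E F\<^esub> z \<otimes>\<^bsub>BB\<^esub> pt (B_gen E F i j) \<one>\<^bsub>B_alg E F\<^esub> \<otimes>\<^bsub>BB\<^esub> kappa h"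
      using ij by (simp add: can_inv_mult_pure coact_gen_closed can_inv_coact_gen)
    also have "pt \<one>\<^bsub>B_alg E F\<^esub> z \<otimes>\<^bsub>BB\<^esub> pt (B_gen E F i j) \<one>\<^bsub>B_alg E F\<^esub> = pt (B_gen E F i j) \<one>\<^bsub>B_alg E F\<^esub> \<otimes>\<^bsub>BB\<^esub> pt \<one>\<^bsub>B_alg E F\<^esub> z"
      using ij pure by (simp add: BB.pure_tensor_mult)
    finally show ?case using ij pure by (simp add: BB.TA.m_assoc can_inv_pure)
  next
    case (add s t)
    then show ?case
      using ij by (simp add: HB.TA.r_distr BB.TA.r_distr linear_maps_add[OF can_inv_linear] coact_gen_closed)
  qed
  have "\<forall>s\<in>carrier HZ. can_inv (B_coaction E F u \<otimes>\<^bsub>HZ\<^esub> s) = pt u \<one>\<^bsub>B_alg E F\<^esub> \<otimes>\<^bsub>BB\<^esub> can_inv s"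
    using assms
  proof (induction u rule: B_induct)
    case one
    have "pt \<one>\<^bsub>B_alg E F\<^esub> \<one>\<^bsub>B_alg E F\<^esub> = \<one>\<^bsub>BB\<^esub>" by (simp add: BB.tensor_one)
    then show ?case by (simp add: kalg_hom_one[OF coaction_hom])
  next
    case (gen i j x)
    have "pt (B_gen E F i j \<otimes>\<^bsub>B_alg E F\<^esub> x) \<one>\<^bsub>B_alg E F\<^esub> = pt (B_gen E F i j) \<one>\<^bsub>B_alg E F\<^esub> \<otimes>\<^bsub>BB\<^esub> pt x \<one>\<^bsub>B_alg E F\<^esub>"
      using gen by (simp add: BB.pure_tensor_mult)
    with gen show ?case
      by (simp add: kalg_hom_mult[OF coaction_hom] coaction_gen \<open>\<And>s j i. _ \<Longrightarrow> _ \<Longrightarrow> _ \<Longrightarrow> can_inv (coact_gen i j \<otimes>\<^bsub>HZ\<^esub> s) = _\<close>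
          HB.TA.m_assoc BB.TA.m_assoc coact_gen_closed dc)
  next
    case (smult c x)
    then show ?case
      by (simp add: linear_maps_smult[OF dl] linear_maps_smult[OF can_inv_linear] HB.TA.smult_mult_left
          BB.TA.smult_mult_left BB.pure_tensor_smult_left dc)
  next
    case (add x y)
    then show ?case
      by (simp add: linear_maps_add[OF dl] linear_maps_add[OF can_inv_linear] HB.TA.l_distr BB.TA.l_distr
          BB.pure_tensor_add_left dc)
  qed
  \<comment> \<open>The spectator is removed by taking it to be the unit.\<close>
  moreover have "can_inv \<one>\<^bsub>HZ\<^esub> = \<one>\<^bsub>BB\<^esub>"
    using BB.tensor_one by (simp add: HB.tensor_one can_inv_pure kalg_hom_one[OF kappa_hom] BB.pure_tensor_mult)
  ultimately show ?thesis
    using assms dc by (auto dest!: bspec[of _ _ "\<one>\<^bsub>HZ\<^esub>"])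
qed

text \<open>Applying \<open>can_inv\<close> to the hypothesis on x gives x_ij \<otimes> 1 as the sum
  over p of z_ip \<otimes> y_pj. Multiplying by z' w_qi in the first factor and summing over i
  cancels z. The extra factor z' provides the identity for all elements of Z, the form in which
  flatness tests y.\<close>

lemma cotensor:
  assumes x: "amat (B_alg E F) x" "dim_row x = n"
    and coact: "\<And>i j. i < n \<Longrightarrow> j < dim_col x \<Longrightarrow> B_coaction E F (x $$ (i, j)) =
      (\<Oplus>\<^bsub>HZ\<^esub>l\<in>{..<n}. pure_tensor (B_alg E E) (B_alg E F) (B_gen E E i l) (x $$ (l, j)))"
    and qj: "q < m" "j < dim_col x" and z': "z' \<in> carrier (B_alg E F)"
  defines "y \<equiv> (Z.w \<boxtimes>\<^bsub>B_alg E F\<^esub> x)"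
  shows "pt (z' \<otimes>\<^bsub>B_alg E F\<^esub> y $$ (q, j)) \<one>\<^bsub>B_alg E F\<^esub> = pt z' (y $$ (q, j))"
proof -
  let ?B = "B_alg E F"
  have xc: "x $$ (l, j) \<in> carrier ?B" if "l < n" for l
    using amatD[OF x(1)] x(2) qj that by simp
  have y: "amat ?B y" "dim_row y = m" "dim_col y = dim_col x" using x by (simp_all add: y_def)
  have yc: "y $$ (p, j) \<in> carrier ?B" if "p < m" for p
    using amatD[OF y(1)] y(2,3) qj that by simp
  have eq: "pt (x $$ (i, j)) \<one>\<^bsub>?B\<^esub> = (\<Oplus>\<^bsub>BB\<^esub>p\<in>{..<m}. pt (Z $$ (i, p)) (y $$ (p, j)))" if "i < n" for i
    using can_inv_coaction[of "x $$ (i, j)"] can_inv_coact[OF x that qj(2)] coact[OF that qj(2)] xc[of i] that qj x(2)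
    by (simp add: y_def)
  have "z' \<otimes>\<^bsub>?B\<^esub> y $$ (q, j) = (\<Oplus>\<^bsub>?B\<^esub>i\<in>{..<n}. z' \<otimes>\<^bsub>?B\<^esub> (Z.w $$ (q, i) \<otimes>\<^bsub>?B\<^esub> x $$ (i, j)))"
    using qj z' x(2) by (simp add: y_def mmul_index B.finsum_rdistr xc Pi_def)
  also have "\<dots> = (\<Oplus>\<^bsub>?B\<^esub>i\<in>{..<n}. z' \<otimes>\<^bsub>?B\<^esub> Z.w $$ (q, i) \<otimes>\<^bsub>?B\<^esub> x $$ (i, j))"
    by (rule B.finsum_cong'[OF refl]) (use qj z' in \<open>simp_all add: xc B.m_assoc Pi_def\<close>)
  finally have "pt (z' \<otimes>\<^bsub>?B\<^esub> y $$ (q, j)) \<one>\<^bsub>?B\<^esub> = pt (\<Oplus>\<^bsub>?B\<^esub>i\<in>{..<n}. z' \<otimes>\<^bsub>?B\<^esub> Z.w $$ (q, i) \<otimes>\<^bsub>?B\<^esub> x $$ (i, j)) \<one>\<^bsub>?B\<^esub>"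
    by simp
  also have "\<dots> = (\<Oplus>\<^bsub>BB\<^esub>i\<in>{..<n}. pt (z' \<otimes>\<^bsub>?B\<^esub> Z.w $$ (q, i) \<otimes>\<^bsub>?B\<^esub> x $$ (i, j)) \<one>\<^bsub>?B\<^esub>)"
    by (rule BB.pure_tensor_finsum_left) (use qj z' in \<open>auto simp: xc\<close>)
  also have "\<dots> = (\<Oplus>\<^bsub>BB\<^esub>i\<in>{..<n}. pt (z' \<otimes>\<^bsub>?B\<^esub> Z.w $$ (q, i)) \<one>\<^bsub>?B\<^esub> \<otimes>\<^bsub>BB\<^esub> pt (x $$ (i, j)) \<one>\<^bsub>?B\<^esub>)"
    by (rule BB.TT.finsum_cong'[OF refl]) (use qj z' in \<open>auto simp: xc BB.pure_tensor_mult\<close>)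
  \<comment> \<open>Each x_ij \<otimes> 1 is replaced by its expansion \<open>eq\<close>; after the
    sums are exchanged, the sum over i is the entry (q, p) of w z = 1.\<close>
  also have "\<dots> = (\<Oplus>\<^bsub>BB\<^esub>i\<in>{..<n}. \<Oplus>\<^bsub>BB\<^esub>p\<in>{..<m}. pt (z' \<otimes>\<^bsub>?B\<^esub> (Z.w $$ (q, i) \<otimes>\<^bsub>?B\<^esub> Z $$ (i, p))) (y $$ (p, j)))"
    by (rule BB.TT.finsum_cong'[OF refl])
      (use qj z' in \<open>auto simp: eq yc BB.pure_tensor_mult BB.TA.finsum_rdistr B.m_assoc del: equalityI intro!: BB.TT.finsum_cong' BB.TT.finsum_closed\<close>)
  also have "\<dots> = (\<Oplus>\<^bsub>BB\<^esub>p\<in>{..<m}. \<Oplus>\<^bsub>BB\<^esub>i\<in>{..<n}. pt (z' \<otimes>\<^bsub>?B\<^esub> (Z.w $$ (q, i) \<otimes>\<^bsub>?B\<^esub> Z $$ (i, p))) (y $$ (p, j)))"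
    using qj z' by (intro BB.TT.finsum_swap) (auto simp: yc)
  also have "\<dots> = (\<Oplus>\<^bsub>BB\<^esub>p\<in>{..<m}. if q = p then pt z' (y $$ (p, j)) else \<zero>\<^bsub>BB\<^esub>)"
  proof (rule BB.TT.finsum_cong'[OF refl])
    fix p assume p: "p \<in> {..<m}"
    have "(\<Oplus>\<^bsub>BB\<^esub>i\<in>{..<n}. pt (z' \<otimes>\<^bsub>?B\<^esub> (Z.w $$ (q, i) \<otimes>\<^bsub>?B\<^esub> Z $$ (i, p))) (y $$ (p, j))) =
        pt (\<Oplus>\<^bsub>?B\<^esub>i\<in>{..<n}. z' \<otimes>\<^bsub>?B\<^esub> (Z.w $$ (q, i) \<otimes>\<^bsub>?B\<^esub> Z $$ (i, p))) (y $$ (p, j))"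
      by (rule BB.pure_tensor_finsum_left[symmetric]) (use p qj z' in \<open>auto simp: yc\<close>)
    also have "(\<Oplus>\<^bsub>?B\<^esub>i\<in>{..<n}. z' \<otimes>\<^bsub>?B\<^esub> (Z.w $$ (q, i) \<otimes>\<^bsub>?B\<^esub> Z $$ (i, p))) = z' \<otimes>\<^bsub>?B\<^esub> (Z.w \<boxtimes>\<^bsub>?B\<^esub> Z) $$ (q, p)"
      using p qj z' by (simp add: mmul_index B.finsum_rdistr Pi_def)
    also have "\<dots> = (if q = p then z' else \<zero>\<^bsub>?B\<^esub>)"
      using p qj z' by (simp add: Z.w_z smat_one_index[OF _ _ B.kalg_axioms])
    finally show "(\<Oplus>\<^bsub>BB\<^esub>i\<in>{..<n}. pt (z' \<otimes>\<^bsub>?B\<^esub> (Z.w $$ (q, i) \<otimes>\<^bsub>?B\<^esub> Z $$ (i, p))) (y $$ (p, j))) =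
        (if q = p then pt z' (y $$ (p, j)) else \<zero>\<^bsub>BB\<^esub>)"
      using p qj z' by (simp add: yc)
  qed (use qj z' in \<open>auto simp: yc\<close>)
  also have "\<dots> = pt z' (y $$ (q, j))"
    using qj z' by (intro BB.TT.add.finprod_singleton) (auto simp: yc)
  finally show ?thesis .
qed

end

section \<open>Faithful flatness\<close>

text \<open>Test exactness of \<open>k n \<rightarrow> N \<rightarrow> N\<close>, the inclusion of a cyclic submodule followed by the identity.\<close>

lemma faithfully_flat_zeroI:
  fixes M :: "('k::comm_ring_1, 'm) module" and N :: "('k, 'u) module"
  assumes ff: "faithfully_flat TYPE('u) M" and M: "kmod M" and N: "kmod N" and a: "a \<in> carrier N"
    and zero: "\<And>x. x \<in> carrier M \<Longrightarrow> pure_tensor M N x a = \<zero>\<^bsub>tensor M N\<^esub>"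
  shows "a = \<zero>\<^bsub>N\<^esub>"
proof -
  interpret N: kmod N by fact
  interpret MN: kmod_pair M N using M N by (simp add: kmod_pair_def)
  let ?C = "range (\<lambda>c. c \<odot>\<^bsub>N\<^esub> a)"
  let ?N1 = "N\<lparr>carrier := ?C\<rparr>"
  have "submodule ?C ring_of_type_algebra N"
  proof (rule N.submodule_if_closed)
    show "\<zero>\<^bsub>N\<^esub> \<in> ?C" using a by (auto intro: range_eqI[of _ _ 0])
    show "x \<oplus>\<^bsub>N\<^esub> y \<in> ?C" if "x \<in> ?C" "y \<in> ?C" for x y
      using that a by (auto simp flip: N.smult_l_distr)
    show "c \<odot>\<^bsub>N\<^esub> x \<in> ?C" if "x \<in> ?C" for c x
      using that a by (auto simp flip: N.smult_assoc)
  qed (use a in auto)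
  then have mod1: "module ring_of_type_algebra ?N1"
    by (rule submodule.submodule_is_module) (use N in \<open>simp add: kmod_iff_module\<close>)
  then have N1: "kmod ?N1" by (simp add: kmod_iff_module)
  interpret MN1: kmod_pair M ?N1 using M N1 by (simp add: kmod_pair_def)
  have incl: "id \<in> linear_maps ?N1 N" using a by (auto simp: linear_maps_def)
  note t1 = tensor_map_linear[OF M N1 M N linear_maps_id incl] tensor_map_pure[OF M N1 M N linear_maps_id incl]
  note t2 = tensor_map_linear[OF M N M N linear_maps_id linear_maps_id] tensor_map_pure[OF M N M N linear_maps_id linear_maps_id]
  have id: "tensor_map M N id id t = t" if "t \<in> carrier (tensor M N)" for t
    using MN.linear_maps_tensor_eqI[OF t2(1) linear_maps_id, of t] t2(2) that by simp
  have z: "tensor_map M N id id t = \<zero>\<^bsub>tensor M N\<^esub>" if "t \<in> carrier (tensor M ?N1)" for t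
    using that
  proof (induction t rule: MN1.tensor_induct)
    case (pure x y)
    then obtain c where "y = c \<odot>\<^bsub>N\<^esub> a" by auto
    then have "pure_tensor M N x y = \<zero>\<^bsub>tensor M N\<^esub>"
      using pure a by (simp add: MN.pure_tensor_smult_right zero)
    moreover have "tensor_map M N id id (pure_tensor M ?N1 x y) = pure_tensor M N x y"
      using t1(2)[OF pure] by (simp only: id_apply)
    ultimately show ?case by (simp only:)
  next
    case (add s t)
    show ?case by (simp only: linear_maps_add[OF t1(1) add(1,2)] add(3,4)) simp
  qed
  \<comment> \<open>After tensoring, the first map is zero, since x \<otimes> c a = c (x \<otimes>
    a) = 0, and the identity has zero kernel. Exactness before tensoring then says that every
    multiple of a vanishes.\<close>
  have "exact_at (tensor M ?N1) (tensor M N) (tensor M N) (tensor_map M N id id) (tensor_map M N id id)"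
    unfolding exact_at_def
  proof (intro equalityI subsetI)
    fix t assume "t \<in> tensor_map M N id id ` carrier (tensor M ?N1)"
    then show "t \<in> {y \<in> carrier (tensor M N). tensor_map M N id id y = \<zero>\<^bsub>tensor M N\<^esub>}"
      using z id[OF MN.TT.zero_closed] by auto
  next
    fix t assume "t \<in> {y \<in> carrier (tensor M N). tensor_map M N id id y = \<zero>\<^bsub>tensor M N\<^esub>}"
    then have "t = \<zero>\<^bsub>tensor M N\<^esub>" using id by auto
    then show "t \<in> tensor_map M N id id ` carrier (tensor M ?N1)"
      using z[OF MN1.TT.zero_closed] MN1.TT.zero_closed by (metis image_eqI)
  qed
  then have "exact_at ?N1 N N id id"
    using ff mod1 N incl linear_maps_id unfolding faithfully_flat_def kmod_iff_module by blast
  then have "?C = {y \<in> carrier N. y = \<zero>\<^bsub>N\<^esub>}" by (simp add: exact_at_def)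
  moreover have "a \<in> ?C" using a by (auto intro: range_eqI[of _ _ 1])
  ultimately show ?thesis by auto
qed

section \<open>Injectivity of scalars and descent\<close>

context B_coact
begin

text \<open>If c kills the unit of Z, it kills Z, hence every x \<otimes> c n = c x \<otimes> n
  vanishes and flatness forces c n = 0. A free module with n a basis element then gives c =
  0.\<close>

lemma scalar_inj:
  assumes ff: "B_faithfully_flat E F" and c: "c \<odot>\<^bsub>B_alg E F\<^esub> \<one>\<^bsub>B_alg E F\<^esub> = \<zero>\<^bsub>B_alg E F\<^esub>"
  shows "c = 0"
proof -
  \<comment> \<open>Test modules must consist of sets of polynomials, so the free algebra is taken
    in the guise of its quotient by zero.\<close>
  let ?N = "quotient_module FA {\<zero>\<^bsub>FA\<^esub>}" and ?cl = "\<lambda>p. {\<zero>\<^bsub>FA\<^esub>} +>\<^bsub>FA\<^esub> p"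
  have "submodule {\<zero>\<^bsub>FA\<^esub>} ring_of_type_algebra FA"
    by (rule FA.submodule_if_closed) auto
  then interpret S: ksub "{\<zero>\<^bsub>FA\<^esub>}" FA by (rule ksubI[OF FA.kmod_axioms])
  interpret N: kmod ?N by (rule S.kmod_quotient)
  interpret BN: kmod_pair "B_alg E F" ?N ..
  have one: "?cl \<one>\<^bsub>FA\<^esub> \<in> carrier ?N" by (simp add: carrier_quotient_module)
  have "c \<odot>\<^bsub>?N\<^esub> ?cl \<one>\<^bsub>FA\<^esub> = \<zero>\<^bsub>?N\<^esub>"
  proof (rule faithfully_flat_zeroI[OF ff B.kmod_axioms N.kmod_axioms])
    fix x assume x: "x \<in> carrier (B_alg E F)"
    have "c \<odot>\<^bsub>B_alg E F\<^esub> x = (c \<odot>\<^bsub>B_alg E F\<^esub> \<one>\<^bsub>B_alg E F\<^esub>) \<otimes>\<^bsub>B_alg E F\<^esub> x"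
      using x by (simp add: B.smult_mult_left)
    then have "c \<odot>\<^bsub>B_alg E F\<^esub> x = \<zero>\<^bsub>B_alg E F\<^esub>" using c x by simp
    then show "pure_tensor (B_alg E F) ?N x (c \<odot>\<^bsub>?N\<^esub> ?cl \<one>\<^bsub>FA\<^esub>) = \<zero>\<^bsub>tensor (B_alg E F) ?N\<^esub>"
      using x one BN.pure_tensor_smult_left[OF x one, of c] by (simp add: BN.pure_tensor_smult_right)
  qed (use one in simp)
  then have "?cl (c \<odot>\<^bsub>FA\<^esub> \<one>\<^bsub>FA\<^esub>) = {\<zero>\<^bsub>FA\<^esub>}"
    by (simp add: S.quotient_smult) (simp add: quotient_module_simps)
  then have "c \<odot>\<^bsub>FA\<^esub> \<one>\<^bsub>FA\<^esub> = \<zero>\<^bsub>FA\<^esub>" by (simp add: S.coset_eq_zero_iff)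
  then show ?thesis
    by (simp add: free_algebra_def map_times_single) (metis lookup_single_eq lookup_zero)
qed

text \<open>Apply id \<otimes> pr to the hypothesis, with pr the projection onto Z / k1: the left
  side vanishes because pr kills 1, so z \<otimes> pr(y) = 0 for all z. Faithful flatness gives
  pr(y) = 0, which means that y is a scalar.\<close>

lemma descent:
  assumes ff: "B_faithfully_flat E F" and y: "y \<in> carrier (B_alg E F)"
    and eq: "\<And>z. z \<in> carrier (B_alg E F) \<Longrightarrow> pt (z \<otimes>\<^bsub>B_alg E F\<^esub> y) \<one>\<^bsub>B_alg E F\<^esub> = pt z y"
  shows "\<exists>c. y = c \<odot>\<^bsub>B_alg E F\<^esub> \<one>\<^bsub>B_alg E F\<^esub>"
proof -
  let ?B = "B_alg E F"
  \<comment> \<open>The preimage of k1 in the free algebra. The quotient by it is Z / k1 in the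
    prescribed universe of test modules; a quotient of Z itself would consist of sets of
    cosets.\<close>
  define J where "J = {p \<in> carrier FA. \<exists>c. cl p = c \<odot>\<^bsub>?B\<^esub> \<one>\<^bsub>?B\<^esub>}"
  let ?N = "quotient_module FA J"
  note lin = kalg_hom_linear[OF cl_hom]
  have sub: "submodule J ring_of_type_algebra FA"
    unfolding J_def
  proof (rule FA.submodule_if_closed)
    let ?J = "{p \<in> carrier FA. \<exists>c. cl p = c \<odot>\<^bsub>?B\<^esub> \<one>\<^bsub>?B\<^esub>}"
    have "cl \<zero>\<^bsub>FA\<^esub> = 0 \<odot>\<^bsub>?B\<^esub> \<one>\<^bsub>?B\<^esub>"
      using linear_maps_zero[OF FA.kmod_axioms B.kmod_axioms lin] by simp
    then show "\<zero>\<^bsub>FA\<^esub> \<in> ?J" by blast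
    show "p \<oplus>\<^bsub>FA\<^esub> q \<in> ?J" if pq: "p \<in> ?J" "q \<in> ?J" for p q
    proof -
      obtain c d where "cl p = c \<odot>\<^bsub>?B\<^esub> \<one>\<^bsub>?B\<^esub>" "cl q = d \<odot>\<^bsub>?B\<^esub> \<one>\<^bsub>?B\<^esub>" using pq by blast
      then have "cl (p \<oplus>\<^bsub>FA\<^esub> q) = (c + d) \<odot>\<^bsub>?B\<^esub> \<one>\<^bsub>?B\<^esub>"
        using pq by (simp add: linear_maps_add[OF lin] B.smult_l_distr)
      then show ?thesis using pq by blast
    qed
    show "c \<odot>\<^bsub>FA\<^esub> p \<in> ?J" if p: "p \<in> ?J" for c p
    proof -
      obtain d where "cl p = d \<odot>\<^bsub>?B\<^esub> \<one>\<^bsub>?B\<^esub>" using p by blast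
      then have "cl (c \<odot>\<^bsub>FA\<^esub> p) = (c * d) \<odot>\<^bsub>?B\<^esub> \<one>\<^bsub>?B\<^esub>"
        using p by (simp add: linear_maps_smult[OF lin] B.smult_assoc)
      then show ?thesis using p by blast
    qed
  qed auto
  interpret S: ksub J FA by (rule ksubI[OF FA.kmod_axioms sub])
  interpret N: kmod ?N by (rule S.kmod_quotient)
  interpret BN: kmod_pair ?B ?N ..
  have kill: "J +>\<^bsub>FA\<^esub> p = \<zero>\<^bsub>?N\<^esub>" if "p \<in> B_ideal E F" for p
  proof -
    have "cl p = B_ideal E F" by (rule I.a_rcos_const[OF that])
    also have "\<dots> = \<zero>\<^bsub>?B\<^esub>" by (simp add: B_alg_eq quotient_module_simps)
    also have "\<dots> = 0 \<odot>\<^bsub>?B\<^esub> \<one>\<^bsub>?B\<^esub>" by simp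
    finally have "p \<in> J" using that I.a_subset unfolding J_def by blast
    then show ?thesis unfolding quotient_module_simps(2) by (rule S.a_rcos_const)
  qed
  define pr where "pr C = the_elem ((\<lambda>p. J +>\<^bsub>FA\<^esub> p) ` C)" for C
  have pr: "pr \<in> linear_maps ?B ?N"
    unfolding pr_def by (rule I.the_elem_linear[OF N.kmod_axioms S.coset_linear kill, folded B_alg_eq])
  have pr_cl: "pr (cl p) = J +>\<^bsub>FA\<^esub> p" if "p \<in> carrier FA" for p
    unfolding pr_def by (rule I.the_elem_coset[OF N.kmod_axioms S.coset_linear kill that])
  have pr_zero: "pr (cl p) = \<zero>\<^bsub>?N\<^esub> \<longleftrightarrow> p \<in> J" if "p \<in> carrier FA" for p
    unfolding pr_cl[OF that] quotient_module_simps(2) by (rule S.coset_eq_zero_iff[OF that])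
  have "cl \<one>\<^bsub>FA\<^esub> = 1 \<odot>\<^bsub>?B\<^esub> \<one>\<^bsub>?B\<^esub>" using kalg_hom_one[OF cl_hom] by simp
  then have "\<one>\<^bsub>FA\<^esub> \<in> J" using FA.one_closed unfolding J_def by blast
  then have "pr (cl \<one>\<^bsub>FA\<^esub>) = \<zero>\<^bsub>?N\<^esub>" by (rule iffD2[OF pr_zero[OF FA.one_closed]])
  then have pr_one: "pr \<one>\<^bsub>?B\<^esub> = \<zero>\<^bsub>?N\<^esub>" by (simp only: kalg_hom_one[OF cl_hom])
  \<comment> \<open>The hypothesis lives in Z \<otimes> Z^op, so the projection has to act on the
    opposite algebra.\<close>
  have "pr \<in> linear_maps (op_alg ?B) ?N" using pr by simp
  note tm = tensor_map_pure[OF B.kmod_axioms op.kmod_axioms B.kmod_axioms N.kmod_axioms linear_maps_id this]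
  have "pr y = \<zero>\<^bsub>?N\<^esub>"
  proof (rule faithfully_flat_zeroI[OF ff B.kmod_axioms N.kmod_axioms linear_maps_closed[OF pr y]])
    fix z assume z: "z \<in> carrier ?B"
    show "pure_tensor ?B ?N z (pr y) = \<zero>\<^bsub>tensor ?B ?N\<^esub>"
      using tm[of z y] tm[of "z \<otimes>\<^bsub>?B\<^esub> y" "\<one>\<^bsub>?B\<^esub>"] z y eq[OF z] by (simp add: pr_one)
  qed
  moreover obtain p where p: "p \<in> carrier FA" "y = cl p"
    using y by (auto simp: B_alg_eq carrier_quotient_module)
  ultimately have "p \<in> J" by (simp only: pr_zero[OF p(1)])
  with p show ?thesis unfolding J_def by blast
qed

end

section \<open>Isomorphisms\<close>

lemma comodule_iso_imp_congruent:
  fixes E F1 F2 :: "'k::comm_ring_1 mat"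
  assumes E: "E \<in> GL n" and F1: "F1 \<in> GL m1" and F2: "F2 \<in> GL m2" and ff: "B_faithfully_flat E F2"
    and \<phi>: "\<phi> \<in> kalg_hom (B_alg E F1) (B_alg E F2)"
    and comod: "\<And>x. x \<in> carrier (B_alg E F1) \<Longrightarrow>
      B_coaction E F2 (\<phi> x) = tensor_map (B_hopf E) (B_alg E F2) id \<phi> (B_coaction E F1 x)"
  shows "m1 = m2 \<and> (\<exists>P \<in> GL m1. F1 = P * F2 * transpose_mat P)"
proof -
  interpret C1: B_coact E F1 n m1 using E F1 by (simp add: B_coact_def B_data_def)
  interpret C2: B_coact E F2 n m2 using E F2 by (simp add: B_coact_def B_data_def)
  let ?H = "B_hopf E" and ?B1 = "B_alg E F1" and ?B2 = "B_alg E F2"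
  note lin = kalg_hom_linear[OF \<phi>]
  note lin_closed = linear_maps_closed[OF lin]
  define x where "x = map_mat \<phi> C1.Z"
  have x_index: "x $$ (i, j) = \<phi> (B_gen E F1 i j)" if "i < n" "j < m1" for i j
    using that by (simp add: x_def)
  have "B_relation ?B2 E F1 x"
    unfolding x_def by (rule C1.Z.B_relation_map[OF C2.B.kalg_axioms \<phi>])
  then interpret x: B_solution ?B2 E F1 x n m1
    using E F1 C2.B.kalg_axioms by (simp add: B_solution_def B_solution_axioms_def)
  note tm = tensor_map_linear[OF C1.H.B.kmod_axioms C1.B.kmod_axioms C1.H.B.kmod_axioms C2.B.kmod_axioms linear_maps_id lin]
    tensor_map_pure[OF C1.H.B.kmod_axioms C1.B.kmod_axioms C1.H.B.kmod_axioms C2.B.kmod_axioms linear_maps_id lin]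
  \<comment> \<open>The coaction formula for generators involves only row indices, so colinearity
    carries it over to their images.\<close>
  have coact: "B_coaction E F2 (x $$ (i, j)) =
      (\<Oplus>\<^bsub>C2.HZ\<^esub>l\<in>{..<n}. pure_tensor ?H ?B2 (B_gen E E i l) (x $$ (l, j)))"
    if ij: "i < n" "j < dim_col x" for i j
  proof -
    have "B_coaction E F2 (x $$ (i, j)) = tensor_map ?H ?B2 id \<phi> (C1.coact_gen i j)"
      using ij by (simp add: x_index comod C1.coaction_gen)
    also have "\<dots> = (\<Oplus>\<^bsub>C2.HZ\<^esub>l\<in>{..<n}. tensor_map ?H ?B2 id \<phi> (pure_tensor ?H ?B1 (B_gen E E i l) (B_gen E F1 l j)))"
      unfolding C1.coact_gen_def
      by (rule linear_maps_finsum[OF C1.HB.TT.kmod_axioms C2.HB.TT.kmod_axioms tm(1)]) (use ij in auto)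
    also have "\<dots> = (\<Oplus>\<^bsub>C2.HZ\<^esub>l\<in>{..<n}. pure_tensor ?H ?B2 (B_gen E E i l) (x $$ (l, j)))"
      by (rule C2.HB.TT.finsum_cong'[OF refl]) (use ij in \<open>auto simp: tm(2) x_index lin_closed\<close>)
    finally show ?thesis .
  qed
  define y where "y = C2.Z.w \<boxtimes>\<^bsub>?B2\<^esub> x"
  have y: "amat ?B2 y" "dim_row y = m2" "dim_col y = m1" by (simp_all add: y_def)
  have "\<exists>c. y $$ (q, j) = c \<odot>\<^bsub>?B2\<^esub> \<one>\<^bsub>?B2\<^esub>" if qj: "q < m2" "j < m1" for q j
  proof (rule C2.descent[OF ff])
    show "y $$ (q, j) \<in> carrier ?B2" using amatD[OF y(1)] qj y by simp
    show "C2.pt (z \<otimes>\<^bsub>?B2\<^esub> y $$ (q, j)) \<one>\<^bsub>?B2\<^esub> = C2.pt z (y $$ (q, j))" if "z \<in> carrier ?B2" for z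
      unfolding y_def by (rule C2.cotensor[OF _ _ coact]) (use that qj in auto)
  qed
  then obtain c where c: "\<And>q j. q < m2 \<Longrightarrow> j < m1 \<Longrightarrow> y $$ (q, j) = c q j \<odot>\<^bsub>?B2\<^esub> \<one>\<^bsub>?B2\<^esub>"
    by metis
  define P where "P = mat m2 m1 (\<lambda>(q, j). c q j)"
  have P: "P \<in> carrier_mat m2 m1" "dim_row P = m2" "dim_col P = m1" by (simp_all add: P_def)
  have yP: "y = smat ?B2 P"
    by (rule eq_matI) (auto simp: y P smat_index P_def c)
  have "C2.Z \<boxtimes>\<^bsub>?B2\<^esub> y = x"
    by (simp add: y_def C2.Z.z_w flip: C2.B.mmul_assoc)
  then have xP: "x = C2.Z \<boxtimes>\<^bsub>?B2\<^esub> smat ?B2 P" by (simp add: yP)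
  \<comment> \<open>By injectivity of k -> Z a scalar matrix over Z determines its entries in k.
    This transfers both F1 = P^t F2 P and the second inverse identity for P.\<close>
  have smat_inj: "S = S'" if "smat ?B2 S = smat ?B2 S'" "S \<in> carrier_mat a b" "S' \<in> carrier_mat a b" for S S' a b
  proof (rule eq_matI)
    fix i j assume ij: "i < dim_row S'" "j < dim_col S'"
    have "smat ?B2 S $$ (i, j) = smat ?B2 S' $$ (i, j)" using that(1) by simp
    then have "S $$ (i, j) \<odot>\<^bsub>?B2\<^esub> \<one>\<^bsub>?B2\<^esub> = S' $$ (i, j) \<odot>\<^bsub>?B2\<^esub> \<one>\<^bsub>?B2\<^esub>"
      using ij that(2,3) by (simp add: smat_index)
    then have "(S $$ (i, j) - S' $$ (i, j)) \<odot>\<^bsub>?B2\<^esub> \<one>\<^bsub>?B2\<^esub> = \<zero>\<^bsub>?B2\<^esub>"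
      using C2.B.smult_l_distr[of "\<one>\<^bsub>?B2\<^esub>" "S $$ (i, j)" "- S' $$ (i, j)"]
        C2.B.smult_l_distr[of "\<one>\<^bsub>?B2\<^esub>" "S' $$ (i, j)" "- S' $$ (i, j)"] by simp
    then show "S $$ (i, j) = S' $$ (i, j)" using C2.scalar_inj[OF ff] by fastforce
  qed (use that in auto)
  \<comment> \<open>Multiplying F1 = P^t F2 P by the inverse of F1 shows that this is a left inverse
    of P. Over Z it equals \<open>x.w\<close> times the generating matrix, from which the right
    inverse property is obtained.\<close>
  let ?Q = "mat_inv F1 * (transpose_mat P * F2)"
  have Q: "?Q \<in> carrier_mat m1 m2" using P C1.F_mat C2.F_mat by auto
  have xT: "transpose_mat x = smat ?B2 (transpose_mat P) \<boxtimes>\<^bsub>?B2\<^esub> transpose_mat C2.Z"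
    by (simp add: xP C2.B.transpose_mmul_smat P)
  have "smat ?B2 (transpose_mat P * (F2 * P)) = smat ?B2 F1"
  proof -
    have "transpose_mat x \<boxtimes>\<^bsub>?B2\<^esub> (smat ?B2 E \<boxtimes>\<^bsub>?B2\<^esub> x) =
      smat ?B2 (transpose_mat P) \<boxtimes>\<^bsub>?B2\<^esub> (transpose_mat C2.Z \<boxtimes>\<^bsub>?B2\<^esub> (smat ?B2 E \<boxtimes>\<^bsub>?B2\<^esub> C2.Z) \<boxtimes>\<^bsub>?B2\<^esub> smat ?B2 P)"
      unfolding xT by (simp add: xP C2.B.mmul_assoc P)
    also have "\<dots> = smat ?B2 (transpose_mat P * (F2 * P))"
      by (simp add: C2.Z.zEz C2.B.smat_mult P)
    finally show ?thesis by (simp add: x.zEz)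
  qed
  then have F1_eq: "transpose_mat P * (F2 * P) = F1"
    by (rule smat_inj) (use P C1.F_mat C2.F_mat in auto)
  have "transpose_mat P * F2 * P = F1"
    using F1_eq P C2.F_mat(1) by (simp add: assoc_mult_mat[of _ m1 m2 _ m2 _ m1])
  then have QP: "?Q * P = 1\<^sub>m m1"
    using P C1.F_mat C2.F_mat by (simp add: assoc_mult_mat[of _ m1 m1 _ m2 _ m1])
  have "smat ?B2 (P * ?Q) = smat ?B2 (1\<^sub>m m2)"
  proof -
    have wZ: "x.w \<boxtimes>\<^bsub>?B2\<^esub> C2.Z = smat ?B2 ?Q"
    proof -
      have "x.w \<boxtimes>\<^bsub>?B2\<^esub> C2.Z = smat ?B2 (mat_inv F1) \<boxtimes>\<^bsub>?B2\<^esub> (smat ?B2 (transpose_mat P) \<boxtimes>\<^bsub>?B2\<^esub>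
          (transpose_mat C2.Z \<boxtimes>\<^bsub>?B2\<^esub> (smat ?B2 E \<boxtimes>\<^bsub>?B2\<^esub> C2.Z)))"
        by (simp add: B_inverse_def xT C2.B.mmul_assoc P)
      then show ?thesis by (simp add: C2.Z.zEz C2.B.smat_mult P)
    qed
    \<comment> \<open>Insert w z = 1 in front, recognise z P = x and cancel x against its inverse: P
      times \<open>x.w\<close> is \<open>C2.Z.w\<close>. Multiplying by z on the right turns this
      into P Q = 1.\<close>
    have "smat ?B2 P \<boxtimes>\<^bsub>?B2\<^esub> x.w = C2.Z.w \<boxtimes>\<^bsub>?B2\<^esub> C2.Z \<boxtimes>\<^bsub>?B2\<^esub> smat ?B2 P \<boxtimes>\<^bsub>?B2\<^esub> x.w"
      by (simp add: C2.Z.w_z P)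
    also have "\<dots> = C2.Z.w \<boxtimes>\<^bsub>?B2\<^esub> (C2.Z \<boxtimes>\<^bsub>?B2\<^esub> smat ?B2 P) \<boxtimes>\<^bsub>?B2\<^esub> x.w"
      by (simp add: C2.B.mmul_assoc[of C2.Z.w C2.Z "smat ?B2 P"] P)
    also have "\<dots> = C2.Z.w \<boxtimes>\<^bsub>?B2\<^esub> (x \<boxtimes>\<^bsub>?B2\<^esub> x.w)"
      unfolding xP[symmetric] by (rule C2.B.mmul_assoc) simp_all
    also have "\<dots> = C2.Z.w" by (simp add: x.z_w)
    finally have "smat ?B2 P \<boxtimes>\<^bsub>?B2\<^esub> (x.w \<boxtimes>\<^bsub>?B2\<^esub> C2.Z) = C2.Z.w \<boxtimes>\<^bsub>?B2\<^esub> C2.Z"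
      using C2.B.mmul_assoc[of "smat ?B2 P" x.w C2.Z] by (simp add: P)
    then show ?thesis by (simp add: wZ C2.Z.w_z C2.B.smat_mult P)
  qed
  then have PQ: "P * ?Q = 1\<^sub>m m2"
    by (rule smat_inj) (use P Q in auto)
  have m: "m1 = m2"
    using left_inverse_imp_dim_le[OF P(1) Q QP] left_inverse_imp_dim_le[OF Q P(1) PQ] by simp
  have "P \<in> GL m1" using P Q PQ QP m by (auto simp: GL_iff)
  \<comment> \<open>The congruence obtained has P^t on the left, so the witness is the transpose of
    P.\<close>
  then have "transpose_mat P \<in> GL m1" by (rule transpose_GL)
  moreover have "F1 = transpose_mat P * F2 * transpose_mat (transpose_mat P)"
    using \<open>transpose_mat P * F2 * P = F1\<close> by simp
  ultimately show ?thesis using m by blast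
qed

section \<open>From a congruence to an isomorphism\<close>

lemma (in B_solution) B_relation_congruent:
  assumes R: "R \<in> GL m" and F1: "F1 = transpose_mat R * F * R" and F1GL: "F1 \<in> GL m"
  shows "B_relation A E F1 (z \<boxtimes> smat A R)"
proof -
  note R_mat = GL_carrier[OF R] mat_inv_carrier[OF R] mat_inv_right[OF R] mat_inv_left[OF R]
  note F1_mat = GL_carrier[OF F1GL] mat_inv_carrier[OF F1GL] mat_inv_right[OF F1GL] mat_inv_left[OF F1GL]
  have d [simp]: "dim_row R = m" "dim_col R = m" "dim_row F1 = m" "dim_col F1 = m" "dim_row (mat_inv F1) = m"
    "dim_col (mat_inv F1) = m"
    using R_mat F1_mat by auto
  have RT: "transpose_mat R \<in> carrier_mat m m" using R_mat by auto
  \<comment> \<open>The congruence for the inverses, needed in the second relation: F1^{-1} R^t F is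
    a left inverse of R, hence equals R^{-1}, and multiplying by R on the left and F^{-1} on the
    right gives the claim.\<close>
  have inv: "R * (mat_inv F1 * transpose_mat R) = mat_inv F"
  proof -
    let ?G = "mat_inv F" and ?F1' = "mat_inv F1" and ?R' = "mat_inv R" and ?RT = "transpose_mat R"
    note ac = assoc_mult_mat[of _ m m _ m _ m]
    have "?F1' * ?RT * F * R = 1\<^sub>m m"
      using F1_mat R_mat RT F_mat by (simp add: F1 ac)
    then have "?F1' * ?RT * F * R * ?R' = ?R'" using R_mat by simp
    then have "?F1' * ?RT * F = ?R'"
      using F1_mat R_mat RT F_mat by (simp add: ac)
    then have "R * (?F1' * ?RT * F) * ?G = ?G" using R_mat F_mat by simp
    then show ?thesis using F1_mat R_mat RT F_mat by (simp add: ac)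
  qed
  have zT: "transpose_mat (z \<boxtimes> smat A R) = smat A (transpose_mat R) \<boxtimes> transpose_mat z"
    by (simp add: transpose_mmul_smat)
  have 1: "transpose_mat z \<boxtimes> (smat A E \<boxtimes> (z \<boxtimes> smat A R)) = smat A F \<boxtimes> smat A R"
    by (simp flip: zEz add: mmul_assoc)
  have F1': "transpose_mat R * (F * R) = F1"
    using R_mat RT F_mat by (simp add: F1 assoc_mult_mat[of _ m m _ m _ m])
  have 2: "smat A R \<boxtimes> (smat A (mat_inv F1) \<boxtimes> (smat A (transpose_mat R) \<boxtimes> U)) = smat A (mat_inv F) \<boxtimes> U"
    if "amat A U" "dim_row U = m" for U
    using that by (simp flip: mmul_assoc inv add: smat_mult)
  have 3: "smat A (mat_inv F1) \<boxtimes> (smat A (transpose_mat R) \<boxtimes> (smat A F \<boxtimes> smat A R)) = smat A (1\<^sub>m m)"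
    by (simp add: smat_mult F1' F1_mat)
  show ?thesis
    using z_w by (simp add: B_relation_def zT mmul_assoc 1 2 3 B_inverse_def)
qed

text \<open>The map z \<mapsto> z R exists because z R solves the relations for R^t F2 R. It is
  described on the whole generating matrix so that composites become matrix products; it is used
  once for R and once for its inverse.\<close>

lemma congruent_imp_hom:
  assumes "B_data E F1 n m" "B_data E F2 n m" and R: "R \<in> GL m" and F1: "F1 = transpose_mat R * F2 * R"
  obtains \<phi> where "\<phi> \<in> kalg_hom (B_alg E F1) (B_alg E F2)"
    and "map_mat \<phi> (B_data.Z E F1 n m) = B_data.Z E F2 n m \<boxtimes>\<^bsub>B_alg E F2\<^esub> smat (B_alg E F2) R"
proof -
  interpret C1: B_data E F1 n m by fact
  interpret C2: B_data E F2 n m by fact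
  let ?B2 = "B_alg E F2"
  let ?x = "C2.Z \<boxtimes>\<^bsub>?B2\<^esub> smat ?B2 R"
  have d: "dim_row R = m" "dim_col R = m" using GL_carrier[OF R] by auto
  have rel: "B_relation ?B2 E F1 ?x"
    by (rule C2.Z.B_relation_congruent[OF R F1 C1.F])
  have x: "amat ?B2 ?x" "dim_row ?x = n" "dim_col ?x = m" by (simp_all add: d)
  have eq: "mat n m (\<lambda>(i, j). ?x $$ (i, j)) = ?x"
    by (rule eq_matI) (simp_all add: d)
  have closed: "?x $$ (i, j) \<in> carrier ?B2" if "i < n" "j < m" for i j
    using amatD[OF x(1)] x that by simp
  from rel have rel': "B_relation ?B2 E F1 (mat n m (\<lambda>(i, j). ?x $$ (i, j)))" unfolding eq .
  let ?\<phi> = "induced ?B2 (word_prod ?B2 (\<lambda>i j. ?x $$ (i, j)))"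
  have "?\<phi> \<in> kalg_hom (B_alg E F1) ?B2"
    by (rule C1.B_hom[OF C2.B.kalg_axioms closed rel'])
  moreover have "map_mat ?\<phi> C1.Z = ?x"
    using C1.B_hom_gen[OF C2.B.kalg_axioms closed rel'] d by (intro eq_matI) simp_all
  ultimately show ?thesis by (rule that)
qed

text \<open>The maps for R and its inverse undo each other on generating matrices, by R' R = 1 and R
  R' = 1. Compatibility with the coactions holds because R acts on column indices and the coaction
  on row indices.\<close>

lemma congruent_imp_comodule_iso:
  fixes E F1 F2 :: "'k::comm_ring_1 mat"
  assumes E: "E \<in> GL n" and F1: "F1 \<in> GL m" and F2: "F2 \<in> GL m" and P: "P \<in> GL m"
    and eq: "F1 = P * F2 * transpose_mat P"
  shows "B_galois_isomorphic E F1 F2"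
proof -
  interpret C1: B_coact E F1 n m using E F1 by (simp add: B_coact_def B_data_def)
  interpret C2: B_coact E F2 n m using E F2 by (simp add: B_coact_def B_data_def)
  let ?H = "B_hopf E" and ?B1 = "B_alg E F1" and ?B2 = "B_alg E F2"
  \<comment> \<open>Generators are multiplied by R on the right, which congruates by R^t on the
    left, so R is the transpose of P.\<close>
  define R where "R = transpose_mat P"
  define R' where "R' = mat_inv R"
  have R: "R \<in> GL m" unfolding R_def by (rule transpose_GL[OF P])
  note R_mat = GL_carrier[OF R] mat_inv_carrier[OF R, folded R'_def] mat_inv_right[OF R, folded R'_def]
    mat_inv_left[OF R, folded R'_def]
  have R'GL: "R' \<in> GL m" using R_mat by (auto simp: GL_iff)
  have F1_eq: "F1 = transpose_mat R * F2 * R" by (simp add: R_def eq)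
  have F2_eq: "F2 = transpose_mat R' * F1 * R'"
  proof -
    note ac = assoc_mult_mat[of _ m m _ m _ m]
    have "transpose_mat R' * transpose_mat R = 1\<^sub>m m"
      using R_mat by (simp flip: transpose_mult)
    moreover have "transpose_mat R' * F1 * R' = transpose_mat R' * transpose_mat R * F2 * (R * R')"
      using R_mat C2.F_mat(1) by (simp add: F1_eq ac)
    ultimately show ?thesis using R_mat C2.F_mat(1) by simp
  qed
  have d: "dim_row R = m" "dim_col R = m" "dim_row R' = m" "dim_col R' = m" using R_mat by auto
  obtain \<phi> where \<phi>: "\<phi> \<in> kalg_hom ?B1 ?B2" "map_mat \<phi> C1.Z = C2.Z \<boxtimes>\<^bsub>?B2\<^esub> smat ?B2 R"
    using congruent_imp_hom[OF C1.B_data_axioms C2.B_data_axioms R F1_eq] .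
  obtain \<psi> where \<psi>: "\<psi> \<in> kalg_hom ?B2 ?B1" "map_mat \<psi> C2.Z = C1.Z \<boxtimes>\<^bsub>?B1\<^esub> smat ?B1 R'"
    using congruent_imp_hom[OF C2.B_data_axioms C1.B_data_axioms R'GL F2_eq] .
  note l\<phi> = kalg_hom_linear[OF \<phi>(1)] and l\<psi> = kalg_hom_linear[OF \<psi>(1)]
  note c\<phi> = linear_maps_closed[OF l\<phi>] and c\<psi> = linear_maps_closed[OF l\<psi>]
  have id: "(\<lambda>x. x) \<in> kalg_hom A A" for A :: "('k, 'k B_elem) module" by (rule kalg_homI) (auto simp: linear_maps_ident)
  have \<psi>\<phi>: "\<psi> (\<phi> x) = x" if "x \<in> carrier ?B1" for x
  proof (rule C1.B_hom_eqI[OF kalg_hom_comp[OF \<phi>(1) \<psi>(1)] id _ that])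
    have e: "map_mat \<psi> (map_mat \<phi> C1.Z) = C1.Z"
      by (simp add: \<phi>(2) map_mmul[OF C2.B.kalg_axioms C1.B.kalg_axioms \<psi>(1)] map_smat[OF C2.B.kalg_axioms C1.B.kalg_axioms \<psi>(1)]
          \<psi>(2) d C1.B.mmul_assoc C1.B.smat_mult R_mat)
    show "\<psi> (\<phi> (B_gen E F1 i j)) = B_gen E F1 i j" if "i < n" "j < m" for i j
      using arg_cong[OF e, of "\<lambda>M. M $$ (i, j)"] that by simp
  qed
  have \<phi>\<psi>: "\<phi> (\<psi> x) = x" if "x \<in> carrier ?B2" for x
  proof (rule C2.B_hom_eqI[OF kalg_hom_comp[OF \<psi>(1) \<phi>(1)] id _ that])
    have e: "map_mat \<phi> (map_mat \<psi> C2.Z) = C2.Z"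
      by (simp add: \<psi>(2) map_mmul[OF C1.B.kalg_axioms C2.B.kalg_axioms \<phi>(1)] map_smat[OF C1.B.kalg_axioms C2.B.kalg_axioms \<phi>(1)]
          \<phi>(2) d C2.B.mmul_assoc C2.B.smat_mult R_mat)
    show "\<phi> (\<psi> (B_gen E F2 i j)) = B_gen E F2 i j" if "i < n" "j < m" for i j
      using arg_cong[OF e, of "\<lambda>M. M $$ (i, j)"] that by simp
  qed
  have bij: "bij_betw \<phi> (carrier ?B1) (carrier ?B2)"
    by (rule bij_betwI[of _ _ _ \<psi>]) (auto simp: \<psi>\<phi> \<phi>\<psi> c\<phi> c\<psi>)
  have idH: "id \<in> kalg_hom ?H ?H" using id by (simp add: id_def)
  note tm = tensor_map_kalg_hom[OF C1.H.B.kalg_axioms C1.B.kalg_axioms C1.H.B.kalg_axioms C2.B.kalg_axioms idH \<phi>(1)]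
    tensor_map_pure[OF C1.H.B.kmod_axioms C1.B.kmod_axioms C1.H.B.kmod_axioms C2.B.kmod_axioms linear_maps_id l\<phi>]
  have \<phi>_gen: "\<phi> (B_gen E F1 i j) = (\<Oplus>\<^bsub>?B2\<^esub>l\<in>{..<m}. R $$ (l, j) \<odot>\<^bsub>?B2\<^esub> B_gen E F2 i l)" if ij: "i < n" "j < m" for i j
  proof -
    have "\<phi> (B_gen E F1 i j) = (map_mat \<phi> C1.Z) $$ (i, j)" using ij by simp
    also have "\<dots> = (\<Oplus>\<^bsub>?B2\<^esub>l\<in>{..<m}. R $$ (l, j) \<odot>\<^bsub>?B2\<^esub> C2.Z $$ (i, l))"
      unfolding \<phi>(2) using ij d by (subst C2.B.mmul_smat_index) auto
    also have "\<dots> = (\<Oplus>\<^bsub>?B2\<^esub>l\<in>{..<m}. R $$ (l, j) \<odot>\<^bsub>?B2\<^esub> B_gen E F2 i l)"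
      by (rule C2.B.finsum_cong'[OF refl]) (use ij in auto)
    finally show ?thesis .
  qed
  have "B_coaction E F2 (\<phi> x) = tensor_map ?H ?B2 id \<phi> (B_coaction E F1 x)" if "x \<in> carrier ?B1" for x
  \<comment> \<open>Both sides are algebra maps in x, so it is enough to compare them on
    generators.\<close>
  proof (rule C1.B_hom_eqI[OF kalg_hom_comp[OF \<phi>(1) C2.coaction_hom] kalg_hom_comp[OF C1.coaction_hom tm(1)] _ that])
    fix i j assume ij: "i < n" "j < m"
    have "B_coaction E F2 (\<phi> (B_gen E F1 i j)) = (\<Oplus>\<^bsub>C2.HZ\<^esub>l\<in>{..<m}. R $$ (l, j) \<odot>\<^bsub>C2.HZ\<^esub> C2.coact_gen i l)"
      unfolding \<phi>_gen[OF ij] using ij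
      by (subst linear_maps_finsum[OF C2.B.kmod_axioms C2.HB.TT.kmod_axioms kalg_hom_linear[OF C2.coaction_hom]])
        (auto simp: linear_maps_smult[OF kalg_hom_linear[OF C2.coaction_hom]] C2.coaction_gen C2.coact_gen_closed
          del: equalityI intro!: C2.HB.TT.finsum_cong')
    also have "\<dots> = (\<Oplus>\<^bsub>C2.HZ\<^esub>l\<in>{..<m}. \<Oplus>\<^bsub>C2.HZ\<^esub>k\<in>{..<n}. R $$ (l, j) \<odot>\<^bsub>C2.HZ\<^esub> pure_tensor ?H ?B2 (B_gen E E i k) (B_gen E F2 k l))"
      unfolding C2.coact_gen_def using ij
      by (auto simp: C2.HB.TT.smult_finsum del: equalityI intro!: C2.HB.TT.finsum_cong' C2.HB.TT.finsum_closed)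
    \<comment> \<open>Here the two actions are interchanged: k comes from the coaction, l from the
      multiplication by R.\<close>
    also have "\<dots> = (\<Oplus>\<^bsub>C2.HZ\<^esub>k\<in>{..<n}. \<Oplus>\<^bsub>C2.HZ\<^esub>l\<in>{..<m}. R $$ (l, j) \<odot>\<^bsub>C2.HZ\<^esub> pure_tensor ?H ?B2 (B_gen E E i k) (B_gen E F2 k l))"
      using ij by (intro C2.HB.TT.finsum_swap) auto
    also have "\<dots> = (\<Oplus>\<^bsub>C2.HZ\<^esub>k\<in>{..<n}. tensor_map ?H ?B2 id \<phi> (pure_tensor ?H ?B1 (B_gen E E i k) (B_gen E F1 k j)))"
    proof (rule C2.HB.TT.finsum_cong'[OF refl])
      fix k assume "k \<in> {..<n}"
      then have k: "k < n" by simp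
      have "tensor_map ?H ?B2 id \<phi> (pure_tensor ?H ?B1 (B_gen E E i k) (B_gen E F1 k j)) =
        pure_tensor ?H ?B2 (B_gen E E i k) (\<Oplus>\<^bsub>?B2\<^esub>l\<in>{..<m}. R $$ (l, j) \<odot>\<^bsub>?B2\<^esub> B_gen E F2 k l)"
        using ij k by (simp add: tm(2) \<phi>_gen)
      also have "\<dots> = (\<Oplus>\<^bsub>C2.HZ\<^esub>l\<in>{..<m}. pure_tensor ?H ?B2 (B_gen E E i k) (R $$ (l, j) \<odot>\<^bsub>?B2\<^esub> B_gen E F2 k l))"
        by (rule C2.HB.pure_tensor_finsum_right) (use ij k in auto)
      also have "\<dots> = (\<Oplus>\<^bsub>C2.HZ\<^esub>l\<in>{..<m}. R $$ (l, j) \<odot>\<^bsub>C2.HZ\<^esub> pure_tensor ?H ?B2 (B_gen E E i k) (B_gen E F2 k l))"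
        by (rule C2.HB.TT.finsum_cong'[OF refl]) (use ij k in \<open>auto simp: C2.HB.pure_tensor_smult_right\<close>)
      finally show "(\<Oplus>\<^bsub>C2.HZ\<^esub>l\<in>{..<m}. R $$ (l, j) \<odot>\<^bsub>C2.HZ\<^esub> pure_tensor ?H ?B2 (B_gen E E i k) (B_gen E F2 k l)) =
        tensor_map ?H ?B2 id \<phi> (pure_tensor ?H ?B1 (B_gen E E i k) (B_gen E F1 k j))" by simp
    qed (use ij in \<open>auto simp: tm(2) c\<phi>\<close>)
    also have "\<dots> = tensor_map ?H ?B2 id \<phi> (C1.coact_gen i j)"
      unfolding C1.coact_gen_def
      by (rule linear_maps_finsum[OF C1.HB.TT.kmod_axioms C2.HB.TT.kmod_axioms kalg_hom_linear[OF tm(1)], symmetric])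
        (use ij in auto)
    finally show "B_coaction E F2 (\<phi> (B_gen E F1 i j)) = tensor_map ?H ?B2 id \<phi> (B_coaction E F1 (B_gen E F1 i j))"
      using ij by (simp add: C1.coaction_gen)
  qed
  then have "\<phi> \<in> comodule_algebra_iso ?H ?B1 (B_coaction E F1) ?B2 (B_coaction E F2)"
    using \<phi>(1) bij by (simp add: comodule_algebra_iso_def ring_iso_def kalg_hom_def)
  then show ?thesis by (auto simp: B_galois_isomorphic_def)
qed

theorem theorem7:
  fixes E F1 F2 :: "'k::comm_ring_1 mat" and n m1 m2 :: nat
  assumes "principal_domain (ring_of_type_algebra :: 'k ring)"
    and "n \<ge> 2" and "m1 \<ge> 2" and "m2 \<ge> 2"
    and "E \<in> GL n" and "F1 \<in> GL m1" and "F2 \<in> GL m2"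
    and "B_faithfully_flat E F1" and "B_faithfully_flat E F2"
  shows "B_galois_isomorphic E F1 F2 \<longleftrightarrow>
    m1 = m2 \<and> (\<exists>P \<in> GL m1. F1 = P * F2 * transpose_mat P)"
proof
  assume "B_galois_isomorphic E F1 F2"
  then obtain \<phi> where "\<phi> \<in> comodule_algebra_iso (B_hopf E) (B_alg E F1) (B_coaction E F1) (B_alg E F2) (B_coaction E F2)"
    by (auto simp: B_galois_isomorphic_def)
  then show "m1 = m2 \<and> (\<exists>P \<in> GL m1. F1 = P * F2 * transpose_mat P)"
    using assms by (intro comodule_iso_imp_congruent[of E n F1 m1 F2 m2 \<phi>])
      (auto simp: comodule_algebra_iso_def ring_iso_def kalg_hom_def)
next
  assume "m1 = m2 \<and> (\<exists>P \<in> GL m1. F1 = P * F2 * transpose_mat P)"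
  then show "B_galois_isomorphic E F1 F2"
    using assms congruent_imp_comodule_iso[of E n F1 m1 F2] by blast
qed

end
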